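(* Let $V,W$ be real vector spaces of dimensions $m$ and $n$ respectively. (1) If $\min(m,n)\le2$, then $\mathrm{Hom}_{\mathcal{AC}}(S_+(V),S_+(W))$ and $\mathrm{Sym}^2(S_+(V))$ are SDR sets and $S_+(V)\otimes S_+(W)$ is spectrahedral. (2) If $m=n=3$, then $S_+(V)\otimes S_+(W)$ has a non-exposed face and in particular is not a spectrahedron.
   Context: For a finite-dimensional real vector space $W$, $S_+(W)\subseteq\mathrm{Sym}^2(W)$ is the cone of sums of squares of elements of $W$ (the PSD cone). $\mathrm{Hom}_{\mathcal{AC}}(C_1,C_2)$, for cones $C_i\subseteq LC_i$, is the cone of linear maps $f:LC_1\to LC_2$ with $f(C_1)\subseteq C_2$, inside $\mathrm{Hom}(LC_1,LC_2)$. $C_1\otimes C_2:=\mathrm{Cone}\{c_1\otimes c_2:c_i\in C_i\}\subseteq LC_1\otimes LC_2$. $\mathrm{Sym}^2(C):=\mathrm{Cone}\{v_1v_2:v_i\in C\}\subseteq\mathrm{Sym}^2(LC)$. A closed, pointed, full-dimensional cone $C\subseteq LC$ is spectrahedral if there are a real vector space $U$ and an injective linear map $\psi:LC\to\mathrm{Sym}^2(U^* )$ with $C=\psi^{-1}(S_+(U^* ))$. More generally a spectrahedron in $E\cong\mathbb{R}^N$ is a set $\{x:M_0+\sum x_iM_i\succeq0\}$ with $M_i$ symmetric matrices, and an SDR set is a set of the form $\{x:\exists y\in\mathbb{R}^k,\ M_0+\sum x_iM_i+\sum y_jN_j\succeq0\}$ with $M_i,N_j$ symmetric matrices. A face of a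 cone $C$ is a subcone $F\subseteq C$ such that $c_1,c_2\in C$, $c_1+c_2\in F$ imply $c_1,c_2\in F$; it is exposed if $F=C\cap\ker\phi$ for some linear functional $\phi\ge0$ on $C$.
   Formalization: That Sym²(S₊(V)) is an SDR set is stated only for m ≤ 2 (the case W = V), not for every m with min(m,n) ≤ 2; the literal claim fails, e.g. for n = 1 and m ≥ 6, since nonnegative biquadratic forms on R³×R³ are not SDR. *)

theory Defs
  imports "HOL-Analysis.Analysis"
begin

definition has_dimension :: "'a::real_vector itself \<Rightarrow> nat \<Rightarrow> bool" where
  "has_dimension _ n \<longleftrightarrow>
     (\<exists>B::'a set. finite B \<and> independent B \<and> span B = UNIV \<and> card B = n)"


text \<open>
  Symmetric squares and tensor products are given by their universal properties, so that nothing
  depends on bases or on a particular model: \<open>s x y\<close> is the product \<open>xy\<close> in \<open>Sym\<^sup>2\<close>, and \<open>t x y\<close> is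
  \<open>x \<otimes> y\<close>. It suffices to test against real-valued bilinear maps: this says that the transpose of
  the canonical linear map from the symmetric square (tensor product) is bijective, hence so is
  that map itself.
\<close>

definition is_symmetric_square ::
    "('a::real_vector \<Rightarrow> 'a \<Rightarrow> 's::real_vector) \<Rightarrow> bool" where
  "is_symmetric_square s \<longleftrightarrow>
     bilinear s \<and> (\<forall>x y. s x y = s y x) \<and>
     (\<forall>b::'a \<Rightarrow> 'a \<Rightarrow> real. bilinear b \<and> (\<forall>x y. b x y = b y x) \<longrightarrow>
        (\<exists>!f. linear f \<and> (\<forall>x y. f (s x y) = b x y)))"

definition is_tensor_product ::
    "('a::real_vector \<Rightarrow> 'b::real_vector \<Rightarrow> 'c::real_vector) \<Rightarrow> bool" where
  "is_tensor_product t \<longleftrightarrow>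
     bilinear t \<and>
     (\<forall>b::'a \<Rightarrow> 'b \<Rightarrow> real. bilinear b \<longrightarrow>
        (\<exists>!f. linear f \<and> (\<forall>x y. f (t x y) = b x y)))"


text \<open>
  Each cone lives in the vector space given by its type: \<open>LC\<close> is \<open>UNIV\<close>.
\<close>

definition psd_cone :: "('a::real_vector \<Rightarrow> 'a \<Rightarrow> 's::real_vector) \<Rightarrow> 's set" where
  "psd_cone s = {\<Sum>i<k. s (v i) (v i) | (k::nat) v. True}"

definition tensor_cone ::
    "('a::real_vector \<Rightarrow> 'b::real_vector \<Rightarrow> 'c::real_vector) \<Rightarrow> 'a set \<Rightarrow> 'b set \<Rightarrow> 'c set" where
  "tensor_cone t C\<^sub>1 C\<^sub>2 = convex_cone hull {t c\<^sub>1 c\<^sub>2 | c\<^sub>1 c\<^sub>2. c\<^sub>1 \<in> C\<^sub>1 \<and> c\<^sub>2 \<in> C\<^sub>2}"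

definition sym2_cone ::
    "('a::real_vector \<Rightarrow> 'a \<Rightarrow> 's::real_vector) \<Rightarrow> 'a set \<Rightarrow> 's set" where
  "sym2_cone s C = convex_cone hull {s v\<^sub>1 v\<^sub>2 | v\<^sub>1 v\<^sub>2. v\<^sub>1 \<in> C \<and> v\<^sub>2 \<in> C}"

text \<open>
  The space \<open>Hom(LC\<^sub>1, LC\<^sub>2)\<close> is the type of bounded linear maps; for finite-dimensional spaces,
  whatever their norms, these are all the linear maps.
\<close>

definition hom_cone ::
    "'a::real_normed_vector set \<Rightarrow> 'b::real_normed_vector set \<Rightarrow> ('a \<Rightarrow>\<^sub>L 'b) set" where
  "hom_cone C\<^sub>1 C\<^sub>2 = {f. blinfun_apply f ` C\<^sub>1 \<subseteq> C\<^sub>2}"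


text \<open>
  A \<open>d \<times> d\<close> matrix is a function \<open>nat \<Rightarrow> nat \<Rightarrow> real\<close> of which only the entries with
  indices below \<open>d\<close> matter.
\<close>

definition sym_mat :: "nat \<Rightarrow> (nat \<Rightarrow> nat \<Rightarrow> real) \<Rightarrow> bool" where
  "sym_mat d A \<longleftrightarrow> (\<forall>i<d. \<forall>j<d. A i j = A j i)"

definition psd_mat :: "nat \<Rightarrow> (nat \<Rightarrow> nat \<Rightarrow> real) \<Rightarrow> bool" where
  "psd_mat d A \<longleftrightarrow>
     sym_mat d A \<and> (\<forall>x::nat \<Rightarrow> real. 0 \<le> (\<Sum>i<d. \<Sum>j<d. x i * A i j * x j))"

text \<open>
  Here \<open>B\<close> is the basis giving the coordinates \<open>E \<cong> \<real>\<^sup>N\<close>; the \<open>b\<close>-coordinate of \<open>x\<close> is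
  \<open>representation B x b\<close>. The choice of \<open>B\<close> is immaterial.
\<close>

definition spectrahedron :: "'e::real_vector set \<Rightarrow> bool" where
  "spectrahedron S \<longleftrightarrow>
     (\<exists>(B::'e set) d M\<^sub>0 M.
        finite B \<and> independent B \<and> span B = UNIV \<and>
        sym_mat d M\<^sub>0 \<and> (\<forall>b\<in>B. sym_mat d (M b)) \<and>
        S = {x. psd_mat d (\<lambda>i j. M\<^sub>0 i j + (\<Sum>b\<in>B. representation B x b * M b i j))})"

definition SDR_set :: "'e::real_vector set \<Rightarrow> bool" where
  "SDR_set S \<longleftrightarrow>
     (\<exists>(B::'e set) d k M\<^sub>0 M N.
        finite B \<and> independent B \<and> span B = UNIV \<and>
        sym_mat d M\<^sub>0 \<and> (\<forall>b\<in>B. sym_mat d (M b)) \<and> (\<forall>l<k. sym_mat d (N l)) \<and>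
        S = {x. \<exists>y::nat \<Rightarrow> real.
               psd_mat d (\<lambda>i j. M\<^sub>0 i j + (\<Sum>b\<in>B. representation B x b * M b i j)
                                 + (\<Sum>l<k. y l * N l i j))})"

text \<open>
  In the definition of a spectrahedral cone we take \<open>U = \<real>\<^sup>k\<close>, so that \<open>Sym\<^sup>2(U\<^sup>*)\<close> is the space
  of symmetric \<open>k \<times> k\<close> matrices, with the product \<open>uu'\<close> of \<open>u, u' \<in> U\<^sup>*\<close> the symmetrisation of
  \<open>u u'\<^sup>T\<close>.
\<close>

definition sos_mat :: "nat \<Rightarrow> (nat \<Rightarrow> nat \<Rightarrow> real) \<Rightarrow> bool" where
  "sos_mat k A \<longleftrightarrow>
     (\<exists>(r::nat) (u::nat \<Rightarrow> nat \<Rightarrow> real). \<forall>i<k. \<forall>j<k. A i j = (\<Sum>p<r. u p i * u p j))"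

definition spectrahedral_cone :: "'e::real_normed_vector set \<Rightarrow> bool" where
  "spectrahedral_cone C \<longleftrightarrow>
     convex_cone C \<and> closed C \<and> (\<forall>x. x \<in> C \<and> - x \<in> C \<longrightarrow> x = 0) \<and> span C = UNIV \<and>
     (\<exists>k (\<psi> :: 'e \<Rightarrow> nat \<Rightarrow> nat \<Rightarrow> real).
        (\<forall>i<k. \<forall>j<k. linear (\<lambda>x. \<psi> x i j)) \<and>
        (\<forall>x. sym_mat k (\<psi> x)) \<and>
        (\<forall>x y. (\<forall>i<k. \<forall>j<k. \<psi> x i j = \<psi> y i j) \<longrightarrow> x = y) \<and>
        C = {x. sos_mat k (\<psi> x)})"


text \<open>
  \<open>convex_cone\<close> excludes the empty set.
\<close>

definition cone_face :: "'e::real_vector set \<Rightarrow> 'e set \<Rightarrow> bool" where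
  "cone_face C F \<longleftrightarrow>
     convex_cone F \<and> F \<subseteq> C \<and>
     (\<forall>c\<^sub>1\<in>C. \<forall>c\<^sub>2\<in>C. c\<^sub>1 + c\<^sub>2 \<in> F \<longrightarrow> c\<^sub>1 \<in> F \<and> c\<^sub>2 \<in> F)"

definition exposed_cone_face :: "'e::real_vector set \<Rightarrow> 'e set \<Rightarrow> bool" where
  "exposed_cone_face C F \<longleftrightarrow>
     cone_face C F \<and>
     (\<exists>\<phi>::'e \<Rightarrow> real. linear \<phi> \<and> (\<forall>c\<in>C. 0 \<le> \<phi> c) \<and> F = C \<inter> {x. \<phi> x = 0})"

end

theory Submission
  imports Defs
begin

text \<open>
  Write \<open>x \<in> \<real>\<^sup>m\<close> and \<open>y \<in> \<real>\<^sup>n\<close> for coordinates of \<open>V\<close> and \<open>W\<close>. A linear functional on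
  \<open>Sym\<^sup>2 V \<otimes> Sym\<^sup>2 W\<close> is a biquadratic form \<open>q(x, y)\<close>, and it is nonnegative on the cone
  \<open>S\<^sub>+(V) \<otimes> S\<^sub>+(W)\<close>, which is spanned by the products \<open>x\<^sup>2 \<otimes> y\<^sup>2\<close>, iff \<open>q \<ge> 0\<close> everywhere; a linear map
  \<open>Sym\<^sup>2 V \<rightarrow> Sym\<^sup>2 W\<close> is positive under the same condition on its associated form.

  When \<open>m \<le> 2\<close>, both sides of this duality are governed by positive semidefinite matrices. An element
  of \<open>Sym\<^sup>2 V \<otimes> Sym\<^sup>2 W\<close> is a block matrix \<open>[P, Q; Q, R]\<close> with symmetric blocks, and such a matrix is a sum
  of rank one products as soon as it is positive semidefinite (\<open>block_psd_separable\<close>): if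
  \<open>Q y = \<lambda> P y\<close>, then \<open>(1, \<lambda>) \<otimes> P y\<close> is a product vector in the range of the matrix, and subtracting the right
  multiple of its square lowers the rank without leaving the class. On the dual side, a nonnegative
  form \<open>x\<^sub>0\<^sup>2 A(u) + 2 x\<^sub>0 x\<^sub>1 B(u) + x\<^sub>1\<^sup>2 C(u)\<close> is a sum of squares of bilinear forms (\<open>pencil_sos\<close>): subtract
  a multiple of \<open>|x|\<^sup>2 |u|\<^sup>2\<close> until a zero appears, rotate it to \<open>x = (1, 0)\<close>, and complete the square there.
  The first result presents \<open>S\<^sub>+(V) \<otimes> S\<^sub>+(W)\<close> as a spectrahedral cone, and presents \<open>Sym\<^sup>2(S\<^sub>+(V))\<close>, the image of
  \<open>S\<^sub>+(V) \<otimes> S\<^sub>+(V)\<close> under symmetrisation, as a projection of one. The second presents the cone of positive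
  maps as the set of \<open>A, B, C\<close> for which some skew \<open>K\<close> makes \<open>[A, B + K; B - K, C]\<close> positive
  semidefinite. The case \<open>n \<le> 2\<close> follows by exchanging the roles of \<open>x\<close> and \<open>y\<close>.

  When \<open>m = n = 3\<close>, consider the form
  \<open>p(x, y) = 4 |x|\<^sup>2 |y|\<^sup>2 - 3 (x \<cdot> y)\<^sup>2 - 3 (x\<^sub>1\<^sup>2 y\<^sub>2\<^sup>2 + x\<^sub>2\<^sup>2 y\<^sub>3\<^sup>2 + x\<^sub>3\<^sup>2 y\<^sub>1\<^sup>2)\<close>.
  Its nonnegativity is the inequality \<open>a\<^sup>2b + b\<^sup>2c + c\<^sup>2a + abc \<le> 4/27 (a + b + c)\<^sup>3\<close> for the squares of the
  coordinates of \<open>y\<close>, and it has exactly ten zeros in the product of two real projective planes. The ten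
  products \<open>x\<^sup>2 \<otimes> y\<^sup>2\<close> at these zeros are linearly independent, so any nine of them span a face. This face is
  not exposed if the tenth is \<open>x = y = (1, 1, 1)\<close>: a nonnegative form with the nine zeros has vanishing
  derivatives there, and these linear conditions imply that it vanishes at the tenth zero too
  (\<open>functional_vanishes\<close>). Finally, all faces of a spectrahedron are exposed, because its supporting
  functionals include \<open>u\<^sup>T A(x) u\<close> for the vectors \<open>u\<close> in the kernel of \<open>A\<close> at a point of the face; the instance
  needed here is \<open>spectrahedron_cone_continues\<close>.
\<close>

section \<open>Quadratic forms on finite index sets\<close>

lemma linear_term_zero_of_nonneg:
  fixes b c :: real
  assumes "\<And>t. 0 \<le> 2 * t * b + t\<^sup>2 * c"
  shows "b = 0"
proof (rule ccontr)
  assume b: "b \<noteq> 0"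
  define k where "k = \<bar>c\<bar> + 1"
  have k: "k > 0" "c < k" by (auto simp: k_def)
  have "2 * (- b / k) * b + (- b / k)\<^sup>2 * c = b\<^sup>2 / k * (c / k - 2)"
    using k by (simp add: field_simps power2_eq_square)
  also have "\<dots> < 0"
  proof -
    have "c / k < 1" using k by (simp add: divide_less_eq)
    then have "c / k - 2 < 0" by linarith
    moreover have "b\<^sup>2 / k > 0" using b k by simp
    ultimately show ?thesis by (rule mult_pos_neg[rotated])
  qed
  finally show False using assms[of "- b / k"] by linarith
qed

definition bform :: "'i set \<Rightarrow> ('i \<Rightarrow> 'i \<Rightarrow> real) \<Rightarrow> ('i \<Rightarrow> real) \<Rightarrow> ('i \<Rightarrow> real) \<Rightarrow> real" where
  "bform I A u v = (\<Sum>i\<in>I. \<Sum>j\<in>I. u i * A i j * v j)"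

definition dot :: "'i set \<Rightarrow> ('i \<Rightarrow> real) \<Rightarrow> ('i \<Rightarrow> real) \<Rightarrow> real" where
  "dot I w u = (\<Sum>i\<in>I. w i * u i)"

definition symmetric_on :: "'i set \<Rightarrow> ('i \<Rightarrow> 'i \<Rightarrow> real) \<Rightarrow> bool" where
  "symmetric_on I A \<longleftrightarrow> (\<forall>i\<in>I. \<forall>j\<in>I. A i j = A j i)"

lemma symmetric_on_subset: "symmetric_on I A \<Longrightarrow> J \<subseteq> I \<Longrightarrow> symmetric_on J A"
  by (auto simp: symmetric_on_def)

lemma bform_commute: "symmetric_on I A \<Longrightarrow> bform I A u v = bform I A v u"
  unfolding bform_def symmetric_on_def
  by (subst sum.swap, intro sum.cong refl) (simp add: mult_ac)

lemma bform_comb_left: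
  "bform I A (\<lambda>i. a * u i + b * w i) v = a * bform I A u v + b * bform I A w v"
  by (simp add: bform_def sum_distrib_left sum.distrib algebra_simps)

lemma bform_comb_right:
  "bform I A u (\<lambda>i. a * v i + b * w i) = a * bform I A u v + b * bform I A u w"
  by (simp add: bform_def sum_distrib_left sum.distrib algebra_simps)

lemma bform_shift:
  assumes "symmetric_on I A"
  shows "bform I A (\<lambda>i. u i + c * y i) (\<lambda>i. u i + c * y i)
       = bform I A u u + 2 * c * bform I A u y + c\<^sup>2 * bform I A y y"
  using bform_comb_left[of I A 1 u c y] bform_comb_right[of I A _ 1 u c y] bform_commute[OF assms, of y u]
  by (simp add: algebra_simps power2_eq_square)

lemma bform_scale: "bform I A (\<lambda>i. c * u i) (\<lambda>i. c * u i) = c\<^sup>2 * bform I A u u"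
  using bform_comb_left[of I A c u 0 u] bform_comb_right[of I A _ c u 0 u]
  by (simp add: power2_eq_square)

lemma bform_cong: "(\<And>i. i \<in> I \<Longrightarrow> u i = u' i) \<Longrightarrow> (\<And>i. i \<in> I \<Longrightarrow> v i = v' i) \<Longrightarrow>
    bform I A u v = bform I A u' v'"
  by (simp add: bform_def cong: sum.cong)

lemma bform_lincomb_mat:
  "bform I (\<lambda>i j. a * A i j + b * B i j) u v = a * bform I A u v + b * bform I B u v"
  by (simp add: bform_def sum_distrib_left sum.distrib algebra_simps)

lemma bform_rank_one: "bform I (\<lambda>i j. w i * z j) u v = dot I w u * dot I z v"
  by (simp add: bform_def dot_def sum_product mult_ac)

lemma bform_subtract_rank_one:
  "bform I (\<lambda>i j. A i j - c * (w i * z j)) u v = bform I A u v - c * dot I w u * dot I z v"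
  using bform_lincomb_mat[of I 1 A "-c" "\<lambda>i j. w i * z j" u v] by (simp add: bform_rank_one)

lemma dot_row: "dot I (\<lambda>i. \<Sum>j\<in>I. A i j * y j) u = bform I A u y"
  by (simp add: dot_def bform_def sum_distrib_left sum_distrib_right mult_ac)

lemma dot_shift: "dot I w (\<lambda>i. u i + c * y i) = dot I w u + c * dot I w y"
  by (simp add: dot_def sum_distrib_left sum.distrib algebra_simps)

lemma psd_kernel:
  assumes "symmetric_on I A" and "\<And>u. 0 \<le> bform I A u u" and "bform I A y y = 0"
  shows "bform I A u y = 0"
proof (rule linear_term_zero_of_nonneg[where c = "bform I A u u"])
  fix t
  show "0 \<le> 2 * t * bform I A u y + t\<^sup>2 * bform I A u u"
    using assms(2)[of "\<lambda>i. y i + t * u i"] bform_shift[OF assms(1), of y t u]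
      bform_commute[OF assms(1), of y u] assms(3) by simp
qed

text \<open>
  The representative of \<open>u\<close> modulo \<open>y\<close> whose \<open>k\<close>-th coordinate is \<open>0\<close>. A form with \<open>y\<close> in its kernel factors
  through it, which makes inductions on the index set possible without changing bases.
\<close>

definition elim :: "('i \<Rightarrow> real) \<Rightarrow> 'i \<Rightarrow> ('i \<Rightarrow> real) \<Rightarrow> 'i \<Rightarrow> real" where
  "elim y k u = (\<lambda>i. u i - u k / y k * y i)"

lemma bform_elim:
  assumes "finite I" "k \<in> I" "y k \<noteq> 0" "symmetric_on I A" "\<And>u. bform I A u y = 0"
  shows "bform I A u v = bform (I - {k}) A (elim y k u) (elim y k v)"
proof -
  have e: "elim y k u = (\<lambda>i. 1 * u i + (- (u k / y k)) * y i)" for u by (simp add: elim_def)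
  have "bform I A (elim y k u) (elim y k v) = bform I A u v"
    unfolding e bform_comb_left bform_comb_right
    using assms(5) bform_commute[OF assms(4), of y] by simp
  moreover have "bform I A (elim y k u) (elim y k v) = bform (I - {k}) A (elim y k u) (elim y k v)"
    unfolding bform_def using assms(1-3)
    by (intro sum.mono_neutral_cong_right sum.mono_neutral_right)
       (auto simp: elim_def intro!: sum.mono_neutral_right)
  ultimately show ?thesis by simp
qed

lemma dot_elim:
  assumes "finite I" "k \<in> I" "y k \<noteq> 0"
  shows "dot (I - {k}) w (elim y k u) = dot I (w(k := - dot (I - {k}) w y / y k)) u"
proof -
  have "dot I (w(k := - dot (I - {k}) w y / y k)) u
      = - dot (I - {k}) w y / y k * u k + dot (I - {k}) w u"
    using assms unfolding dot_def by (subst sum.remove[of I k]) (auto intro!: sum.cong)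
  moreover have "elim y k u = (\<lambda>i. u i + (- (u k / y k)) * y i)" by (simp add: elim_def)
  ultimately show ?thesis by (simp only: dot_shift) (simp add: field_simps)
qed

lemma bform_restrict:
  assumes "finite I" "k \<in> I"
  shows "bform (I - {k}) A u v = bform I A (u(k := 0)) (v(k := 0))"
  unfolding bform_def using assms
  by (intro sum.mono_neutral_cong_left) (auto intro!: sum.mono_neutral_cong_left)

text \<open>
  Vectors are functions on the whole index type; forcing them to vanish outside \<open>I\<close> makes the sphere
  compact in the product topology.
\<close>

definition usphere :: "'i set \<Rightarrow> ('i \<Rightarrow> real) set" where
  "usphere I = {u. (\<forall>i. i \<notin> I \<longrightarrow> u i = 0) \<and> (\<Sum>i\<in>I. (u i)\<^sup>2) = 1}"

lemma continuous_on_coord: "continuous_on S (\<lambda>u. u i :: real)"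
  by (rule continuous_on_subset[OF continuous_on_product_coordinates]) simp

lemma compact_usphere:
  fixes I :: "'i set"
  assumes "finite I"
  shows "compact (usphere I)"
proof -
  define K :: "('i \<Rightarrow> real) set" where "K = PiE UNIV (\<lambda>i. if i \<in> I then {-1..1} else {0})"
  have "compactin (product_topology (\<lambda>i. euclidean) UNIV) K"
    unfolding K_def compactin_PiE by auto
  then have K: "compact K" by (simp add: euclidean_product_topology)
  have cl: "closed {u. (\<Sum>i\<in>I. (u i)\<^sup>2) = (1::real)}"
    by (intro closed_Collect_eq continuous_intros continuous_on_coord)
  have "usphere I = K \<inter> {u. (\<Sum>i\<in>I. (u i)\<^sup>2) = 1}"
  proof (intro set_eqI iffI)
    fix u assume u: "u \<in> usphere I"
    have "(u i)\<^sup>2 \<le> 1" if "i \<in> I" for i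
      using u member_le_sum[OF that, of "\<lambda>i. (u i)\<^sup>2"] assms by (auto simp: usphere_def)
    then have "u i \<in> {-1..1}" if "i \<in> I" for i
      using that by (auto simp: abs_square_le_1 abs_le_iff)
    then show "u \<in> K \<inter> {u. (\<Sum>i\<in>I. (u i)\<^sup>2) = 1}"
      using u by (auto simp: usphere_def K_def PiE_iff)
  qed (auto simp: usphere_def K_def PiE_iff split: if_splits, (metis singletonD)?)
  then show ?thesis using K cl by (simp add: compact_Int_closed)
qed

lemma usphere_nonempty: "I \<noteq> {} \<Longrightarrow> finite I \<Longrightarrow> usphere I \<noteq> {}"
proof -
  assume "I \<noteq> {}" "finite I"
  then obtain k where "k \<in> I" by auto
  then have "(\<lambda>i. of_bool (i = k)) \<in> usphere I"
    using \<open>finite I\<close> by (auto simp: usphere_def of_bool_def if_distrib[of "\<lambda>x. x\<^sup>2"] cong: if_cong)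
  then show ?thesis by auto
qed

lemma usphere_normalize:
  assumes "finite I" "i \<in> I" "u i \<noteq> 0"
  obtains r v where "r > 0" "v \<in> usphere I" "\<And>j. j \<in> I \<Longrightarrow> u j = r * v j" "r\<^sup>2 = (\<Sum>i\<in>I. (u i)\<^sup>2)"
proof -
  define r where "r = sqrt (\<Sum>i\<in>I. (u i)\<^sup>2)"
  have s: "(\<Sum>i\<in>I. (u i)\<^sup>2) > 0"
    using assms by (intro sum_pos2[where i = i]) auto
  then have r: "r > 0" "r\<^sup>2 = (\<Sum>i\<in>I. (u i)\<^sup>2)" by (auto simp: r_def)
  show ?thesis
  proof
    show "(\<lambda>j. if j \<in> I then u j / r else 0) \<in> usphere I"
      using r s by (auto simp: usphere_def power_divide sum_divide_distrib[symmetric] cong: sum.cong)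
  qed (use r in auto)
qed

lemma usphere_nonzero: "u \<in> usphere I \<Longrightarrow> \<exists>k\<in>I. u k \<noteq> 0"
proof (rule ccontr)
  assume "u \<in> usphere I" "\<not> (\<exists>k\<in>I. u k \<noteq> 0)"
  then have "(\<Sum>i\<in>I. (u i)\<^sup>2) = 0" "(\<Sum>i\<in>I. (u i)\<^sup>2) = 1" by (simp_all add: usphere_def)
  then show False by simp
qed

lemma bform_homogeneous:
  assumes "finite I" "i \<in> I" "u i \<noteq> 0"
  shows "\<exists>v\<in>usphere I. \<forall>A. bform I A u u = (\<Sum>i\<in>I. (u i)\<^sup>2) * bform I A v v"
proof -
  obtain r v where v: "v \<in> usphere I" "\<And>j. j \<in> I \<Longrightarrow> u j = r * v j" "r\<^sup>2 = (\<Sum>i\<in>I. (u i)\<^sup>2)"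
    using usphere_normalize[OF assms(1,2), of u] assms(3) by metis
  have "bform I A u u = r\<^sup>2 * bform I A v v" for A
    using bform_cong[of I u "\<lambda>j. r * v j" u "\<lambda>j. r * v j" A] bform_scale[of I A r v] v(2) by simp
  then show ?thesis using v(1,3) by auto
qed

lemma continuous_on_bform [continuous_intros]: "continuous_on S (\<lambda>u. bform I A u u)"
  unfolding bform_def by (intro continuous_intros continuous_on_coord)

section \<open>Positive block matrices with symmetric blocks are separable\<close>

text \<open>
  A maximiser \<open>y\<close> of the Rayleigh quotient \<open>Q(u, u) / P(u, u)\<close> on the sphere, with maximum \<open>\<lambda>\<close>, is a zero of the
  positive semidefinite form \<open>\<lambda> P - Q\<close>, hence in its kernel. If \<open>P\<close> is singular, a kernel vector of \<open>P\<close> serves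
  instead.
\<close>

lemma generalized_eigenvector:
  assumes I: "finite I" "I \<noteq> {}" and sym: "symmetric_on I P" "symmetric_on I Q"
    and psd: "\<And>u. 0 \<le> bform I P u u"
    and ker: "\<And>u y. bform I P y y = 0 \<Longrightarrow> bform I Q u y = 0"
  shows "\<exists>k\<in>I. \<exists>y l. y k \<noteq> 0 \<and> (\<forall>u. bform I Q u y = l * bform I P u y)"
proof -
  show ?thesis
  proof (cases "\<exists>y\<in>usphere I. bform I P y y = 0")
    case True
    then obtain y where y: "y \<in> usphere I" "bform I P y y = 0" by auto
    obtain k where k: "k \<in> I" "y k \<noteq> 0" using usphere_nonzero[OF y(1)] by auto
    have "bform I Q u y = 0 * bform I P u y" for u using ker[OF y(2)] by simp
    then show ?thesis using k by blast
  next
    case False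
    have cont: "continuous_on (usphere I) (\<lambda>u. bform I Q u u / bform I P u u)"
      using False by (intro continuous_intros) auto
    obtain y where y: "y \<in> usphere I"
      and max: "\<And>u. u \<in> usphere I \<Longrightarrow> bform I Q u u / bform I P u u \<le> bform I Q y y / bform I P y y"
      using continuous_attains_sup[OF compact_usphere[OF I(1)] usphere_nonempty[OF I(2,1)] cont] by auto
    define l where "l = bform I Q y y / bform I P y y"
    have pos: "bform I P u u > 0" if "u \<in> usphere I" for u
      using psd[of u] False that by (metis less_eq_real_def)
    let ?M = "\<lambda>i j. l * P i j + (-1) * Q i j"
    have M: "bform I ?M u v = l * bform I P u v - bform I Q u v" for u v
      by (subst bform_lincomb_mat) simp
    have "0 \<le> bform I ?M u u" for u
    proof (cases "\<exists>i\<in>I. u i \<noteq> 0")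
      case True
      then obtain i where "i \<in> I" "u i \<noteq> 0" by auto
      then obtain v where v: "v \<in> usphere I"
        and u: "bform I ?M u u = (\<Sum>i\<in>I. (u i)\<^sup>2) * bform I ?M v v"
        using bform_homogeneous[OF I(1), of i u] \<open>i \<in> I\<close> \<open>u i \<noteq> 0\<close> by blast
      have "0 \<le> bform I ?M v v"
        using max[OF v] pos[OF v] unfolding M by (simp add: l_def divide_le_eq)
      then show ?thesis unfolding u by (intro mult_nonneg_nonneg sum_nonneg) auto
    next
      case False
      then show ?thesis by (simp add: bform_def)
    qed
    moreover have "symmetric_on I ?M" using sym by (simp add: symmetric_on_def)
    moreover have "bform I ?M y y = 0" unfolding M using pos[OF y] by (simp add: l_def)
    ultimately have "bform I ?M u y = 0" for u using psd_kernel[of I ?M y u] by blast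
    then have ev: "bform I Q u y = l * bform I P u y" for u unfolding M by simp
    obtain k where k: "k \<in> I" "y k \<noteq> 0" using usphere_nonzero[OF y] by auto
    show ?thesis using k ev by blast
  qed
qed

text \<open>
  Positivity of the block matrix \<open>[P, Q; Q, R]\<close>, for a symmetric \<open>Q\<close>.
\<close>

definition block_psd :: "'i set \<Rightarrow> ('i \<Rightarrow> 'i \<Rightarrow> real) \<Rightarrow> ('i \<Rightarrow> 'i \<Rightarrow> real) \<Rightarrow> ('i \<Rightarrow> 'i \<Rightarrow> real) \<Rightarrow> bool" where
  "block_psd I P Q R \<longleftrightarrow> (\<forall>u v. 0 \<le> bform I P u u + 2 * bform I Q u v + bform I R v v)"

lemma block_psd_shift:
  assumes sym: "symmetric_on I P" "symmetric_on I Q"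
  shows "bform I P (\<lambda>i. u i + c * y i) (\<lambda>i. u i + c * y i) + 2 * bform I Q (\<lambda>i. u i + c * y i) v
       = bform I P u u + 2 * bform I Q u v + 2 * c * (bform I P u y + bform I Q v y) + c\<^sup>2 * bform I P y y"
  using bform_shift[OF sym(1), of u c y] bform_comb_left[of I Q 1 u c y v] bform_commute[OF sym(2), of y v]
  by (simp add: algebra_simps)

lemma block_psd_first_kernel:
  assumes sym: "symmetric_on I P" "symmetric_on I Q" and psd: "block_psd I P Q R"
    and y: "bform I P y y = 0"
  shows "bform I Q u y = 0"
proof (rule linear_term_zero_of_nonneg[where c = "bform I R u u"])
  fix t
  have "bform I Q y (\<lambda>i. t * u i) = t * bform I Q y u"
    using bform_comb_right[of I Q y t u 0 u] by simp
  then show "0 \<le> 2 * t * bform I Q u y + t\<^sup>2 * bform I R u u"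
    using psd[unfolded block_psd_def, rule_format, of y "\<lambda>i. t * u i"] y
      bform_scale[of I R t u] bform_commute[OF sym(2), of u y] by simp
qed

text \<open>
  Let \<open>Q y = \<lambda> P y\<close>. Applying the block matrix to \<open>(y, 0)\<close> yields the product vector
  \<open>(1, \<lambda>) \<otimes> P y\<close>, so subtracting its square divided by \<open>P(y, y)\<close> keeps positivity and moves \<open>(y, 0)\<close> into
  the kernel. The vector \<open>(0, y)\<close> is then mapped to the product vector \<open>(0, 1) \<otimes> R y\<close>, and a second subtraction moves it
  into the kernel as well. What is left lives on one index less.
\<close>

theorem block_psd_separable:
  assumes "finite I" and "symmetric_on I P" "symmetric_on I Q" "symmetric_on I R"
    and "block_psd I P Q R"
  shows "\<exists>L. \<forall>u v. bform I P u v = (\<Sum>(c, d, w)\<leftarrow>L. c\<^sup>2 * dot I w u * dot I w v) \<and>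
                   bform I Q u v = (\<Sum>(c, d, w)\<leftarrow>L. c * d * dot I w u * dot I w v) \<and>
                   bform I R u v = (\<Sum>(c, d, w)\<leftarrow>L. d\<^sup>2 * dot I w u * dot I w v)"
  using assms
proof (induction I arbitrary: P Q R rule: finite_psubset_induct)
  case (psubset I)
  note sym = psubset.prems(1-3) and psd = psubset.prems(4)
  show ?case
  proof (cases "I = {}")
    case True
    then show ?thesis by (intro exI[of _ "[]"]) (simp add: bform_def)
  next
    case False
    have Pnn: "0 \<le> bform I P u u" for u
      using psd[unfolded block_psd_def, rule_format, of u "\<lambda>_. 0"] by (simp add: bform_def)
    obtain k y l where k: "k \<in> I" "y k \<noteq> 0" and ev: "\<And>u. bform I Q u y = l * bform I P u y"
      using generalized_eigenvector[OF psubset.hyps(1) False sym(1,2) Pnn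
            block_psd_first_kernel[OF sym(1,2) psd]] by auto
    \<comment> \<open>Division by zero covers the degenerate case: if \<open>p = 0\<close>, then \<open>P y = 0\<close> and nothing is subtracted.\<close>
    define p where "p = bform I P y y"
    define w where "w = (\<lambda>i. \<Sum>j\<in>I. P i j * y j)"
    define P1 where "P1 = (\<lambda>i j. P i j - 1 / p * (w i * w j))"
    define Q1 where "Q1 = (\<lambda>i j. Q i j - l / p * (w i * w j))"
    define R1 where "R1 = (\<lambda>i j. R i j - l\<^sup>2 / p * (w i * w j))"
    have w: "dot I w u = bform I P u y" for u by (simp add: w_def dot_row)
    have P0: "bform I P u y = 0" if "p = 0" for u
      using psd_kernel[OF sym(1) Pnn] that by (simp add: p_def)
    have p0: "p \<ge> 0" using Pnn p_def by simp
    have sym1: "symmetric_on I P1" "symmetric_on I Q1" "symmetric_on I R1"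
      using sym by (auto simp: symmetric_on_def P1_def Q1_def R1_def mult.commute)
    have b1: "bform I P1 u v = bform I P u v - 1 / p * bform I P u y * bform I P v y"
             "bform I Q1 u v = bform I Q u v - l / p * bform I P u y * bform I P v y"
             "bform I R1 u v = bform I R u v - l\<^sup>2 / p * bform I P u y * bform I P v y" for u v
      unfolding P1_def Q1_def R1_def by (simp_all only: bform_subtract_rank_one w)
    have k1: "bform I P1 u y = 0" "bform I Q1 u y = 0" for u
      using P0 by (auto simp: b1 ev p_def[symmetric])
    have psd1: "block_psd I P1 Q1 R1"
      unfolding block_psd_def
    proof (intro allI)
      fix u v
      \<comment> \<open>The new form at \<open>(u, v)\<close> is the value of the old one at its minimiser over \<open>u + t y\<close>.\<close>
      define z where "z = bform I P u y + l * bform I P v y"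
      have "0 \<le> bform I P (\<lambda>i. u i + (- z / p) * y i) (\<lambda>i. u i + (- z / p) * y i)
              + 2 * bform I Q (\<lambda>i. u i + (- z / p) * y i) v + bform I R v v"
        using psd unfolding block_psd_def by blast
      also have "\<dots> = bform I P u u + 2 * bform I Q u v + bform I R v v - z\<^sup>2 / p"
        unfolding block_psd_shift[OF sym(1,2)] ev z_def[symmetric] p_def[symmetric]
        by (cases "p = 0") (simp_all add: field_simps power2_eq_square)
      also have "\<dots> = bform I P1 u u + 2 * bform I Q1 u v + bform I R1 v v"
        unfolding b1 z_def by (simp add: field_simps power2_eq_square add_divide_distrib)
      finally show "0 \<le> bform I P1 u u + 2 * bform I Q1 u v + bform I R1 v v" .
    qed
    have Rnn: "0 \<le> bform I R1 v v" for v
      using psd1[unfolded block_psd_def, rule_format, of "\<lambda>_. 0" v] by (simp add: bform_def)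
    define q where "q = bform I R1 y y"
    define z where "z = (\<lambda>i. \<Sum>j\<in>I. R1 i j * y j)"
    define R2 where "R2 = (\<lambda>i j. R1 i j - 1 / q * (z i * z j))"
    have z: "dot I z u = bform I R1 u y" for u by (simp add: z_def dot_row)
    have R0: "bform I R1 u y = 0" if "q = 0" for u
      using psd_kernel[OF sym1(3) Rnn] that by (simp add: q_def)
    have q0: "q \<ge> 0" using Rnn q_def by simp
    have sym2: "symmetric_on I R2"
      using sym1 by (auto simp: symmetric_on_def R2_def mult.commute)
    have b2: "bform I R2 u v = bform I R1 u v - 1 / q * bform I R1 u y * bform I R1 v y" for u v
      unfolding R2_def by (simp only: bform_subtract_rank_one z)
    have k2: "bform I R2 u y = 0" for u
      using R0 by (auto simp: b2 q_def[symmetric])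
    have psd2: "block_psd I P1 Q1 R2"
      unfolding block_psd_def
    proof (intro allI)
      fix u v
      \<comment> \<open>Again the value of the old form at a minimiser, now over \<open>v + t y\<close>.\<close>
      define t where "t = - bform I R1 v y / q"
      have "0 \<le> bform I P1 u u + 2 * bform I Q1 u (\<lambda>i. v i + t * y i)
              + bform I R1 (\<lambda>i. v i + t * y i) (\<lambda>i. v i + t * y i)"
        using psd1 unfolding block_psd_def by blast
      also have "bform I Q1 u (\<lambda>i. v i + t * y i) = bform I Q1 u v"
        using bform_comb_right[of I Q1 u 1 v t y] k1 by simp
      also have "bform I R1 (\<lambda>i. v i + t * y i) (\<lambda>i. v i + t * y i) = bform I R2 v v"
        unfolding bform_shift[OF sym1(3)] b2 t_def q_def[symmetric]
        by (cases "q = 0") (simp_all add: field_simps power2_eq_square)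
      finally show "0 \<le> bform I P1 u u + 2 * bform I Q1 u v + bform I R2 v v" .
    qed
    let ?J = "I - {k}"
    have "block_psd ?J P1 Q1 R2"
      using psd2 unfolding block_psd_def bform_restrict[OF psubset.hyps(1) k(1)] by blast
    moreover have "?J \<subset> I" using k by auto
    moreover have "symmetric_on ?J P1" "symmetric_on ?J Q1" "symmetric_on ?J R2"
      using sym1 sym2 by (auto intro: symmetric_on_subset)
    ultimately have "\<exists>L. \<forall>u v. bform ?J P1 u v = (\<Sum>(c, d, w)\<leftarrow>L. c\<^sup>2 * dot ?J w u * dot ?J w v) \<and>
         bform ?J Q1 u v = (\<Sum>(c, d, w)\<leftarrow>L. c * d * dot ?J w u * dot ?J w v) \<and>
         bform ?J R2 u v = (\<Sum>(c, d, w)\<leftarrow>L. d\<^sup>2 * dot ?J w u * dot ?J w v)"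
      by (intro psubset.IH)
    then obtain L where
      L: "\<And>u v. bform ?J P1 u v = (\<Sum>(c, d, w)\<leftarrow>L. c\<^sup>2 * dot ?J w u * dot ?J w v)"
         "\<And>u v. bform ?J Q1 u v = (\<Sum>(c, d, w)\<leftarrow>L. c * d * dot ?J w u * dot ?J w v)"
         "\<And>u v. bform ?J R2 u v = (\<Sum>(c, d, w)\<leftarrow>L. d\<^sup>2 * dot ?J w u * dot ?J w v)" by blast
    \<comment> \<open>The vectors found on \<open>I - {k}\<close> extend to \<open>I\<close> by orthogonality to \<open>y\<close>.\<close>
    define ext where "ext = (\<lambda>w. w(k := - dot ?J w y / y k))"
    define rp rq where "rp = sqrt (1 / p)" and "rq = sqrt (1 / q)"
    define L' where "L' = (rp, l * rp, w) # (0, rq, z)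
                          # map (\<lambda>(c, d, w). (c, d, ext w)) L"
    have ext: "dot ?J w (elim y k u) = dot I (ext w) u" for w u
      unfolding ext_def by (rule dot_elim[of I k y, OF psubset.hyps(1) k])
    have sq: "rp\<^sup>2 = 1 / p" "rq\<^sup>2 = 1 / q" "rp * (l * rp) = l / p"
    proof -
      show "rp\<^sup>2 = 1 / p" "rq\<^sup>2 = 1 / q" using p0 q0 by (simp_all add: rp_def rq_def power_divide)
      then show "rp * (l * rp) = l / p" by (simp add: power2_eq_square mult.left_commute)
    qed
    have "bform I P u v = (\<Sum>(c, d, w)\<leftarrow>L'. c\<^sup>2 * dot I w u * dot I w v) \<and>
          bform I Q u v = (\<Sum>(c, d, w)\<leftarrow>L'. c * d * dot I w u * dot I w v) \<and>
          bform I R u v = (\<Sum>(c, d, w)\<leftarrow>L'. d\<^sup>2 * dot I w u * dot I w v)" for u v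
    proof (intro conjI)
      note el = bform_elim[of I k y, OF psubset.hyps(1) k]
      show "bform I P u v = (\<Sum>(c, d, w)\<leftarrow>L'. c\<^sup>2 * dot I w u * dot I w v)"
        using b1(1)[of u v] el[OF sym1(1) k1(1), of u v]
        by (simp add: L ext L'_def case_prod_unfold comp_def sq w)
      show "bform I Q u v = (\<Sum>(c, d, w)\<leftarrow>L'. c * d * dot I w u * dot I w v)"
        using b1(2)[of u v] el[OF sym1(2) k1(2), of u v]
        by (simp add: L ext L'_def case_prod_unfold comp_def w sq(3))
      show "bform I R u v = (\<Sum>(c, d, w)\<leftarrow>L'. d\<^sup>2 * dot I w u * dot I w v)"
        using b1(3)[of u v] b2[of u v] el[OF sym2 k2, of u v]
        by (simp add: L ext L'_def case_prod_unfold comp_def sq w z power_mult_distrib)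
    qed
    then show ?thesis by blast
  qed
qed

section \<open>Nonnegative biquadratic forms in two by n variables are sums of squares\<close>

lemma constant_term_nonneg:
  fixes a b c :: real
  assumes "\<And>t. t \<noteq> 0 \<Longrightarrow> 0 \<le> a + t * b + t\<^sup>2 * c"
  shows "0 \<le> a"
proof (rule tendsto_lowerbound)
  have "((\<lambda>t. a + t * b + t\<^sup>2 * c) \<longlongrightarrow> a + 0 * b + 0\<^sup>2 * c) (at 0)"
    by (intro tendsto_intros)
  then show "((\<lambda>t. a + t * b + t\<^sup>2 * c) \<longlongrightarrow> a) (at 0)" by simp
  show "\<forall>\<^sub>F t in at 0. 0 \<le> a + t * b + t\<^sup>2 * c"
    using assms by (auto simp: eventually_at_filter)
qed simp

text \<open>
  Nonnegativity of the biquadratic form with coefficients \<open>A, B, C\<close> in \<open>x \<in> \<real>\<^sup>2\<close> and \<open>u\<close>.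
\<close>

definition pencil_psd :: "'i set \<Rightarrow> ('i \<Rightarrow> 'i \<Rightarrow> real) \<Rightarrow> ('i \<Rightarrow> 'i \<Rightarrow> real) \<Rightarrow> ('i \<Rightarrow> 'i \<Rightarrow> real) \<Rightarrow> bool" where
  "pencil_psd I A B C \<longleftrightarrow>
     (\<forall>x0 x1 u. 0 \<le> x0\<^sup>2 * bform I A u u + 2 * x0 * x1 * bform I B u u + x1\<^sup>2 * bform I C u u)"

text \<open>
  At a zero \<open>((1, 0), y)\<close> the kernel of \<open>A\<close> contains \<open>y\<close> and \<open>B(y, y) = 0\<close>, so along \<open>u + \<tau> y\<close> the form is a
  quadratic polynomial in \<open>\<tau>\<close> with leading coefficient \<open>x\<^sub>1\<^sup>2 C(y, y)\<close>. Completing the square removes \<open>\<tau>\<close>. The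
  remainder is nonnegative because it is the value of the form where the square vanishes; such a \<open>\<tau>\<close> exists if
  \<open>x\<^sub>1 \<noteq> 0\<close>, and the case \<open>x\<^sub>1 = 0\<close> follows by continuity. If \<open>C(y, y) = 0\<close>, then \<open>y\<close> lies in the kernel of all three
  matrices.
\<close>

lemma pencil_deflate:
  assumes sym: "symmetric_on I A" "symmetric_on I B" "symmetric_on I C"
    and psd: "pencil_psd I A B C" and y: "bform I A y y = 0"
  shows "\<exists>A1 B1 C1 a b. symmetric_on I A1 \<and> symmetric_on I B1 \<and> symmetric_on I C1 \<and>
    pencil_psd I A1 B1 C1 \<and>
    (\<forall>u. bform I A1 u y = 0 \<and> bform I B1 u y = 0 \<and> bform I C1 u y = 0) \<and>
    (\<forall>u. bform I A u u = bform I A1 u u + (dot I a u)\<^sup>2 \<and>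
         bform I B u u = bform I B1 u u + dot I a u * dot I b u \<and>
         bform I C u u = bform I C1 u u + (dot I b u)\<^sup>2)"
proof -
  note psdD = psd[unfolded pencil_psd_def, rule_format]
  have Ann: "0 \<le> bform I A u u" for u using psdD[of 1 u 0] by simp
  have Cnn: "0 \<le> bform I C u u" for u using psdD[of 0 u 1] by simp
  have Ay: "bform I A u y = 0" for u by (rule psd_kernel[OF sym(1) Ann y])
  have Byy: "bform I B y y = 0"
  proof (rule linear_term_zero_of_nonneg[where c = "bform I C y y"])
    show "0 \<le> 2 * t * bform I B y y + t\<^sup>2 * bform I C y y" for t
      using psdD[of 1 y t] y by simp
  qed
  define g where "g = bform I C y y"
  have g0: "g \<ge> 0" using Cnn by (simp add: g_def)
  show ?thesis
  proof (cases "g = 0")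
    case True
    have Cy: "bform I C u y = 0" for u using psd_kernel[OF sym(3) Cnn] True by (simp add: g_def)
    have By: "bform I B u y = 0" for u
    proof -
      have "2 * bform I B u y = 0"
      proof (rule linear_term_zero_of_nonneg[where c = "bform I A u u + 2 * bform I B u u + bform I C u u"])
        fix t
        show "0 \<le> 2 * t * (2 * bform I B u y) + t\<^sup>2 * (bform I A u u + 2 * bform I B u u + bform I C u u)"
          using psdD[of 1 "\<lambda>i. y i + t * u i" 1] Ay Cy y Byy True
            bform_commute[OF sym(1), of y u] bform_commute[OF sym(2), of y u] bform_commute[OF sym(3), of y u]
          unfolding bform_shift[OF sym(1)] bform_shift[OF sym(2)] bform_shift[OF sym(3)]
          by (simp add: algebra_simps g_def)
      qed
      then show ?thesis by simp
    qed
    show ?thesis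
      by (rule exI[of _ A], rule exI[of _ B], rule exI[of _ C], rule exI[of _ "\<lambda>_. 0"],
          rule exI[of _ "\<lambda>_. 0"]) (use sym psd Ay By Cy in \<open>simp add: dot_def\<close>)
  next
    case False
    define s where "s = 1 / sqrt g"
    have s: "s * s * g = 1" "s * s = 1 / g"
      using g0 False by (simp_all add: s_def)
    have s0: "s \<noteq> 0" using g0 False by (simp add: s_def)
    \<comment> \<open>The mixed term \<open>2 x\<^sub>0 x\<^sub>1 (a \<cdot> u)(b \<cdot> y)\<close> of the square has to equal \<open>4 x\<^sub>0 x\<^sub>1 B(u, y)\<close>, where
      \<open>b \<cdot> y\<close> is the square root of \<open>g\<close>.\<close>
    define a where "a = (\<lambda>i. \<Sum>j\<in>I. (2 * s * B i j) * y j)"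
    define b where "b = (\<lambda>i. \<Sum>j\<in>I. (s * C i j) * y j)"
    have a: "dot I a u = 2 * s * bform I B u y" for u
      using dot_row[of I "\<lambda>i j. 2 * s * B i j" y u] bform_lincomb_mat[of I "2 * s" B 0 B u y]
      by (simp add: a_def)
    have b: "dot I b u = s * bform I C u y" for u
      using dot_row[of I "\<lambda>i j. s * C i j" y u] bform_lincomb_mat[of I s C 0 C u y]
      by (simp add: b_def)
    define A1 where "A1 = (\<lambda>i j. A i j - 1 * (a i * a j))"
    define B1 where "B1 = (\<lambda>i j. (B i j - 1/2 * (a i * b j)) - 1/2 * (b i * a j))"
    define C1 where "C1 = (\<lambda>i j. C i j - 1 * (b i * b j))"
    have eqs: "bform I A1 u v = bform I A u v - dot I a u * dot I a v"
        "bform I B1 u v = bform I B u v - 1/2 * dot I a u * dot I b v - 1/2 * dot I b u * dot I a v"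
        "bform I C1 u v = bform I C u v - dot I b u * dot I b v" for u v
      unfolding A1_def B1_def C1_def by (simp_all only: bform_subtract_rank_one) 
    have ay: "dot I a y = 0" and by_: "dot I b y = s * g" by (simp_all add: a b Byy g_def)
    have sg: "s * (s * g) = 1" using s(2) False by (simp add: mult.assoc[symmetric])
    have ker: "bform I A1 u y = 0" "bform I B1 u y = 0" "bform I C1 u y = 0" for u
      unfolding eqs ay by_ using sg Ay by (simp_all add: a b mult_ac)
    have sym1: "symmetric_on I A1" "symmetric_on I B1" "symmetric_on I C1"
      using sym by (auto simp: symmetric_on_def A1_def B1_def C1_def algebra_simps)
    have main: "0 \<le> x0\<^sup>2 * bform I A1 u u + 2 * x0 * x1 * bform I B1 u u + x1\<^sup>2 * bform I C1 u u"
      if x1: "x1 \<noteq> 0" for x0 x1 u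
    proof -
      \<comment> \<open>The shift along \<open>y\<close> that makes the subtracted square vanish.\<close>
      define t where "t = - (x0 * dot I a u + x1 * dot I b u) / (x1 * (s * g))"
      have sg0: "s * g \<noteq> 0" using s0 False by simp
      let ?v = "\<lambda>i. u i + t * y i"
      have v: "bform I A1 ?v ?v = bform I A1 u u" "bform I B1 ?v ?v = bform I B1 u u"
          "bform I C1 ?v ?v = bform I C1 u u"
        using ker by (simp_all add: bform_shift sym1)
      have "x0 * dot I a ?v + x1 * dot I b ?v = 0"
        unfolding dot_shift ay by_ t_def using x1 sg0 s0 False by (simp add: field_simps)
      then have "0 = (x0 * dot I a ?v + x1 * dot I b ?v)\<^sup>2" by simp
      then have "x0\<^sup>2 * bform I A1 ?v ?v + 2 * x0 * x1 * bform I B1 ?v ?v + x1\<^sup>2 * bform I C1 ?v ?v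
          = x0\<^sup>2 * bform I A ?v ?v + 2 * x0 * x1 * bform I B ?v ?v + x1\<^sup>2 * bform I C ?v ?v"
        unfolding eqs by (simp add: algebra_simps power2_eq_square)
      then show ?thesis using psdD[of x0 ?v x1] unfolding v by simp
    qed
    have "pencil_psd I A1 B1 C1"
      unfolding pencil_psd_def
    proof (intro allI)
      fix x0 x1 u
      show "0 \<le> x0\<^sup>2 * bform I A1 u u + 2 * x0 * x1 * bform I B1 u u + x1\<^sup>2 * bform I C1 u u"
      proof (cases "x1 = 0")
        case True
        have "0 \<le> x0\<^sup>2 * bform I A1 u u"
          by (rule constant_term_nonneg[where b = "2 * x0 * bform I B1 u u" and c = "bform I C1 u u"])
             (use main[of _ x0 u] in \<open>simp add: mult_ac\<close>)
        then show ?thesis using True by simp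
      qed (rule main)
    qed
    then show ?thesis
      by (intro exI[of _ A1] exI[of _ B1] exI[of _ C1] exI[of _ a] exI[of _ b])
         (use sym1 ker in \<open>simp add: eqs power2_eq_square\<close>)
  qed
qed

text \<open>
  Coefficients of the pencil in the rotated variables \<open>x = x\<^sub>0' (c, s) + x\<^sub>1' (-s, c)\<close>.
\<close>

definition rot_fst where "rot_fst c s A B C = (\<lambda>i j. c\<^sup>2 * A i j + 2 * c * s * B i j + s\<^sup>2 * C i j :: real)"
definition rot_mid where "rot_mid c s A B C = (\<lambda>i j. (c\<^sup>2 - s\<^sup>2) * B i j + c * s * (C i j - A i j) :: real)"

lemma bform_rot:
  "bform I (rot_fst c s A B C) u v = c\<^sup>2 * bform I A u v + 2 * c * s * bform I B u v + s\<^sup>2 * bform I C u v"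
  "bform I (rot_mid c s A B C) u v = (c\<^sup>2 - s\<^sup>2) * bform I B u v + c * s * (bform I C u v - bform I A u v)"
  unfolding rot_fst_def rot_mid_def
  using bform_lincomb_mat[of I 1 "\<lambda>i j. c\<^sup>2 * A i j + 2 * c * s * B i j" "s\<^sup>2" C u v]
    bform_lincomb_mat[of I "c\<^sup>2" A "2 * c * s" B u v]
    bform_lincomb_mat[of I "c\<^sup>2 - s\<^sup>2" B "c * s" "\<lambda>i j. C i j - A i j" u v]
    bform_lincomb_mat[of I 1 C "-1" A u v]
  by simp_all

text \<open>
  Over the compact set of unit \<open>x\<close> and \<open>u\<close> the form attains its minimum \<open>e\<close>. Subtracting \<open>e |x|\<^sup>2 |u|\<^sup>2\<close>,
  itself a sum of squares, creates a zero, at which \<open>pencil_deflate\<close> splits off one more square and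
  eliminates an index.
\<close>

theorem pencil_sos:
  assumes "finite I" and "symmetric_on I A" "symmetric_on I B" "symmetric_on I C"
    and "pencil_psd I A B C"
  shows "\<exists>L. \<forall>u. bform I A u u = (\<Sum>(a, b)\<leftarrow>L. (dot I a u)\<^sup>2) \<and>
                 bform I B u u = (\<Sum>(a, b)\<leftarrow>L. dot I a u * dot I b u) \<and>
                 bform I C u u = (\<Sum>(a, b)\<leftarrow>L. (dot I b u)\<^sup>2)"
  using assms
proof (induction I arbitrary: A B C rule: finite_psubset_induct)
  case (psubset I)
  note fin = psubset.hyps(1) and sym = psubset.prems(1-3) and psd = psubset.prems(4)
  show ?case
  proof (cases "I = {}")
    case True
    then show ?thesis by (intro exI[of _ "[]"]) (simp add: bform_def)
  next
    case False
    define G where "G = (\<lambda>x0 x1 u. x0\<^sup>2 * bform I A u u + 2 * x0 * x1 * bform I B u u + x1\<^sup>2 * bform I C u u)"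
    have Gnn: "0 \<le> G x0 x1 u" for x0 x1 u
      using psd by (simp add: G_def pencil_psd_def)
    let ?K = "{0..2*pi} \<times> usphere I"
    have comp: "compact ?K" by (intro compact_Times compact_usphere fin compact_Icc)
    have "?K \<noteq> {}" using usphere_nonempty[OF False fin] by auto
    moreover have cb: "continuous_on ?K (\<lambda>p. bform I M (snd p) (snd p))" for M
      by (rule continuous_on_compose2[OF continuous_on_bform[of UNIV]]) (auto intro: continuous_intros)
    have "continuous_on ?K (\<lambda>p. G (cos (fst p)) (sin (fst p)) (snd p))"
      unfolding G_def
      by (intro continuous_intros cb continuous_on_compose2[of UNIV cos]
          continuous_on_compose2[of UNIV sin]) auto
    ultimately have "\<exists>p0\<in>?K. \<forall>p\<in>?K. G (cos (fst p0)) (sin (fst p0)) (snd p0)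
                                    \<le> G (cos (fst p)) (sin (fst p)) (snd p)"
      by (rule continuous_attains_inf[OF comp])
    then obtain p0 where p0: "p0 \<in> ?K"
      and min: "\<And>p. p \<in> ?K \<Longrightarrow> G (cos (fst p0)) (sin (fst p0)) (snd p0) \<le> G (cos (fst p)) (sin (fst p)) (snd p)" by blast
    define c s y where "c = cos (fst p0)" and "s = sin (fst p0)" and "y = snd p0"
    have cs: "c\<^sup>2 + s\<^sup>2 = 1" by (simp add: c_def s_def)
    have y: "y \<in> usphere I" using p0 by (auto simp: y_def)
    define e where "e = G c s y"
    have e0: "e \<ge> 0" using Gnn by (simp add: e_def)
    define A0 where "A0 = (\<lambda>i j. A i j - e * of_bool (i = j))"
    define C0 where "C0 = (\<lambda>i j. C i j - e * of_bool (i = j))"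
    have diag: "bform I (\<lambda>i j. M i j - e * of_bool (i = j)) u u = bform I M u u - e * (\<Sum>i\<in>I. (u i)\<^sup>2)" for M u
    proof -
      have "bform I (\<lambda>i j. of_bool (i = j)) u u = (\<Sum>i\<in>I. (u i)\<^sup>2)"
        using fin by (simp add: bform_def of_bool_def if_distrib if_distribR power2_eq_square cong: if_cong)
      then show ?thesis
        using bform_lincomb_mat[of I 1 M "-e" "\<lambda>i j. of_bool (i = j)" u u] by simp
    qed
    have G0: "x0\<^sup>2 * bform I A0 u u + 2 * x0 * x1 * bform I B u u + x1\<^sup>2 * bform I C0 u u
            = G x0 x1 u - e * ((x0\<^sup>2 + x1\<^sup>2) * (\<Sum>i\<in>I. (u i)\<^sup>2))" for x0 x1 u
      unfolding A0_def C0_def diag G_def by (simp add: algebra_simps)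
    have G0nn: "0 \<le> G x0 x1 u - e * ((x0\<^sup>2 + x1\<^sup>2) * (\<Sum>i\<in>I. (u i)\<^sup>2))" for x0 x1 u
    proof (cases "x0\<^sup>2 + x1\<^sup>2 = 0 \<or> (\<forall>i\<in>I. u i = 0)")
      case True
      then have "(x0\<^sup>2 + x1\<^sup>2) * (\<Sum>i\<in>I. (u i)\<^sup>2) = 0" by auto
      then show ?thesis using Gnn[of x0 x1 u] by (metis diff_zero mult_zero_right)
    next
      case nz: False
      define r where "r = sqrt (x0\<^sup>2 + x1\<^sup>2)"
      have r: "r > 0" "r\<^sup>2 = x0\<^sup>2 + x1\<^sup>2"
        using nz by (auto simp: r_def sum_power2_gt_zero_iff)
      have "(x0 / r)\<^sup>2 + (x1 / r)\<^sup>2 = 1"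
        using r nz by (simp add: power_divide add_divide_distrib[symmetric])
      then obtain th where th: "0 \<le> th" "th < 2 * pi" "x0 / r = cos th" "x1 / r = sin th"
        using sincos_total_2pi by metis
      obtain i where i: "i \<in> I" "u i \<noteq> 0" using nz by auto
      obtain v where v: "v \<in> usphere I" "\<forall>M. bform I M u u = (\<Sum>i\<in>I. (u i)\<^sup>2) * bform I M v v"
        using bform_homogeneous[OF fin i(1), of u] i(2) by blast
      define k where "k = (\<Sum>i\<in>I. (u i)\<^sup>2)"
      have k0: "k \<ge> 0" by (simp add: k_def sum_nonneg)
      have "bform I M u u = k * bform I M v v" for M using v(2) by (simp add: k_def)
      moreover have "x0 = r * cos th" "x1 = r * sin th" using th r by (auto simp: field_simps)
      ultimately have "G x0 x1 u = r\<^sup>2 * k * G (cos th) (sin th) v"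
        by (simp add: G_def algebra_simps power2_eq_square)
      moreover have "e \<le> G (cos th) (sin th) v"
        using min[of "(th, v)"] th v by (simp add: e_def c_def s_def y_def)
      ultimately have "r\<^sup>2 * k * e \<le> G x0 x1 u" using k0 by (simp add: mult_left_mono)
      then show ?thesis by (simp add: r(2)[symmetric] k_def[symmetric] mult_ac)
    qed
    define A' where "A' = rot_fst c s A0 B C0"
    define B' where "B' = rot_mid c s A0 B C0"
    define C' where "C' = rot_fst (-s) c A0 B C0"
    have sym0: "symmetric_on I A0" "symmetric_on I C0"
      using sym by (auto simp: symmetric_on_def A0_def C0_def)
    have sym': "symmetric_on I A'" "symmetric_on I B'" "symmetric_on I C'"
      using sym sym0 by (auto simp: symmetric_on_def A'_def B'_def C'_def rot_fst_def rot_mid_def)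
    have psd': "pencil_psd I A' B' C'"
      unfolding pencil_psd_def
    proof (intro allI)
      fix x0 x1 u
      have "x0\<^sup>2 * bform I A' u u + 2 * x0 * x1 * bform I B' u u + x1\<^sup>2 * bform I C' u u
          = (c * x0 - s * x1)\<^sup>2 * bform I A0 u u
            + 2 * (c * x0 - s * x1) * (s * x0 + c * x1) * bform I B u u + (s * x0 + c * x1)\<^sup>2 * bform I C0 u u"
        unfolding A'_def B'_def C'_def bform_rot by algebra
      then show "0 \<le> x0\<^sup>2 * bform I A' u u + 2 * x0 * x1 * bform I B' u u + x1\<^sup>2 * bform I C' u u"
        unfolding G0 using G0nn by simp
    qed
    have zero: "bform I A' y y = 0"
      unfolding A'_def bform_rot G0 using y cs by (simp add: e_def usphere_def)
    obtain A1 B1 C1 a b where sym1: "symmetric_on I A1" "symmetric_on I B1" "symmetric_on I C1"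
      and psd1: "pencil_psd I A1 B1 C1"
      and ker': "\<forall>u. bform I A1 u y = 0 \<and> bform I B1 u y = 0 \<and> bform I C1 u y = 0"
      and dec: "\<forall>u. bform I A' u u = bform I A1 u u + (dot I a u)\<^sup>2 \<and>
        bform I B' u u = bform I B1 u u + dot I a u * dot I b u \<and>
        bform I C' u u = bform I C1 u u + (dot I b u)\<^sup>2"
      using pencil_deflate[OF sym' psd' zero] by blast
    have ker: "bform I A1 u y = 0" "bform I B1 u y = 0" "bform I C1 u y = 0" for u
      using ker' by simp_all
    obtain k where k: "k \<in> I" "y k \<noteq> 0" using usphere_nonzero[OF y] by blast
    let ?J = "I - {k}"
    have "pencil_psd ?J A1 B1 C1"
      using psd1 unfolding pencil_psd_def bform_restrict[OF fin k(1)] by blast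
    moreover have "?J \<subset> I" using k by auto
    moreover have "symmetric_on ?J A1" "symmetric_on ?J B1" "symmetric_on ?J C1"
      using sym1 by (auto intro: symmetric_on_subset)
    ultimately have "\<exists>L. \<forall>u. bform ?J A1 u u = (\<Sum>(a, b)\<leftarrow>L. (dot ?J a u)\<^sup>2) \<and>
         bform ?J B1 u u = (\<Sum>(a, b)\<leftarrow>L. dot ?J a u * dot ?J b u) \<and>
         bform ?J C1 u u = (\<Sum>(a, b)\<leftarrow>L. (dot ?J b u)\<^sup>2)"
      by (intro psubset.IH)
    then obtain L where
      L: "\<And>u. bform ?J A1 u u = (\<Sum>(a, b)\<leftarrow>L. (dot ?J a u)\<^sup>2)"
         "\<And>u. bform ?J B1 u u = (\<Sum>(a, b)\<leftarrow>L. dot ?J a u * dot ?J b u)"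
         "\<And>u. bform ?J C1 u u = (\<Sum>(a, b)\<leftarrow>L. (dot ?J b u)\<^sup>2)" by blast
    define ext where "ext = (\<lambda>w. w(k := - dot ?J w y / y k))"
    have ext: "dot ?J w (elim y k u) = dot I (ext w) u" for w u
      unfolding ext_def by (rule dot_elim[of I k y, OF fin k])
    define L1 where "L1 = (a, b) # map (\<lambda>(a, b). (ext a, ext b)) L"
    note el = bform_elim[of I k y, OF fin k]
    have L1: "bform I A' u u = (\<Sum>(a, b)\<leftarrow>L1. (dot I a u)\<^sup>2)"
         "bform I B' u u = (\<Sum>(a, b)\<leftarrow>L1. dot I a u * dot I b u)"
         "bform I C' u u = (\<Sum>(a, b)\<leftarrow>L1. (dot I b u)\<^sup>2)" for u
      using dec[rule_format, of u] el[OF sym1(1) ker(1), of u u] el[OF sym1(2) ker(2), of u u] el[OF sym1(3) ker(3), of u u]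
      by (simp_all add: L ext L1_def case_prod_unfold comp_def)
    \<comment> \<open>Undo the rotation.\<close>
    define L2 where "L2 = map (\<lambda>(a, b). (\<lambda>i. c * a i - s * b i, \<lambda>i. s * a i + c * b i)) L1"
    have dl: "dot I (\<lambda>i. x * a i + z * b i) u = x * dot I a u + z * dot I b u"
         "dot I (\<lambda>i. x * a i - z * b i) u = x * dot I a u - z * dot I b u" for x z a b u
      by (simp_all add: dot_def sum_distrib_left sum.distrib sum_subtractf algebra_simps)
    have unrot: "bform I A0 u u = c\<^sup>2 * bform I A' u u - 2 * c * s * bform I B' u u + s\<^sup>2 * bform I C' u u"
         "bform I B u u = c * s * bform I A' u u + (c\<^sup>2 - s\<^sup>2) * bform I B' u u - c * s * bform I C' u u"
         "bform I C0 u u = s\<^sup>2 * bform I A' u u + 2 * c * s * bform I B' u u + c\<^sup>2 * bform I C' u u" for u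
      unfolding A'_def B'_def C'_def bform_rot using cs by algebra+
    have L2: "bform I A0 u u = (\<Sum>(a, b)\<leftarrow>L2. (dot I a u)\<^sup>2)"
         "bform I B u u = (\<Sum>(a, b)\<leftarrow>L2. dot I a u * dot I b u)"
         "bform I C0 u u = (\<Sum>(a, b)\<leftarrow>L2. (dot I b u)\<^sup>2)" for u
      unfolding unrot L1 L2_def
      by (simp_all add: case_prod_unfold comp_def dl sum_list_const_mult[symmetric]
          sum_list_addf[symmetric] sum_list_subtractf[symmetric] algebra_simps power2_eq_square)
    \<comment> \<open>Restore the subtracted \<open>e |x|\<^sup>2 |u|\<^sup>2\<close>.\<close>
    obtain ks where ks: "set ks = I" "distinct ks" using finite_distinct_list[OF fin] by blast
    define d :: "'a \<Rightarrow> 'a \<Rightarrow> real" where "d = (\<lambda>k i. sqrt e * of_bool (i = k))"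
    have d: "dot I (d k) u = sqrt e * u k" if "k \<in> I" for k u
      using fin that by (simp add: d_def dot_def of_bool_def if_distrib if_distribR cong: if_cong)
    have dsum: "(\<Sum>k\<leftarrow>ks. (dot I (d k) u)\<^sup>2) = e * (\<Sum>i\<in>I. (u i)\<^sup>2)" for u
      using e0 ks by (simp add: sum_list_distinct_conv_sum_set d power_mult_distrib sum_distrib_left cong: sum.cong)
    have z: "dot I (\<lambda>_. 0) u = 0" for u by (simp add: dot_def)
    define L3 where "L3 = map (\<lambda>k. (d k, \<lambda>_. 0)) ks @ map (\<lambda>k. (\<lambda>_. 0, d k)) ks @ L2"
    have "bform I A u u = (\<Sum>(a, b)\<leftarrow>L3. (dot I a u)\<^sup>2) \<and>
          bform I B u u = (\<Sum>(a, b)\<leftarrow>L3. dot I a u * dot I b u) \<and>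
          bform I C u u = (\<Sum>(a, b)\<leftarrow>L3. (dot I b u)\<^sup>2)" for u
      using L2[of u] diag[of A u] diag[of C u] unfolding A0_def[symmetric] C0_def[symmetric]
      by (simp add: L3_def comp_def z dsum)
    then show ?thesis by blast
  qed
qed

section \<open>Positive semidefinite matrices\<close>

lemma dot_unit:
  assumes "finite I" "i \<in> I"
  shows "dot I w (\<lambda>k. of_bool (k = i)) = w i"
proof -
  have "I \<inter> {x. x = i} = {i}" using assms(2) by auto
  then show ?thesis using assms(1) by (simp add: dot_def)
qed

lemma bform_unit:
  assumes "finite I" "i \<in> I" "j \<in> I"
  shows "bform I A (\<lambda>k. of_bool (k = i)) (\<lambda>k. of_bool (k = j)) = A i j"
proof -
  have "I \<inter> {x. x = i} = {i}" "I \<inter> {x. x = j} = {j}" using assms(2,3) by auto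
  then show ?thesis using assms(1) by (simp add: bform_def mult.assoc sum_distrib_left[symmetric])
qed

lemma sum_list_index: "(\<Sum>x\<leftarrow>L. f x) = (\<Sum>p<length L. f (L ! p))"
  by (simp add: sum_list_sum_nth atLeast0LessThan)

corollary block_psd_entries:
  assumes "finite I" "symmetric_on I P" "symmetric_on I Q" "symmetric_on I R" "block_psd I P Q R"
  shows "\<exists>(r::nat) c d w. \<forall>i\<in>I. \<forall>j\<in>I.
    P i j = (\<Sum>p<r. (c p)\<^sup>2 * (w p i * w p j)) \<and>
    Q i j = (\<Sum>p<r. c p * d p * (w p i * w p j)) \<and>
    R i j = (\<Sum>p<r. (d p)\<^sup>2 * (w p i * w p j))"
proof -
  obtain L where L: "\<forall>u v. bform I P u v = (\<Sum>(c, d, w)\<leftarrow>L. c\<^sup>2 * dot I w u * dot I w v) \<and>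
                   bform I Q u v = (\<Sum>(c, d, w)\<leftarrow>L. c * d * dot I w u * dot I w v) \<and>
                   bform I R u v = (\<Sum>(c, d, w)\<leftarrow>L. d\<^sup>2 * dot I w u * dot I w v)"
    using block_psd_separable[OF assms] by blast
  define c where "c = (\<lambda>p. fst (L ! p))"
  define d where "d = (\<lambda>p. fst (snd (L ! p)))"
  define w where "w = (\<lambda>p. snd (snd (L ! p)))"
  have "P i j = (\<Sum>p<length L. (c p)\<^sup>2 * (w p i * w p j)) \<and>
        Q i j = (\<Sum>p<length L. c p * d p * (w p i * w p j)) \<and>
        R i j = (\<Sum>p<length L. (d p)\<^sup>2 * (w p i * w p j))" if ij: "i \<in> I" "j \<in> I" for i j
    using L[rule_format, of "\<lambda>k. of_bool (k = i)" "\<lambda>k. of_bool (k = j)"] ij assms(1)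
    by (simp add: bform_unit dot_unit case_prod_unfold sum_list_index c_def d_def w_def mult.assoc)
  then show ?thesis by blast
qed

corollary psd_entries:
  assumes "finite I" "symmetric_on I A" "\<And>u. 0 \<le> bform I A u u"
  shows "\<exists>(r::nat) w. \<forall>i\<in>I. \<forall>j\<in>I. A i j = (\<Sum>p<r. w p i * w p j)"
proof -
  let ?Z = "\<lambda>_ _. 0 :: real"
  have Z: "symmetric_on I ?Z" by (simp add: symmetric_on_def)
  have "block_psd I A ?Z ?Z"
    using assms(3) by (simp add: block_psd_def bform_def)
  then obtain r :: nat and c d :: "nat \<Rightarrow> real" and w where
    e: "\<forall>i\<in>I. \<forall>j\<in>I. A i j = (\<Sum>p<r. (c p)\<^sup>2 * (w p i * w p j)) \<and>
      0 = (\<Sum>p<r. c p * d p * (w p i * w p j)) \<and> 0 = (\<Sum>p<r. (d p)\<^sup>2 * (w p i * w p j))"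
    using block_psd_entries[OF assms(1,2) Z Z] by blast
  have "\<forall>i\<in>I. \<forall>j\<in>I. A i j = (\<Sum>p<r. (c p)\<^sup>2 * (w p i * w p j))" using e by blast
  then show ?thesis
    by (intro exI[of _ r] exI[of _ "\<lambda>p i. c p * w p i"]) (simp add: power2_eq_square mult_ac)
qed

lemma psd_mat_iff: "psd_mat d A \<longleftrightarrow> symmetric_on {..<d} A \<and> (\<forall>u. 0 \<le> bform {..<d} A u u)"
  by (auto simp: psd_mat_def sym_mat_def symmetric_on_def bform_def)

lemma bform_sum_rank_one:
  assumes A: "\<And>i j. i \<in> I \<Longrightarrow> j \<in> I \<Longrightarrow> A i j = (\<Sum>p<(r::nat). a p i * b p j)"
  shows "bform I A u v = (\<Sum>p<r. dot I (a p) u * dot I (b p) v)"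
proof -
  have "(\<Sum>p<r. dot I (a p) u * dot I (b p) v) = (\<Sum>p<r. \<Sum>i\<in>I. \<Sum>j\<in>I. u i * (a p i * b p j) * v j)"
    by (simp add: dot_def sum_product mult_ac)
  also have "\<dots> = (\<Sum>i\<in>I. \<Sum>j\<in>I. \<Sum>p<r. u i * (a p i * b p j) * v j)"
    by (subst sum.swap, intro sum.cong refl, rule sum.swap)
  also have "\<dots> = bform I A u v"
    unfolding bform_def by (intro sum.cong refl) (simp add: A sum_distrib_left sum_distrib_right)
  finally show ?thesis by simp
qed

lemma sos_mat_iff_psd_mat: "sos_mat k A \<longleftrightarrow> psd_mat k A"
proof
  assume "sos_mat k A"
  then obtain r u where u: "\<forall>i<k. \<forall>j<k. A i j = (\<Sum>p<(r::nat). u p i * u p j)"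
    by (auto simp: sos_mat_def)
  have "bform {..<k} A x x \<ge> 0" for x
    using bform_sum_rank_one[where I = "{..<k}" and A = A and r = r and a = u and b = u and u = x and v = x] u by (simp add: sum_nonneg)
  moreover have "symmetric_on {..<k} A" using u by (simp add: symmetric_on_def mult.commute)
  ultimately show "psd_mat k A" by (simp add: psd_mat_iff)
next
  assume "psd_mat k A"
  then have "\<exists>(r::nat) w. \<forall>i\<in>{..<k}. \<forall>j\<in>{..<k}. A i j = (\<Sum>p<r. w p i * w p j)"
    by (intro psd_entries) (simp_all add: psd_mat_iff)
  then show "sos_mat k A" unfolding sos_mat_def by (simp add: Ball_def)
qed

text \<open>
  The matrix \<open>[P, Q; Q\<^sup>T, R]\<close> of size \<open>2 n\<close>.
\<close>

definition block_mat :: "nat \<Rightarrow> (nat \<Rightarrow> nat \<Rightarrow> real) \<Rightarrow> (nat \<Rightarrow> nat \<Rightarrow> real) \<Rightarrow> (nat \<Rightarrow> nat \<Rightarrow> real) \<Rightarrow> nat \<Rightarrow> nat \<Rightarrow> real" where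
  "block_mat n P Q R i j =
     (if i < n then if j < n then P i j else Q i (j - n)
      else if j < n then Q j (i - n) else R (i - n) (j - n))"

lemma sum_lessThan_twice: "(\<Sum>i<2 * n. f i) = (\<Sum>i<n. f i) + (\<Sum>i<n. f (n + i) :: 'a::comm_monoid_add)" for n :: nat
proof -
  have "(\<Sum>i\<in>{n..<n+n}. f i) = (\<Sum>i<n. f (n + i))"
    using sum.shift_bounds_nat_ivl[of f 0 n n] by (simp add: atLeast0LessThan add.commute)
  moreover have "{..<2*n} = {..<n} \<union> {n..<n+n}" by auto
  moreover have "sum f ({..<n} \<union> {n..<n+n}) = sum f {..<n} + sum f {n..<n+n}"
    by (rule sum.union_disjoint) auto
  ultimately show ?thesis by simp
qed

lemma psd_mat_block:
  assumes "symmetric_on {..<n} P" "symmetric_on {..<n} R"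
  shows "psd_mat (2 * n) (block_mat n P Q R) \<longleftrightarrow> block_psd {..<n} P Q R"
proof -
  let ?B = "block_mat n P Q R"
  have split: "bform {..<2*n} ?B x x = bform {..<n} P x x + 2 * bform {..<n} Q x (\<lambda>i. x (n + i))
       + bform {..<n} R (\<lambda>i. x (n + i)) (\<lambda>i. x (n + i))" for x
  proof -
    have "(\<Sum>i<n. \<Sum>j<n. x (n + i) * Q j i * x j) = bform {..<n} Q x (\<lambda>i. x (n + i))"
      unfolding bform_def by (subst sum.swap) (simp add: mult_ac)
    then show ?thesis
      by (simp add: bform_def sum_lessThan_twice sum.distrib block_mat_def)
  qed
  have "symmetric_on {..<2*n} ?B"
    using assms by (auto simp: symmetric_on_def block_mat_def)
  moreover have "(\<forall>x. 0 \<le> bform {..<2*n} ?B x x) \<longleftrightarrow> block_psd {..<n} P Q R"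
  proof
    assume nn: "\<forall>x. 0 \<le> bform {..<2*n} ?B x x"
    show "block_psd {..<n} P Q R"
      unfolding block_psd_def
    proof (intro allI)
      fix u v :: "nat \<Rightarrow> real"
      let ?x = "\<lambda>i. if i < n then u i else v (i - n)"
      have "bform {..<n} P ?x ?x = bform {..<n} P u u"
           "bform {..<n} Q ?x (\<lambda>i. ?x (n + i)) = bform {..<n} Q u v"
           "bform {..<n} R (\<lambda>i. ?x (n + i)) (\<lambda>i. ?x (n + i)) = bform {..<n} R v v"
        by (auto intro!: bform_cong)
      then show "0 \<le> bform {..<n} P u u + 2 * bform {..<n} Q u v + bform {..<n} R v v"
        using nn[rule_format, of ?x] unfolding split by simp
    qed
  qed (simp add: split block_psd_def)
  ultimately show ?thesis by (simp add: psd_mat_iff)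
qed

lemma sym_mat_block:
  "symmetric_on {..<n} P \<Longrightarrow> symmetric_on {..<n} R \<Longrightarrow> sym_mat (2 * n) (block_mat n P Q R)"
  by (auto simp: sym_mat_def symmetric_on_def block_mat_def)

lemma block_mat_add:
  "block_mat n P Q R i j + block_mat n P' Q' R' i j
     = block_mat n (\<lambda>i j. P i j + P' i j) (\<lambda>i j. Q i j + Q' i j) (\<lambda>i j. R i j + R' i j) i j"
  by (simp add: block_mat_def)

lemma block_mat_sum:
  "(\<Sum>l\<in>J. y l * block_mat n (P l) (Q l) (R l) i j)
     = block_mat n (\<lambda>i j. \<Sum>l\<in>J. y l * P l i j) (\<lambda>i j. \<Sum>l\<in>J. y l * Q l i j) (\<lambda>i j. \<Sum>l\<in>J. y l * R l i j) i j"
  by (simp add: block_mat_def)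

lemma linear_block_mat:
  assumes "\<And>i j. linear (\<lambda>x. P x i j)" "\<And>i j. linear (\<lambda>x. Q x i j)" "\<And>i j. linear (\<lambda>x. R x i j)"
  shows "linear (\<lambda>x. block_mat n (P x) (Q x) (R x) i j)"
  using assms by (cases "i < n"; cases "j < n") (simp_all add: block_mat_def)

section \<open>Finite-dimensional spaces and spectrahedral shadows\<close>

lemma separating_functional:
  fixes w :: "'e::real_vector"
  assumes "w \<noteq> 0"
  obtains h :: "'e \<Rightarrow> real" where "linear h" "h w \<noteq> 0"
proof -
  have "independent {w}" using assms by (simp add: dependent_single)
  then obtain h :: "'e \<Rightarrow> real" where "linear h" "\<forall>x\<in>{w}. h x = 1"
    using linear_independent_extend[of "{w}" "\<lambda>_. 1::real"] by blast
  then show ?thesis using that by simp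
qed

text \<open>
  The universal properties speak about functionals only; this carries their uniqueness part over to
  maps into an arbitrary space.
\<close>

lemma linear_zero_if_functionals_vanish:
  fixes F :: "'e::real_vector \<Rightarrow> 'f::real_vector"
  assumes "\<And>h :: 'e \<Rightarrow> real. linear h \<Longrightarrow> (\<And>x. x \<in> G \<Longrightarrow> h x = 0) \<Longrightarrow> h z = 0"
    and "linear F" and "\<And>x. x \<in> G \<Longrightarrow> F x = 0"
  shows "F z = 0"
proof (rule ccontr)
  assume "F z \<noteq> 0"
  then obtain h :: "'f \<Rightarrow> real" where h: "linear h" "h (F z) \<noteq> 0" by (rule separating_functional)
  have "(h \<circ> F) z = 0"
    using assms(1)[OF linear_compose[OF assms(2) h(1)]] assms(3) h(1) by (simp add: linear_0)
  then show False using h by simp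
qed

lemma finite_basis_of_expansion:
  fixes v :: "'j \<Rightarrow> 'e::real_vector"
  assumes "finite J" "\<And>x. x = (\<Sum>p\<in>J. c p x *\<^sub>R v p)"
  obtains B :: "'e set" where "finite B" "independent B" "span B = UNIV"
proof -
  have "x \<in> span (v ` J)" for x
    using assms(2)[of x] by (metis (no_types, lifting) imageI span_base span_scale span_sum)
  then have sp: "span (v ` J) = UNIV" by auto
  obtain B where B: "B \<subseteq> v ` J" "independent B" "v ` J \<subseteq> span B"
    using maximal_independent_subset[of "v ` J"] by blast
  have "finite B" using B(1) assms(1) finite_subset by blast
  moreover have "span B = UNIV" using B(3) sp by (metis span_minimal span_span subspace_span top.extremum_uniqueI)
  ultimately show ?thesis using B(2) that by blast
qed

lemma linear_eq_sum_representation: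
  fixes h :: "'e::real_vector \<Rightarrow> real"
  assumes "finite B" "independent B" "span B = UNIV" "linear h"
  shows "h x = (\<Sum>b\<in>B. representation B x b * h b)"
proof -
  have "x = (\<Sum>b\<in>B. representation B x b *\<^sub>R b)"
    using sum_representation_eq[of B x B] assms by auto
  then have "h x = h (\<Sum>b\<in>B. representation B x b *\<^sub>R b)" by simp
  also have "\<dots> = (\<Sum>b\<in>B. representation B x b * h b)"
    by (simp add: linear_sum[OF assms(4)] linear_cmul[OF assms(4)])
  finally show ?thesis .
qed

text \<open>
  The parameters of the pencil may be indexed by any finite set, and its linear part may be given
  without reference to a basis.
\<close>

lemma SDR_setI:
  fixes S :: "'e::real_vector set"
  assumes B: "finite B" "independent B" "span B = (UNIV :: 'e set)"
    and lin: "\<And>i j. linear (\<lambda>x. M x i j)" and sym: "\<And>x. sym_mat d (M x)"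
    and J: "finite J" and symN: "\<And>l. l \<in> J \<Longrightarrow> sym_mat d (N l)"
    and S: "\<And>x. x \<in> S \<longleftrightarrow> (\<exists>y. psd_mat d (\<lambda>i j. M x i j + (\<Sum>l\<in>J. y l * N l i j)))"
  shows "SDR_set S"
proof -
  obtain g where g: "bij_betw g {..<card J} J"
    using ex_bij_betw_nat_finite[OF J] by (auto simp: atLeast0LessThan)
  have rep: "M x i j = (\<Sum>b\<in>B. representation B x b * M b i j)" for x i j
    using linear_eq_sum_representation[OF B lin] .
  have "x \<in> S \<longleftrightarrow> (\<exists>y. psd_mat d (\<lambda>i j. 0 + (\<Sum>b\<in>B. representation B x b * M b i j)
          + (\<Sum>l<card J. y l * N (g l) i j)))" for x
  proof
    assume "x \<in> S"
    then obtain y where y: "psd_mat d (\<lambda>i j. M x i j + (\<Sum>l\<in>J. y l * N l i j))" using S by blast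
    have "(\<Sum>l\<in>J. y l * N l i j) = (\<Sum>l<card J. y (g l) * N (g l) i j)" for i j
      using sum.reindex_bij_betw[OF g, of "\<lambda>l. y l * N l i j"] by simp
    then show "\<exists>y. psd_mat d (\<lambda>i j. 0 + (\<Sum>b\<in>B. representation B x b * M b i j)
          + (\<Sum>l<card J. y l * N (g l) i j))"
      using y unfolding rep[symmetric] by (intro exI[of _ "y \<circ> g"]) simp
  next
    assume "\<exists>y. psd_mat d (\<lambda>i j. 0 + (\<Sum>b\<in>B. representation B x b * M b i j)
          + (\<Sum>l<card J. y l * N (g l) i j))"
    then obtain y where y: "psd_mat d (\<lambda>i j. M x i j + (\<Sum>l<card J. y l * N (g l) i j))"
      unfolding rep[symmetric] by auto
    define y' where "y' = (\<lambda>l. y (the_inv_into {..<card J} g l))"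
    have "(\<Sum>l\<in>J. y' l * N l i j) = (\<Sum>l<card J. y l * N (g l) i j)" for i j
    proof -
      have "(\<Sum>l\<in>J. y' l * N l i j) = (\<Sum>l<card J. y' (g l) * N (g l) i j)"
        using sum.reindex_bij_betw[OF g, of "\<lambda>l. y' l * N l i j"] by simp
      also have "\<dots> = (\<Sum>l<card J. y l * N (g l) i j)"
        using g by (intro sum.cong refl) (simp add: y'_def bij_betw_def the_inv_into_f_f)
      finally show ?thesis .
    qed
    then have "psd_mat d (\<lambda>i j. M x i j + (\<Sum>l\<in>J. y' l * N l i j))" using y by simp
    then show "x \<in> S" using S by blast
  qed
  then have "S = {x. \<exists>y. psd_mat d (\<lambda>i j. 0 + (\<Sum>b\<in>B. representation B x b * M b i j)
          + (\<Sum>l<card J. y l * N (g l) i j))}" by blast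
  moreover have "\<forall>l<card J. sym_mat d (N (g l))" using g symN by (auto simp: bij_betw_def)
  moreover have "sym_mat d (\<lambda>_ _. 0)" by (simp add: sym_mat_def)
  ultimately show ?thesis
    unfolding SDR_set_def using B sym
    by (intro exI[of _ B] exI[of _ d] exI[of _ "card J"] exI[of _ "\<lambda>_ _. 0"] exI[of _ M]
          exI[of _ "\<lambda>l. N (g l)"]) simp
qed

text \<open>
  The norm of a combination of basis vectors is continuous in the coefficients and has a positive
  minimum on their unit sphere, so coefficients are bounded by the norm.
\<close>

lemma bounded_linear_finite_dim:
  fixes h :: "'e::real_normed_vector \<Rightarrow> real"
  assumes B: "finite B" "independent B" "span B = (UNIV :: 'e set)" and lin: "linear h"
  shows "bounded_linear h"
proof (cases "B = {}")
  case True
  then have "h x = 0" for x using linear_eq_sum_representation[OF B lin, of x] by simp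
  then have "h = (\<lambda>_. 0)" by auto
  then show ?thesis by simp
next
  case False
  define T where "T = (\<lambda>u. \<Sum>b\<in>B. u b *\<^sub>R b)"
  have cont: "continuous_on (usphere B) (\<lambda>u. norm (T u))"
    unfolding T_def by (intro continuous_intros continuous_on_coord)
  obtain u0 where u0: "u0 \<in> usphere B" "\<And>u. u \<in> usphere B \<Longrightarrow> norm (T u0) \<le> norm (T u)"
    using continuous_attains_inf[OF compact_usphere[OF B(1)] usphere_nonempty[OF False B(1)] cont] by auto
  have "T u0 \<noteq> 0"
  proof
    assume "T u0 = 0"
    then have "\<forall>b\<in>B. u0 b = 0" using B(1,2) by (auto simp: T_def dependent_finite)
    then show False using u0(1) by (auto simp: usphere_def)
  qed
  then have d: "norm (T u0) > 0" by simp
  define K where "K = (\<Sum>b\<in>B. \<bar>h b\<bar>) / norm (T u0)"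
  have "norm (h x) \<le> norm x * K" for x
  proof -
    let ?r = "representation B x"
    have x: "T ?r = x" using sum_representation_eq[of B x B] B by (simp add: T_def)
    have "\<bar>?r b\<bar> * norm (T u0) \<le> norm x" if b: "b \<in> B" for b
    proof (cases "?r b = 0")
      case False
      then obtain k v where v: "k > 0" "v \<in> usphere B" "\<And>b. b \<in> B \<Longrightarrow> ?r b = k * v b"
         "k\<^sup>2 = (\<Sum>b\<in>B. (?r b)\<^sup>2)" using usphere_normalize[OF B(1) b] by metis
      have "(?r b)\<^sup>2 \<le> k\<^sup>2" unfolding v(4) using B(1) b by (intro member_le_sum) auto
      then have "\<bar>?r b\<bar> \<le> k" using v(1) by (simp add: abs_le_square_iff[symmetric])
      moreover have "T ?r = k *\<^sub>R T v" by (simp add: T_def v(3) scaleR_sum_right cong: sum.cong)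
      then have "norm x = k * norm (T v)" using x v(1) by simp
      ultimately show ?thesis using u0(2)[OF v(2)] v(1)
        by (simp add: mult_mono)
    qed simp
    then have r: "\<bar>?r b\<bar> \<le> norm x / norm (T u0)" if "b \<in> B" for b
      using d that by (simp add: field_simps)
    have "\<bar>h x\<bar> \<le> (\<Sum>b\<in>B. \<bar>?r b * h b\<bar>)"
      unfolding linear_eq_sum_representation[OF B lin, of x] by (rule sum_abs)
    also have "\<dots> \<le> (\<Sum>b\<in>B. norm x / norm (T u0) * \<bar>h b\<bar>)"
      unfolding abs_mult by (intro sum_mono mult_right_mono r) auto
    also have "\<dots> = norm x * K" by (simp add: K_def sum_distrib_left sum_divide_distrib)
    finally show ?thesis by simp
  qed
  then show ?thesis using lin by (intro bounded_linear_intro) (auto simp: linear_add linear_cmul)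
qed

section \<open>Coordinates for symmetric squares and tensor products\<close>

lemma bilinear_expand:
  assumes "bilinear b"
  shows "b (\<Sum>i\<in>I. c i *\<^sub>R x i) (\<Sum>j\<in>J. d j *\<^sub>R y j) = (\<Sum>i\<in>I. \<Sum>j\<in>J. (c i * d j) *\<^sub>R b (x i) (y j))"
proof -
  have l: "linear (\<lambda>x. b x y)" and r: "linear (\<lambda>y. b x y)" for x y
    using assms by (auto simp: bilinear_def)
  have "b (\<Sum>i\<in>I. c i *\<^sub>R x i) (\<Sum>j\<in>J. d j *\<^sub>R y j)
      = (\<Sum>i\<in>I. c i *\<^sub>R b (x i) (\<Sum>j\<in>J. d j *\<^sub>R y j))"
    by (simp only: linear_sum[OF l] linear_cmul[OF l])
  also have "\<dots> = (\<Sum>i\<in>I. \<Sum>j\<in>J. (c i * d j) *\<^sub>R b (x i) (y j))"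
    by (simp add: linear_sum[OF r] linear_cmul[OF r] scaleR_sum_right)
  finally show ?thesis .
qed

lemma bilinear_mult_linear:
  assumes "linear f" "linear g"
  shows "bilinear (\<lambda>x y. f x * g y :: real)"
proof -
  interpret f: linear f by fact
  interpret g: linear g by fact
  show ?thesis
    by (auto simp: bilinear_def linear_iff f.add f.scale g.add g.scale algebra_simps)
qed

lemma bilinear_symmetrized:
  assumes "linear f" "linear g"
  shows "bilinear (\<lambda>x y. (f x * g y + g x * f y) / 2 :: real)"
proof -
  interpret f: linear f by fact
  interpret g: linear g by fact
  show ?thesis
    by (auto simp: bilinear_def linear_iff f.add f.scale g.add g.scale algebra_simps add_divide_distrib)
qed

lemma symmetric_square_spanned:
  assumes "is_symmetric_square s" and "linear F" and "\<And>x y. F (s x y) = 0"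
  shows "F z = 0"
proof (rule linear_zero_if_functionals_vanish[OF _ assms(2), where G = "{s x y | x y. True}"])
  fix h :: "_ \<Rightarrow> real"
  assume h: "linear h" "\<And>x. x \<in> {s x y |x y. True} \<Longrightarrow> h x = 0"
  have "bilinear (\<lambda>x y. 0::real)" by (simp add: bilinear_def linear_iff)
  then have "\<exists>!f. linear f \<and> (\<forall>x y. f (s x y) = (0::real))"
    using assms(1) unfolding is_symmetric_square_def by blast
  moreover have "linear h \<and> (\<forall>x y. h (s x y) = 0)" using h by blast
  moreover have "linear (\<lambda>_. 0::real)" by (simp add: linear_iff)
  ultimately have "h = (\<lambda>_. 0)" by blast
  then show "h z = 0" by simp
qed (use assms(3) in auto)

lemma tensor_product_spanned:
  assumes "is_tensor_product t" and "linear F" and "\<And>x y. F (t x y) = 0"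
  shows "F z = 0"
proof (rule linear_zero_if_functionals_vanish[OF _ assms(2), where G = "{t x y | x y. True}"])
  fix h :: "_ \<Rightarrow> real"
  assume h: "linear h" "\<And>x. x \<in> {t x y |x y. True} \<Longrightarrow> h x = 0"
  have "bilinear (\<lambda>x y. 0::real)" by (simp add: bilinear_def linear_iff)
  then have "\<exists>!f. linear f \<and> (\<forall>x y. f (t x y) = (0::real))"
    using assms(1) unfolding is_tensor_product_def by blast
  moreover have "linear h \<and> (\<forall>x y. h (t x y) = 0)" using h by blast
  moreover have "linear (\<lambda>_. 0::real)" by (simp add: linear_iff)
  ultimately have "h = (\<lambda>_. 0)" by blast
  then show "h z = 0" by simp
qed (use assms(3) in auto)

text \<open>
  Coordinates \<open>xi\<close> on \<open>V\<close> and \<open>mu\<close> on \<open>Sym\<^sup>2 V\<close> with respect to spanning families. The vectors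
  \<open>e i\<close> need not be independent: in dimension less than \<open>N\<close> some of them may be \<open>0\<close>. In this way
  \<open>N = 2\<close> covers all dimensions up to 2.
\<close>

locale sym_square_coords =
  fixes s :: "'v::real_vector \<Rightarrow> 'v \<Rightarrow> 'a::real_vector" and N :: nat
    and e :: "nat \<Rightarrow> 'v" and xi :: "nat \<Rightarrow> 'v \<Rightarrow> real" and mu :: "nat \<Rightarrow> nat \<Rightarrow> 'a \<Rightarrow> real"
  assumes bil: "bilinear s" and comm: "s x y = s y x"
    and xi_linear: "linear (xi i)" and mu_linear: "linear (mu i j)"
    and mu_prod: "mu i j (s x y) = (xi i x * xi j y + xi j x * xi i y) / 2"
    and expand: "x = (\<Sum>i<N. xi i x *\<^sub>R e i)"
    and expand_square: "a = (\<Sum>i<N. \<Sum>j<N. mu i j a *\<^sub>R s (e i) (e j))"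
begin

definition vec :: "(nat \<Rightarrow> real) \<Rightarrow> 'v" where "vec c = (\<Sum>i<N. c i *\<^sub>R e i)"

lemma vec_xi: "vec (\<lambda>i. xi i x) = x"
  using expand[of x, symmetric] by (simp add: vec_def)

lemma s_vec: "s (vec c) (vec d) = (\<Sum>i<N. \<Sum>j<N. (c i * d j) *\<^sub>R s (e i) (e j))"
  unfolding vec_def by (rule bilinear_expand[OF bil])

lemma mu_square: "mu i j (s x x) = xi i x * xi j x"
  by (simp add: mu_prod mult.commute)

lemma mu_commute: "mu i j a = mu j i a"
proof -
  have "mu i j (\<Sum>k<N. \<Sum>l<N. mu k l a *\<^sub>R s (e k) (e l)) = mu j i (\<Sum>k<N. \<Sum>l<N. mu k l a *\<^sub>R s (e k) (e l))"
    by (simp add: linear_sum[OF mu_linear] linear_cmul[OF mu_linear] mu_prod add.commute)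
  then show ?thesis using expand_square[of a, symmetric] by simp
qed

text \<open>
  Writing the coordinate matrix as a sum of rank one squares amounts to writing the element as a sum of
  squares.
\<close>

lemma psd_cone_iff: "a \<in> psd_cone s \<longleftrightarrow> (\<forall>u. 0 \<le> bform {..<N} (\<lambda>i j. mu i j a) u u)"
proof
  assume "a \<in> psd_cone s"
  then obtain k :: nat and v where a: "a = (\<Sum>p<k. s (v p) (v p))" unfolding psd_cone_def by blast
  have "mu i j a = (\<Sum>p<k. xi i (v p) * xi j (v p))" for i j
    by (simp add: a linear_sum[OF mu_linear] mu_square)
  then have "bform {..<N} (\<lambda>i j. mu i j a) u u
      = (\<Sum>p<k. dot {..<N} (\<lambda>i. xi i (v p)) u * dot {..<N} (\<lambda>i. xi i (v p)) u)" for u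
    by (rule bform_sum_rank_one)
  then show "\<forall>u. 0 \<le> bform {..<N} (\<lambda>i j. mu i j a) u u" by (simp add: sum_nonneg)
next
  assume psd: "\<forall>u. 0 \<le> bform {..<N} (\<lambda>i j. mu i j a) u u"
  have "symmetric_on {..<N} (\<lambda>i j. mu i j a)" using mu_commute by (simp add: symmetric_on_def)
  then obtain r :: nat and w where
    w: "\<forall>i\<in>{..<N}. \<forall>j\<in>{..<N}. mu i j a = (\<Sum>p<r. w p i * w p j)"
    using psd_entries[of "{..<N}" "\<lambda>i j. mu i j a"] psd by blast
  have "a = (\<Sum>i<N. \<Sum>j<N. mu i j a *\<^sub>R s (e i) (e j))" by (rule expand_square)
  also have "\<dots> = (\<Sum>i<N. \<Sum>j<N. (\<Sum>p<r. w p i * w p j) *\<^sub>R s (e i) (e j))"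
    by (intro sum.cong refl) (use w in simp)
  also have "\<dots> = (\<Sum>i<N. \<Sum>j<N. \<Sum>p<r. (w p i * w p j) *\<^sub>R s (e i) (e j))"
    by (simp add: scaleR_sum_left)
  also have "\<dots> = (\<Sum>i<N. \<Sum>p<r. \<Sum>j<N. (w p i * w p j) *\<^sub>R s (e i) (e j))"
    by (rule sum.cong[OF refl], rule sum.swap)
  also have "\<dots> = (\<Sum>p<r. s (vec (w p)) (vec (w p)))"
    unfolding s_vec by (rule sum.swap)
  finally show "a \<in> psd_cone s"
    unfolding psd_cone_def by (intro CollectI exI[of _ r] exI[of _ "\<lambda>p. vec (w p)"]) simp
qed

lemma bform_mu_linear: "linear (\<lambda>a. bform {..<N} (\<lambda>i j. mu i j a) u v)"
  unfolding bform_def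
  by (intro linear_compose_sum ballI)
     (auto simp: linear_iff linear_add[OF mu_linear] linear_cmul[OF mu_linear] algebra_simps)

lemma convex_cone_psd_cone: "convex_cone (psd_cone s)"
  unfolding convex_cone_iff
  by (auto simp: psd_cone_iff linear_0[OF bform_mu_linear] linear_add[OF bform_mu_linear] linear_cmul[OF bform_mu_linear])

lemma square_in_psd_cone: "s v v \<in> psd_cone s"
  unfolding psd_cone_iff mu_square by (simp add: bform_rank_one)

end

text \<open>
  A basis, padded by zeros to length \<open>N\<close>.
\<close>

lemma basis_coordinates:
  assumes "has_dimension TYPE('v::real_vector) m" "m \<le> N"
  shows "\<exists>(e :: nat \<Rightarrow> 'v) xi. (\<forall>i. linear (xi i)) \<and> (\<forall>x. x = (\<Sum>i<N. xi i x *\<^sub>R e i)) \<and>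
           (\<forall>i<m. \<forall>j<m. xi i (e j) = of_bool (i = j))"
proof -
  obtain B :: "'v set" where B: "finite B" "independent B" "span B = UNIV" "card B = m"
    using assms(1) by (auto simp: has_dimension_def)
  obtain f where f: "bij_betw f {..<m} B"
    using ex_bij_betw_nat_finite[OF B(1)] B(4) by (auto simp: atLeast0LessThan)
  have fB: "f i \<in> B" if "i < m" for i using f that by (auto simp: bij_betw_def)
  define e where "e = (\<lambda>i. if i < m then f i else 0)"
  define xi where "xi = (\<lambda>i x. if i < m then representation B x (f i) else 0)"
  have lin: "linear (xi i)" for i
    using B by (auto simp: xi_def linear_iff representation_add representation_scale)
  have exp: "x = (\<Sum>i<N. xi i x *\<^sub>R e i)" for x
  proof -
    have "x = (\<Sum>b\<in>B. representation B x b *\<^sub>R b)"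
      using sum_representation_eq[of B x B] B by auto
    also have "\<dots> = (\<Sum>i<m. representation B x (f i) *\<^sub>R f i)"
      using sum.reindex_bij_betw[OF f, of "\<lambda>b. representation B x b *\<^sub>R b"] by simp
    also have "\<dots> = (\<Sum>i<N. xi i x *\<^sub>R e i)"
      by (rule sum.mono_neutral_cong_left) (use assms(2) in \<open>auto simp: xi_def e_def\<close>)
    finally show ?thesis .
  qed
  have "xi i (e j) = of_bool (i = j)" if "i < m" "j < m" for i j
  proof -
    have "(f j = f i) = (i = j)" using f that by (auto simp: bij_betw_def inj_on_def)
    then show ?thesis
      using that representation_basis[OF B(2) fB[of j]] by (auto simp: xi_def e_def)
  qed
  then show ?thesis using lin exp by blast
qed

lemma sym_square_coords_exist:
  fixes s :: "'v::real_vector \<Rightarrow> 'v \<Rightarrow> 'a::real_vector"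
  assumes "has_dimension TYPE('v) m" "m \<le> N" and s: "is_symmetric_square s"
  shows "\<exists>e xi mu. sym_square_coords s N e xi mu \<and> (\<forall>i<m. \<forall>j<m. xi i (e j) = of_bool (i = j))"
proof -
  obtain e :: "nat \<Rightarrow> 'v" and xi where xi: "\<And>i. linear (xi i)"
    and exp: "\<And>x. x = (\<Sum>i<N. xi i x *\<^sub>R e i)"
    and dual: "\<forall>i<m. \<forall>j<m. xi i (e j) = of_bool (i = j)"
    using basis_coordinates[OF assms(1,2)] by auto
  have bil: "bilinear s" and comm: "s x y = s y x" for x y
    using s by (auto simp: is_symmetric_square_def)
  have univ: "\<And>b :: 'v \<Rightarrow> 'v \<Rightarrow> real. bilinear b \<Longrightarrow> (\<And>x y. b x y = b y x) \<Longrightarrow>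
      \<exists>!h. linear h \<and> (\<forall>x y. h (s x y) = b x y)"
    using s unfolding is_symmetric_square_def by blast
  have "\<exists>h. linear h \<and> (\<forall>x y. h (s x y) = (xi i x * xi j y + xi j x * xi i y) / 2)" for i j
    using univ[OF bilinear_symmetrized[OF xi[of i] xi[of j]]] by (simp add: algebra_simps) blast
  then obtain mu where mu: "\<And>i j. linear (mu i j)"
    "\<And>i j x y. mu i j (s x y) = (xi i x * xi j y + xi j x * xi i y) / 2" by metis
  define F where "F = (\<lambda>a. a - (\<Sum>i<N. \<Sum>j<N. mu i j a *\<^sub>R s (e i) (e j)))"
  have "linear F"
    unfolding F_def
    by (intro linear_compose_sub linear_ident linear_compose_sum ballI)
       (auto simp: linear_iff linear_add[OF mu(1)] linear_cmul[OF mu(1)] algebra_simps)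
  moreover have "F (s x y) = 0" for x y
  proof -
    have b: "s x y = (\<Sum>i<N. \<Sum>j<N. (xi i x * xi j y) *\<^sub>R s (e i) (e j))" for x y
      using bilinear_expand[OF bil, of "\<lambda>i. xi i x" e "{..<N}" "\<lambda>i. xi i y" e "{..<N}"] exp[of x, symmetric] exp[of y, symmetric] by simp
    have b': "s y x = (\<Sum>i<N. \<Sum>j<N. (xi j x * xi i y) *\<^sub>R s (e i) (e j))"
      unfolding b[of y x] by (simp add: mult.commute)
    have "(\<Sum>i<N. \<Sum>j<N. ((xi i x * xi j y + xi j x * xi i y) / 2) *\<^sub>R s (e i) (e j))
        = (1/2) *\<^sub>R (s x y + s y x)"
      unfolding b[of x y] b'
      by (simp add: scaleR_sum_right sum.distrib scaleR_add_left scaleR_add_right add_divide_distrib)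
    then show ?thesis by (simp add: F_def mu(2) comm[of y x] scaleR_2[symmetric])
  qed
  ultimately have "F a = 0" for a by (rule symmetric_square_spanned[OF s])
  then have exp2: "a = (\<Sum>i<N. \<Sum>j<N. mu i j a *\<^sub>R s (e i) (e j))" for a by (simp add: F_def)
  have "sym_square_coords s N e xi mu"
    by (rule sym_square_coords.intro) (fact bil, fact comm, fact xi, fact mu(1), fact mu(2), fact exp, fact exp2)
  then show ?thesis using dual by blast
qed

lemma convex_cone_sum:
  "convex_cone S \<Longrightarrow> (\<And>p. g p \<in> S) \<Longrightarrow> (\<Sum>p<(r::nat). g p) \<in> S"
  by (induction r) (auto simp: convex_cone_iff)

lemma bilinear_psd_cones_in_convex_cone:
  assumes "bilinear b" "convex_cone S" "\<And>v w. b (s v v) (s' w w) \<in> S"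
    and "x \<in> psd_cone s" "y \<in> psd_cone s'"
  shows "b x y \<in> S"
proof -
  obtain k :: nat and v where x: "x = (\<Sum>p<k. s (v p) (v p))" using assms(4) unfolding psd_cone_def by blast
  obtain l :: nat and w where y: "y = (\<Sum>p<l. s' (w p) (w p))" using assms(5) unfolding psd_cone_def by blast
  have "b x y = (\<Sum>p<k. \<Sum>q<l. b (s (v p) (v p)) (s' (w q) (w q)))"
    unfolding x y using bilinear_expand[OF assms(1), of "\<lambda>_. 1" _ "{..<k}" "\<lambda>_. 1" _ "{..<l}"] by simp
  then show ?thesis using convex_cone_sum[OF assms(2)] assms(3) by simp
qed

locale tensor_coords = V: sym_square_coords sV M e xi mu + W: sym_square_coords sW N f eta nu
  for sV :: "'v::real_vector \<Rightarrow> 'v \<Rightarrow> 'a::real_vector" and M e xi mu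
    and sW :: "'w::real_vector \<Rightarrow> 'w \<Rightarrow> 'b::real_vector" and N f eta nu +
  fixes t :: "'a \<Rightarrow> 'b \<Rightarrow> 'c::real_vector" and tau :: "nat \<Rightarrow> nat \<Rightarrow> nat \<Rightarrow> nat \<Rightarrow> 'c \<Rightarrow> real"
  assumes t_bil: "bilinear t" and tau_linear: "linear (tau i j k l)"
    and tau_tensor: "tau i j k l (t a b) = mu i j a * nu k l b"
    and expand_tensor: "z = (\<Sum>i<M. \<Sum>j<M. \<Sum>k<N. \<Sum>l<N. tau i j k l z *\<^sub>R t (sV (e i) (e j)) (sW (f k) (f l)))"
begin

lemma tensor_cone_subset:
  assumes "convex_cone S" "\<And>v w. t (sV v v) (sW w w) \<in> S"
  shows "tensor_cone t (psd_cone sV) (psd_cone sW) \<subseteq> S"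
  unfolding tensor_cone_def
  by (rule hull_minimal) (use bilinear_psd_cones_in_convex_cone[where s = sV and s' = sW, OF t_bil assms] assms(1) in auto)

lemma convex_cone_tensor_cone: "convex_cone (tensor_cone t (psd_cone sV) (psd_cone sW))"
  unfolding tensor_cone_def by (rule convex_cone_convex_cone_hull)

lemma generator_in_tensor_cone: "t (sV v v) (sW w w) \<in> tensor_cone t (psd_cone sV) (psd_cone sW)"
  unfolding tensor_cone_def using V.square_in_psd_cone W.square_in_psd_cone by (blast intro: hull_inc)

lemma tau_generator: "tau i j k l (t (sV v v) (sW w w)) = xi i v * xi j v * (eta k w * eta l w)"
  by (simp add: tau_tensor V.mu_square W.mu_square)

end

lemma tensor_coords_exist:
  assumes V: "sym_square_coords sV M e xi mu" and W: "sym_square_coords sW N f eta nu"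
    and t: "is_tensor_product t"
  shows "\<exists>tau. tensor_coords sV M e xi mu sW N f eta nu t tau"
proof -
  interpret V: sym_square_coords sV M e xi mu by fact
  interpret W: sym_square_coords sW N f eta nu by fact
  have bil: "bilinear t" using t by (simp add: is_tensor_product_def)
  have "\<exists>h. linear h \<and> (\<forall>a b. h (t a b) = mu i j a * nu k l b)" for i j k l
    using t bilinear_mult_linear[OF V.mu_linear[of i j] W.mu_linear[of k l]]
    unfolding is_tensor_product_def by blast
  then obtain tau where tau: "\<And>i j k l. linear (tau i j k l)"
    "\<And>i j k l a b. tau i j k l (t a b) = mu i j a * nu k l b" by metis
  define F where "F = (\<lambda>z. z - (\<Sum>i<M. \<Sum>j<M. \<Sum>k<N. \<Sum>l<N. tau i j k l z *\<^sub>R t (sV (e i) (e j)) (sW (f k) (f l))))"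
  have "linear F"
    unfolding F_def
    by (intro linear_compose_sub linear_ident linear_compose_sum ballI)
       (auto simp: linear_iff linear_add[OF tau(1)] linear_cmul[OF tau(1)] algebra_simps)
  moreover have "F (t a b) = 0" for a b
  proof -
    have l: "linear (\<lambda>x. t x y)" and r: "linear (\<lambda>y. t x y)" for x y
      using bil by (auto simp: bilinear_def)
    have "t a b = t (\<Sum>i<M. \<Sum>j<M. mu i j a *\<^sub>R sV (e i) (e j)) (\<Sum>k<N. \<Sum>l<N. nu k l b *\<^sub>R sW (f k) (f l))"
      using V.expand_square[of a, symmetric] W.expand_square[of b, symmetric] by simp
    also have "\<dots> = (\<Sum>i<M. \<Sum>j<M. mu i j a *\<^sub>R
        t (sV (e i) (e j)) (\<Sum>k<N. \<Sum>l<N. nu k l b *\<^sub>R sW (f k) (f l)))"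
      by (simp only: linear_sum[OF l] linear_cmul[OF l])
    also have "\<dots> = (\<Sum>i<M. \<Sum>j<M. \<Sum>k<N. \<Sum>l<N. (mu i j a * nu k l b) *\<^sub>R t (sV (e i) (e j)) (sW (f k) (f l)))"
      by (simp add: linear_sum[OF r] linear_cmul[OF r] scaleR_sum_right)
    finally have eq: "t a b = \<dots>" .
    show ?thesis unfolding F_def tau(2) by (simp add: eq[symmetric])
  qed
  ultimately have "F z = 0" for z by (rule tensor_product_spanned[OF t])
  then have exp: "z = (\<Sum>i<M. \<Sum>j<M. \<Sum>k<N. \<Sum>l<N. tau i j k l z *\<^sub>R t (sV (e i) (e j)) (sW (f k) (f l)))" for z
    by (simp add: F_def)
  have "tensor_coords sV M e xi mu sW N f eta nu t tau"
    by (intro tensor_coords.intro[OF V W] tensor_coords_axioms.intro)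
       (fact bil, fact tau(1), fact tau(2), fact exp)
  then show ?thesis by blast
qed

section \<open>The tensor product cone when one factor has dimension at most two\<close>

lemma finite_basis_sym_square:
  fixes s :: "'v::real_vector \<Rightarrow> 'v \<Rightarrow> 'a::real_vector"
  assumes "sym_square_coords s N e xi mu"
  obtains B :: "'a set" where "finite B" "independent B" "span B = UNIV"
proof -
  interpret sym_square_coords s N e xi mu by fact
  show ?thesis
  proof (rule finite_basis_of_expansion)
    show "finite ({..<N} \<times> {..<N})" by simp
    show "a = (\<Sum>p\<in>{..<N} \<times> {..<N}. mu (fst p) (snd p) a *\<^sub>R s (e (fst p)) (e (snd p)))" for a
      using expand_square[of a] unfolding sum.cartesian_product by (simp only: case_prod_unfold)
  qed (rule that)
qed

context tensor_coords
begin

lemma finite_basis_tensor: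
  obtains B :: "'c set" where "finite B" "independent B" "span B = UNIV"
proof (rule finite_basis_of_expansion)
  let ?J = "{..<M} \<times> {..<M} \<times> {..<N} \<times> {..<N}"
  show "finite ?J" by simp
  show "z = (\<Sum>p\<in>?J. tau (fst p) (fst (snd p)) (fst (snd (snd p))) (snd (snd (snd p))) z *\<^sub>R
      t (sV (e (fst p)) (e (fst (snd p)))) (sW (f (fst (snd (snd p)))) (f (snd (snd (snd p))))))" for z
    using expand_tensor[of z] unfolding sum.cartesian_product by (simp only: case_prod_unfold fst_conv snd_conv)
qed (rule that)

lemma tau_inject:
  assumes "\<And>i j k l. i < M \<Longrightarrow> j < M \<Longrightarrow> k < N \<Longrightarrow> l < N \<Longrightarrow> tau i j k l z = tau i j k l z'"
  shows "z = z'"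
proof -
  have "z = (\<Sum>i<M. \<Sum>j<M. \<Sum>k<N. \<Sum>l<N. tau i j k l z *\<^sub>R t (sV (e i) (e j)) (sW (f k) (f l)))"
    by (rule expand_tensor)
  also have "\<dots> = (\<Sum>i<M. \<Sum>j<M. \<Sum>k<N. \<Sum>l<N. tau i j k l z' *\<^sub>R t (sV (e i) (e j)) (sW (f k) (f l)))"
    by (intro sum.cong refl) (use assms in simp)
  also have "\<dots> = z'" by (rule expand_tensor[symmetric])
  finally show ?thesis .
qed

lemma tau_commute: "tau i j k l z = tau j i k l z" "tau i j k l z = tau i j l k z"
proof -
  have "tau i j k l z - tau j i k l z = 0" and "tau i j k l z - tau i j l k z = 0"
  proof -
    let ?S = "\<Sum>i<M. \<Sum>j<M. \<Sum>k<N. \<Sum>l<N. tau i j k l z *\<^sub>R t (sV (e i) (e j)) (sW (f k) (f l))"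
    have "tau i j k l ?S = tau j i k l ?S" "tau i j k l ?S = tau i j l k ?S"
      by (simp_all only: linear_sum[OF tau_linear] linear_cmul[OF tau_linear] tau_tensor
          V.mu_commute[of i j] W.mu_commute[of k l])
    then show "tau i j k l z - tau j i k l z = 0" and "tau i j k l z - tau i j l k z = 0"
      unfolding expand_tensor[of z, symmetric] by simp_all
  qed
  then show "tau i j k l z = tau j i k l z" "tau i j k l z = tau i j l k z" by simp_all
qed

lemma generator_vec:
  "t (sV (V.vec c) (V.vec c)) (sW (W.vec d) (W.vec d))
     = (\<Sum>i<M. \<Sum>j<M. \<Sum>k<N. \<Sum>l<N. (c i * c j * (d k * d l)) *\<^sub>R t (sV (e i) (e j)) (sW (f k) (f l)))"
proof -
  have l: "linear (\<lambda>x. t x y)" and r: "linear (\<lambda>y. t x y)" for x y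
    using t_bil by (auto simp: bilinear_def)
  have "t (sV (V.vec c) (V.vec c)) (sW (W.vec d) (W.vec d))
      = (\<Sum>i<M. \<Sum>j<M. (c i * c j) *\<^sub>R t (sV (e i) (e j)) (sW (W.vec d) (W.vec d)))"
    unfolding V.s_vec by (simp only: linear_sum[OF l] linear_cmul[OF l])
  also have "\<dots> = (\<Sum>i<M. \<Sum>j<M. \<Sum>k<N. \<Sum>l<N. (c i * c j * (d k * d l)) *\<^sub>R t (sV (e i) (e j)) (sW (f k) (f l)))"
    unfolding W.s_vec by (simp add: linear_sum[OF r] linear_cmul[OF r] scaleR_sum_right)
  finally show ?thesis .
qed

abbreviation separable_cone :: "'c set" where
  "separable_cone \<equiv> tensor_cone t (psd_cone sV) (psd_cone sW)"

text \<open>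
  For \<open>M = 2\<close> the coordinates of a tensor form a block matrix with three distinct symmetric blocks,
  and \<open>block_psd_separable\<close> applies.
\<close>

lemma separable_iff_block_psd:
  assumes M: "M = 2"
  shows "z \<in> separable_cone \<longleftrightarrow>
    block_psd {..<N} (\<lambda>k l. tau 0 0 k l z) (\<lambda>k l. tau 0 1 k l z) (\<lambda>k l. tau 1 1 k l z)"
    (is "_ \<longleftrightarrow> ?psd z")
proof
  let ?b = "\<lambda>i j u v z. bform {..<N} (\<lambda>k l. tau i j k l z) u v"
  have lin: "linear (?b i j u v)" for i j u v
    unfolding bform_def
    by (intro linear_compose_sum ballI)
       (auto simp: linear_iff linear_add[OF tau_linear] linear_cmul[OF tau_linear] algebra_simps)
  have "convex_cone {z. ?psd z}"
    unfolding convex_cone_iff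
  proof (intro conjI ballI allI impI)
    show "0 \<in> {z. ?psd z}" by (simp add: block_psd_def linear_0[OF lin])
  next
    fix x y assume "x \<in> {z. ?psd z}" "y \<in> {z. ?psd z}"
    then show "x + y \<in> {z. ?psd z}"
      by (simp add: block_psd_def linear_add[OF lin] algebra_simps)
         (smt (verit, best))
  next
    fix x and c :: real assume x: "x \<in> {z. ?psd z}" and c: "0 \<le> c"
    have "0 \<le> c * (?b 0 0 u u x + 2 * ?b 0 1 u v x + ?b 1 1 v v x)" for u v
      using x c by (simp add: block_psd_def)
    then show "c *\<^sub>R x \<in> {z. ?psd z}"
      by (simp add: block_psd_def linear_cmul[OF lin] algebra_simps)
  qed
  moreover have "t (sV v v) (sW w w) \<in> {z. ?psd z}" for v w
  proof -
    have b: "?b i j u u' (t (sV v v) (sW w w))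
        = xi i v * xi j v * (dot {..<N} (\<lambda>k. eta k w) u * dot {..<N} (\<lambda>k. eta k w) u')" for i j u u'
      using bform_lincomb_mat[of "{..<N}" "xi i v * xi j v" "\<lambda>k l. eta k w * eta l w" 0 "\<lambda>_ _. 0" u u']
      by (simp add: tau_generator bform_rank_one)
    have "0 \<le> (xi 0 v * dot {..<N} (\<lambda>k. eta k w) u + xi 1 v * dot {..<N} (\<lambda>k. eta k w) u')\<^sup>2" for u u'
      by simp
    then show ?thesis unfolding mem_Collect_eq block_psd_def b
      by (simp add: power2_eq_square algebra_simps)
  qed
  ultimately have "separable_cone \<subseteq> {z. ?psd z}" by (rule tensor_cone_subset)
  then show "z \<in> separable_cone \<Longrightarrow> ?psd z" by blast
next
  assume psd: "?psd z"
  have sym: "symmetric_on {..<N} (\<lambda>k l. tau i j k l z)" for i j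
    unfolding symmetric_on_def using tau_commute(2) by blast
  obtain r :: nat and c d w where dec: "\<forall>k\<in>{..<N}. \<forall>l\<in>{..<N}.
      tau 0 0 k l z = (\<Sum>p<r. (c p)\<^sup>2 * (w p k * w p l)) \<and>
      tau 0 1 k l z = (\<Sum>p<r. c p * d p * (w p k * w p l)) \<and>
      tau 1 1 k l z = (\<Sum>p<r. (d p)\<^sup>2 * (w p k * w p l))"
    using block_psd_entries[OF finite_lessThan sym sym sym psd] by blast
  define x :: "nat \<Rightarrow> nat \<Rightarrow> real" where "x = (\<lambda>p i. if i = 0 then c p else d p :: real)"
  define y where "y = (\<Sum>p<r. t (sV (V.vec (x p)) (V.vec (x p))) (sW (W.vec (w p)) (W.vec (w p))))"
  have entry: "tau i j k l z = (\<Sum>p<r. x p i * x p j * (w p k * w p l))"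
    if "i < M" "j < M" "k < N" "l < N" for i j k l
  proof -
    have "(i = 0 \<or> i = 1) \<and> (j = 0 \<or> j = 1)" using that M by auto
    then show ?thesis
      using dec that tau_commute(1)[of 1 0 k l z] by (auto simp: x_def power2_eq_square mult_ac)
  qed
  have "z = (\<Sum>i<M. \<Sum>j<M. \<Sum>k<N. \<Sum>l<N. tau i j k l z *\<^sub>R t (sV (e i) (e j)) (sW (f k) (f l)))"
    by (rule expand_tensor)
  also have "\<dots> = (\<Sum>i<M. \<Sum>j<M. \<Sum>k<N. \<Sum>l<N. \<Sum>p<r. (x p i * x p j * (w p k * w p l)) *\<^sub>R t (sV (e i) (e j)) (sW (f k) (f l)))"
    by (intro sum.cong refl) (simp add: entry scaleR_sum_left)
  also have "\<dots> = (\<Sum>p<r. \<Sum>i<M. \<Sum>j<M. \<Sum>k<N. \<Sum>l<N. (x p i * x p j * (w p k * w p l)) *\<^sub>R t (sV (e i) (e j)) (sW (f k) (f l)))"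
    by (simp only: sum.swap[of _ _ "{..<r}"])
  also have "\<dots> = y" unfolding y_def generator_vec ..
  finally have "z = y" .
  moreover have "y \<in> separable_cone"
    unfolding y_def by (rule convex_cone_sum[OF convex_cone_tensor_cone generator_in_tensor_cone])
  ultimately show "z \<in> separable_cone" by simp
qed

end

text \<open>
  By polarisation every product is a combination of products of squares.
\<close>

lemma (in tensor_coords) span_separable_cone: "span separable_cone = UNIV"
proof -
  have l: "linear (\<lambda>x. t x y)" and r: "linear (\<lambda>y. t x y)" for x y
    using t_bil by (auto simp: bilinear_def)
  have polV: "2 *\<^sub>R sV v v' = sV (v + v') (v + v') - sV v v - sV v' v'" for v v'
    using V.bil V.comm[of v v'] by (simp add: bilinear_ladd bilinear_radd scaleR_2)
  have polW: "2 *\<^sub>R sW v v' = sW (v + v') (v + v') - sW v v - sW v' v'" for v v'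
    using W.bil W.comm[of v v'] by (simp add: bilinear_ladd bilinear_radd scaleR_2)
  have gen: "t (sV v v) (sW w w) \<in> span separable_cone" for v w
    by (intro span_base generator_in_tensor_cone)
  have half: "x \<in> span separable_cone" if "2 *\<^sub>R x \<in> span separable_cone" for x
    using span_scale[OF that, of "1/2"] by simp
  have "t (sV v v') (sW w w) \<in> span separable_cone" for v v' w
    by (rule half) (simp add: linear_cmul[OF l, symmetric] polV linear_diff[OF l] gen span_diff)
  then have *: "t (sV v v') (sW w w') \<in> span separable_cone" for v v' w w'
    by (intro half[of "t (sV v v') (sW w w')"]) (simp add: linear_cmul[OF r, symmetric] polW linear_diff[OF r] span_diff)
  have "z \<in> span separable_cone" for z
    by (subst expand_tensor[of z]) (intro span_sum span_scale *)
  then show ?thesis by blast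
qed

text \<open>
  The coordinates form an injective linear map into symmetric matrices of size \<open>2 N\<close>, and
  \<open>separable_iff_block_psd\<close> says that the cone is the preimage of the positive semidefinite ones.
\<close>

theorem spectrahedral_separable_cone:
  fixes sV :: "'v::real_vector \<Rightarrow> 'v \<Rightarrow> 'a::real_vector"
    and sW :: "'w::real_vector \<Rightarrow> 'w \<Rightarrow> 'b::real_vector"
    and t :: "'a \<Rightarrow> 'b \<Rightarrow> 'c::real_normed_vector"
  assumes "tensor_coords sV 2 e xi mu sW N f eta nu t tau"
  shows "spectrahedral_cone (tensor_cone t (psd_cone sV) (psd_cone sW))"
proof -
  interpret tensor_coords sV 2 e xi mu sW N f eta nu t tau by fact
  let ?P = "\<lambda>z k l. tau 0 0 k l z" and ?Q = "\<lambda>z k l. tau 0 1 k l z" and ?R = "\<lambda>z k l. tau 1 1 k l z"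
  define psi where "psi = (\<lambda>z. block_mat N (?P z) (?Q z) (?R z))"
  have sym: "symmetric_on {..<N} (\<lambda>k l. tau i j k l z)" for i j z
    unfolding symmetric_on_def using tau_commute(2) by blast
  have iff: "z \<in> separable_cone \<longleftrightarrow> psd_mat (2 * N) (psi z)" for z
    unfolding psi_def using psd_mat_block[OF sym sym] separable_iff_block_psd[OF refl] by blast
  have lin: "linear (\<lambda>z. psi z i j)" for i j
    unfolding psi_def by (intro linear_block_mat tau_linear)
  have inj: "z = z'" if eq: "\<forall>i<2*N. \<forall>j<2*N. psi z i j = psi z' i j" for z z'
  proof (rule tau_inject)
    fix i j k l assume ij: "i < (2::nat)" "j < (2::nat)" "k < N" "l < N"
    have "tau 0 0 k l z = tau 0 0 k l z'" using eq[rule_format, of k l] ij by (simp add: psi_def block_mat_def)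
    moreover have "tau 0 1 k l z = tau 0 1 k l z'"
      using eq[rule_format, of k "N + l"] ij by (simp add: psi_def block_mat_def)
    moreover have "tau 1 1 k l z = tau 1 1 k l z'"
      using eq[rule_format, of "N + k" "N + l"] ij by (simp add: psi_def block_mat_def)
    moreover have "(i = 0 \<or> i = 1) \<and> (j = 0 \<or> j = 1)" using ij by auto
    ultimately show "tau i j k l z = tau i j k l z'"
      using tau_commute(1)[of 1 0 k l z] tau_commute(1)[of 1 0 k l z'] by auto
  qed
  obtain B :: "'c set" where B: "finite B" "independent B" "span B = UNIV" by (rule finite_basis_tensor)
  have b: "linear (\<lambda>z. bform {..<2*N} (psi z) u u)" for u
    unfolding bform_def
    by (intro linear_compose_sum ballI)
       (auto simp: linear_iff linear_add[OF lin] linear_cmul[OF lin] algebra_simps)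
  have symp: "symmetric_on {..<2*N} (psi z)" for z
    using sym_mat_block[OF sym sym] by (simp add: psi_def sym_mat_def symmetric_on_def)
  have iff2: "z \<in> separable_cone \<longleftrightarrow> (\<forall>u. 0 \<le> bform {..<2*N} (psi z) u u)" for z
    unfolding iff psd_mat_iff using symp by simp
  have "separable_cone = (\<Inter>u. {z. 0 \<le> bform {..<2*N} (psi z) u u})"
    using iff2 by auto
  moreover have "closed {z. 0 \<le> bform {..<2*N} (psi z) u u}" for u
    using bounded_linear_finite_dim[OF B b]
    by (intro closed_Collect_le continuous_intros) (simp add: linear_continuous_on)
  ultimately have closed: "closed separable_cone" by auto
  have pointed: "z = 0" if "z \<in> separable_cone" "- z \<in> separable_cone" for z
  proof (rule inj, intro allI impI)
    fix i j assume ij: "i < 2 * N" "j < 2 * N"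
    have z: "bform {..<2*N} (psi z) u u = 0" for u
      using that iff2 linear_neg[OF b] by (metis dual_order.antisym neg_0_le_iff_le)
    have "bform {..<2*N} (psi z) u v = 0" for u v
      by (rule psd_kernel[OF symp]) (simp_all add: z)
    then show "psi z i j = psi 0 i j"
      using bform_unit[of "{..<2*N}" i j "psi z"] ij linear_0[OF lin] by simp
  qed
  show ?thesis
    unfolding spectrahedral_cone_def
  proof (intro conjI)
    show "\<exists>k psi. (\<forall>i<k. \<forall>j<k. linear (\<lambda>x. psi x i j)) \<and> (\<forall>x. sym_mat k (psi x)) \<and>
        (\<forall>x y. (\<forall>i<k. \<forall>j<k. psi x i j = psi y i j) \<longrightarrow> x = y) \<and>
        separable_cone = {x. sos_mat k (psi x)}"
      by (intro exI[of _ "2 * N"] exI[of _ psi])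
         (use lin inj iff symp in \<open>auto simp: sos_mat_iff_psd_mat sym_mat_def symmetric_on_def\<close>)
  qed (use convex_cone_tensor_cone closed pointed span_separable_cone in auto)
qed

section \<open>Lifted representations of positive maps and of the symmetric square\<close>

text \<open>
  A representation \<open>\<Sum> (x\<^sub>0 (a \<cdot> u) + x\<^sub>1 (b \<cdot> u))\<^sup>2\<close> has Gram matrix
  \<open>\<Sum> [a a\<^sup>T, a b\<^sup>T; b a\<^sup>T, b b\<^sup>T]\<close>, whose off-diagonal block differs from \<open>B\<close> by the skew matrix
  \<open>\<Sum> (a b\<^sup>T - b a\<^sup>T) / 2\<close>. Conversely, a skew matrix does not change the form on vectors \<open>x \<otimes> u\<close>.
\<close>

lemma pencil_psd_iff_lift:
  fixes A B C :: "nat \<Rightarrow> nat \<Rightarrow> real"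
  assumes sym: "symmetric_on {..<n} A" "symmetric_on {..<n} B" "symmetric_on {..<n} C"
  shows "pencil_psd {..<n} A B C \<longleftrightarrow>
    (\<exists>y. block_psd {..<n} A (\<lambda>k l. B k l + (y (k, l) - y (l, k))) C)"
proof
  assume "pencil_psd {..<n} A B C"
  then obtain L where L: "\<forall>u. bform {..<n} A u u = (\<Sum>(a, b)\<leftarrow>L. (dot {..<n} a u)\<^sup>2) \<and>
      bform {..<n} B u u = (\<Sum>(a, b)\<leftarrow>L. dot {..<n} a u * dot {..<n} b u) \<and>
      bform {..<n} C u u = (\<Sum>(a, b)\<leftarrow>L. (dot {..<n} b u)\<^sup>2)"
    using pencil_sos[OF finite_lessThan sym] by blast
  define r where "r = length L"
  define a where "a = (\<lambda>p. fst (L ! p))"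
  define b where "b = (\<lambda>p. snd (L ! p))"
  have dA: "bform {..<n} A u u = (\<Sum>p<r. (dot {..<n} (a p) u)\<^sup>2)"
    and dB: "bform {..<n} B u u = (\<Sum>p<r. dot {..<n} (a p) u * dot {..<n} (b p) u)"
    and dC: "bform {..<n} C u u = (\<Sum>p<r. (dot {..<n} (b p) u)\<^sup>2)" for u
    using L by (simp_all add: sum_list_index case_prod_unfold r_def a_def b_def)
  define y where "y = (\<lambda>(k, l). \<Sum>p<r. (a p k / 2) * b p l)"
  have pol: "2 * bform {..<n} B u v = (\<Sum>p<r. dot {..<n} (a p) u * dot {..<n} (b p) v)
       + (\<Sum>p<r. dot {..<n} (a p) v * dot {..<n} (b p) u)" for u v
  proof -
    have "2 * bform {..<n} B u v = bform {..<n} B (\<lambda>i. u i + 1 * v i) (\<lambda>i. u i + 1 * v i)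
        - bform {..<n} B u u - bform {..<n} B v v"
      using bform_shift[OF sym(2), of u 1 v] by simp
    then show ?thesis
      unfolding dB dot_shift by (simp add: sum.distrib[symmetric] sum_subtractf[symmetric] algebra_simps)
  qed
  have K: "bform {..<n} (\<lambda>k l. y (k, l) - y (l, k)) u v
      = (\<Sum>p<r. dot {..<n} (a p) u * dot {..<n} (b p) v) / 2 - (\<Sum>p<r. dot {..<n} (b p) u * dot {..<n} (a p) v) / 2"
    for u v
  proof -
    have h: "dot {..<n} (\<lambda>k. a p k / 2) u = dot {..<n} (a p) u / 2" for p u
      by (simp add: dot_def sum_divide_distrib)
    have 1: "bform {..<n} (\<lambda>k l. y (k, l)) u v = (\<Sum>p<r. dot {..<n} (\<lambda>k. a p k / 2) u * dot {..<n} (b p) v)"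
      by (rule bform_sum_rank_one) (simp add: y_def)
    have 2: "bform {..<n} (\<lambda>k l. y (l, k)) u v = (\<Sum>p<r. dot {..<n} (b p) u * dot {..<n} (\<lambda>k. a p k / 2) v)"
      by (rule bform_sum_rank_one) (simp add: y_def mult.commute)
    show ?thesis
      using bform_lincomb_mat[of "{..<n}" 1 "\<lambda>k l. y (k, l)" "-1" "\<lambda>k l. y (l, k)" u v]
      by (simp add: 1 2 h sum_divide_distrib)
  qed
  have "block_psd {..<n} A (\<lambda>k l. B k l + (y (k, l) - y (l, k))) C"
    unfolding block_psd_def
  proof (intro allI)
    fix u v
    have "2 * bform {..<n} (\<lambda>k l. B k l + (y (k, l) - y (l, k))) u v
        = 2 * (\<Sum>p<r. dot {..<n} (a p) u * dot {..<n} (b p) v)"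
      using bform_lincomb_mat[of "{..<n}" 1 B 1 "\<lambda>k l. y (k, l) - y (l, k)" u v] pol[of u v]
      by (simp add: K mult.commute)
    then have "bform {..<n} A u u + 2 * bform {..<n} (\<lambda>k l. B k l + (y (k, l) - y (l, k))) u v + bform {..<n} C v v
        = (\<Sum>p<r. (dot {..<n} (a p) u + dot {..<n} (b p) v)\<^sup>2)"
      unfolding dA dC by (simp add: power2_sum sum.distrib sum_distrib_left algebra_simps)
    then show "0 \<le> bform {..<n} A u u + 2 * bform {..<n} (\<lambda>k l. B k l + (y (k, l) - y (l, k))) u v + bform {..<n} C v v"
      by (simp add: sum_nonneg)
  qed
  then show "\<exists>y. block_psd {..<n} A (\<lambda>k l. B k l + (y (k, l) - y (l, k))) C" by blast
next
  assume "\<exists>y. block_psd {..<n} A (\<lambda>k l. B k l + (y (k, l) - y (l, k))) C"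
  then obtain y where y: "block_psd {..<n} A (\<lambda>k l. B k l + (y (k, l) - y (l, k))) C" by blast
  show "pencil_psd {..<n} A B C"
    unfolding pencil_psd_def
  proof (intro allI)
    fix x0 x1 and u :: "nat \<Rightarrow> real"
    have "bform {..<n} (\<lambda>k l. y (k, l)) u u = bform {..<n} (\<lambda>k l. y (l, k)) u u"
      unfolding bform_def by (subst sum.swap) (simp add: mult_ac)
    then have K: "bform {..<n} (\<lambda>k l. y (k, l) - y (l, k)) u u = 0"
      using bform_lincomb_mat[of "{..<n}" 1 "\<lambda>k l. y (k, l)" "-1" "\<lambda>k l. y (l, k)" u u] by simp
    have s: "bform {..<n} X (\<lambda>i. c * u i) (\<lambda>i. d * u i) = c * d * bform {..<n} X u u" for X c d
      using bform_comb_left[of "{..<n}" X c u 0 u] bform_comb_right[of "{..<n}" X u d u 0 u] by simp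
    show "0 \<le> x0\<^sup>2 * bform {..<n} A u u + 2 * x0 * x1 * bform {..<n} B u u + x1\<^sup>2 * bform {..<n} C u u"
      using y[unfolded block_psd_def, rule_format, of "\<lambda>i. x0 * u i" "\<lambda>i. x1 * u i"] K
        bform_lincomb_mat[of "{..<n}" 1 B 1 "\<lambda>k l. y (k, l) - y (l, k)" u u]
      unfolding s by (simp add: power2_eq_square mult_ac)
  qed
qed

lemma SDR_set_pencil:
  fixes A B C :: "'e::real_vector \<Rightarrow> nat \<Rightarrow> nat \<Rightarrow> real" and Bas :: "'e set"
  assumes Bas: "finite Bas" "independent Bas" "span Bas = UNIV"
    and lin: "\<And>i j. linear (\<lambda>x. A x i j)" "\<And>i j. linear (\<lambda>x. B x i j)" "\<And>i j. linear (\<lambda>x. C x i j)"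
    and sym: "\<And>x. symmetric_on {..<n} (A x)" "\<And>x. symmetric_on {..<n} (B x)" "\<And>x. symmetric_on {..<n} (C x)"
    and S: "\<And>x. x \<in> S \<longleftrightarrow> pencil_psd {..<n} (A x) (B x) (C x)"
  shows "SDR_set S"
proof (rule SDR_setI[OF Bas])
  let ?J = "{..<n} \<times> {..<n}"
  let ?Z = "\<lambda>_ _. 0 :: real"
  let ?E = "\<lambda>q k l. of_bool (q = (k, l)) - of_bool (q = (l, k)) :: real"
  show "linear (\<lambda>x. block_mat n (A x) (B x) (C x) i j)" for i j by (intro linear_block_mat lin)
  show "sym_mat (2 * n) (block_mat n (A x) (B x) (C x))" for x by (intro sym_mat_block sym)
  show "finite ?J" by simp
  show "sym_mat (2 * n) (block_mat n ?Z (?E q) ?Z)" for q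
    by (intro sym_mat_block) (simp_all add: symmetric_on_def)
  fix x
  have E: "(\<Sum>q\<in>?J. y q * ?E q k l) = y (k, l) - y (l, k)" if "k < n" "l < n" for y k l
  proof -
    have "?J \<inter> {q. q = (k, l)} = {(k, l)}" "?J \<inter> {q. q = (l, k)} = {(l, k)}" using that by auto
    then show ?thesis by (simp add: right_diff_distrib sum_subtractf)
  qed
  have "psd_mat (2 * n) (\<lambda>i j. block_mat n (A x) (B x) (C x) i j + (\<Sum>q\<in>?J. y q * block_mat n ?Z (?E q) ?Z i j))
      \<longleftrightarrow> block_psd {..<n} (A x) (\<lambda>k l. B x k l + (y (k, l) - y (l, k))) (C x)" for y
  proof -
    have "bform {..<n} (\<lambda>k l. B x k l + (\<Sum>q\<in>?J. y q * ?E q k l)) u v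
        = bform {..<n} (\<lambda>k l. B x k l + (y (k, l) - y (l, k))) u v" for u v
      unfolding bform_def by (intro sum.cong refl) (simp add: E)
    then have "block_psd {..<n} (A x) (\<lambda>k l. B x k l + (\<Sum>q\<in>?J. y q * ?E q k l)) (C x)
       \<longleftrightarrow> block_psd {..<n} (A x) (\<lambda>k l. B x k l + (y (k, l) - y (l, k))) (C x)"
      by (simp add: block_psd_def)
    then show ?thesis
      unfolding block_mat_sum block_mat_add
      using psd_mat_block[OF sym(1,3)] by simp
  qed
  then show "x \<in> S \<longleftrightarrow> (\<exists>y. psd_mat (2 * n) (\<lambda>i j. block_mat n (A x) (B x) (C x) i j
      + (\<Sum>q\<in>?J. y q * block_mat n ?Z (?E q) ?Z i j)))"
    using S pencil_psd_iff_lift[OF sym] by simp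
qed

lemma sum_lessThan_2: "(\<Sum>i<2. f i) = f 0 + f (1::nat)"
  by (simp add: numeral_2_eq_2)

lemma finite_basis_blinfun:
  fixes sV :: "'v::real_vector \<Rightarrow> 'v \<Rightarrow> 'a::real_normed_vector"
    and sW :: "'w::real_vector \<Rightarrow> 'w \<Rightarrow> 'b::real_normed_vector"
  assumes "sym_square_coords sV M e xi mu" "sym_square_coords sW N f eta nu"
  obtains B :: "('a \<Rightarrow>\<^sub>L 'b) set" where "finite B" "independent B" "span B = UNIV"
proof -
  interpret V: sym_square_coords sV M e xi mu by fact
  interpret W: sym_square_coords sW N f eta nu by fact
  obtain BV :: "'a set" where BV: "finite BV" "independent BV" "span BV = UNIV"
    by (rule finite_basis_sym_square[OF assms(1)])
  have bl: "bounded_linear (mu i j)" for i j by (rule bounded_linear_finite_dim[OF BV V.mu_linear])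
  define E where "E = (\<lambda>i j k l. Blinfun (\<lambda>a. mu i j a *\<^sub>R sW (f k) (f l)))"
  have E: "blinfun_apply (E i j k l) a = mu i j a *\<^sub>R sW (f k) (f l)" for i j k l a
    unfolding E_def
    by (subst bounded_linear_Blinfun_apply) (auto intro: bounded_linear_scaleR_left bounded_linear_compose[OF bounded_linear_scaleR_left bl])
  let ?J = "{..<M} \<times> {..<M} \<times> {..<N} \<times> {..<N}"
  have h: "h = (\<Sum>i<M. \<Sum>j<M. \<Sum>k<N. \<Sum>l<N. nu k l (blinfun_apply h (sV (e i) (e j))) *\<^sub>R E i j k l)" for h :: "'a \<Rightarrow>\<^sub>L 'b"
  proof (rule blinfun_eqI)
    fix a
    have "blinfun_apply h a = blinfun_apply h (\<Sum>i<M. \<Sum>j<M. mu i j a *\<^sub>R sV (e i) (e j))"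
      by (rule arg_cong[OF V.expand_square])
    also have "\<dots> = (\<Sum>i<M. \<Sum>j<M. mu i j a *\<^sub>R blinfun_apply h (sV (e i) (e j)))"
      by (simp add: blinfun.sum_right blinfun.scaleR_right)
    also have "\<dots> = (\<Sum>i<M. \<Sum>j<M. mu i j a *\<^sub>R (\<Sum>k<N. \<Sum>l<N. nu k l (blinfun_apply h (sV (e i) (e j))) *\<^sub>R sW (f k) (f l)))"
      by (rule sum.cong[OF refl], rule sum.cong[OF refl], rule arg_cong[OF W.expand_square])
    also have "\<dots> = blinfun_apply (\<Sum>i<M. \<Sum>j<M. \<Sum>k<N. \<Sum>l<N. nu k l (blinfun_apply h (sV (e i) (e j))) *\<^sub>R E i j k l) a"
      by (simp add: blinfun.sum_left blinfun.scaleR_left E scaleR_sum_right mult.commute)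
    finally show "blinfun_apply h a = \<dots>" .
  qed
  show ?thesis
  proof (rule finite_basis_of_expansion)
    show "finite ?J" by simp
    show "h = (\<Sum>p\<in>?J. nu (fst (snd (snd p))) (snd (snd (snd p))) (blinfun_apply h (sV (e (fst p)) (e (fst (snd p))))) *\<^sub>R
        E (fst p) (fst (snd p)) (fst (snd (snd p))) (snd (snd (snd p))))" for h
      using h[of h] unfolding sum.cartesian_product by (simp only: case_prod_unfold fst_conv snd_conv)
  qed (rule that)
qed

text \<open>
  A map \<open>h\<close> sends squares to sums of squares iff the biquadratic form \<open>\<langle>h(x\<^sup>2), d\<^sup>2\<rangle>\<close> is nonnegative. If one
  of the two groups of variables has size 2, it plays the role of the pencil parameter.
\<close>

theorem SDR_set_hom_cone:
  fixes sV :: "'v::real_vector \<Rightarrow> 'v \<Rightarrow> 'a::real_normed_vector"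
    and sW :: "'w::real_vector \<Rightarrow> 'w \<Rightarrow> 'b::real_normed_vector"
  assumes V: "sym_square_coords sV M e xi mu" and W: "sym_square_coords sW N f eta nu"
    and two: "M = 2 \<or> N = 2"
  shows "SDR_set (hom_cone (psd_cone sV) (psd_cone sW))"
proof -
  interpret V: sym_square_coords sV M e xi mu by fact
  interpret W: sym_square_coords sW N f eta nu by fact
  obtain Bas :: "('a \<Rightarrow>\<^sub>L 'b) set" where Bas: "finite Bas" "independent Bas" "span Bas = UNIV"
    by (rule finite_basis_blinfun[OF V W])
  define g where "g = (\<lambda>i j k l (h :: 'a \<Rightarrow>\<^sub>L 'b). nu k l (blinfun_apply h (sV (e i) (e j))))"
  have g_lin: "linear (g i j k l)" for i j k l
    by (simp add: g_def linear_iff blinfun.add_left blinfun.scaleR_left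
        linear_add[OF W.mu_linear] linear_cmul[OF W.mu_linear])
  have g_sym: "g i j k l h = g j i k l h" "g i j k l h = g i j l k h" for i j k l h
    using V.comm[of "e i" "e j"] W.mu_commute[of k l] by (simp_all add: g_def)
  have nu_h: "nu k l (blinfun_apply h (sV (V.vec c) (V.vec c))) = bform {..<M} (\<lambda>i j. g i j k l h) c c" for k l c and h :: "'a \<Rightarrow>\<^sub>L 'b"
    unfolding V.s_vec bform_def g_def
    by (simp add: blinfun.sum_right blinfun.scaleR_right linear_sum[OF W.mu_linear]
        linear_cmul[OF W.mu_linear] mult_ac)
  have hom: "h \<in> hom_cone (psd_cone sV) (psd_cone sW) \<longleftrightarrow>
      (\<forall>c d. 0 \<le> bform {..<N} (\<lambda>k l. bform {..<M} (\<lambda>i j. g i j k l h) c c) d d)" for h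
  proof
    assume "h \<in> hom_cone (psd_cone sV) (psd_cone sW)"
    then have "blinfun_apply h (sV (V.vec c) (V.vec c)) \<in> psd_cone sW" for c
      using V.square_in_psd_cone[of "V.vec c"] by (auto simp: hom_cone_def)
    then show "\<forall>c d. 0 \<le> bform {..<N} (\<lambda>k l. bform {..<M} (\<lambda>i j. g i j k l h) c c) d d"
      unfolding W.psd_cone_iff nu_h by blast
  next
    assume nn: "\<forall>c d. 0 \<le> bform {..<N} (\<lambda>k l. bform {..<M} (\<lambda>i j. g i j k l h) c c) d d"
    have sq: "blinfun_apply h (sV v v) \<in> psd_cone sW" for v
    proof -
      have "blinfun_apply h (sV (V.vec c) (V.vec c)) \<in> psd_cone sW" for c
        using nn unfolding W.psd_cone_iff nu_h by blast
      from this[of "\<lambda>i. xi i v"] show ?thesis unfolding V.vec_xi .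
    qed
    show "h \<in> hom_cone (psd_cone sV) (psd_cone sW)"
      unfolding hom_cone_def
    proof (intro CollectI subsetI)
      fix b assume "b \<in> blinfun_apply h ` psd_cone sV"
      then obtain k v where "b = blinfun_apply h (\<Sum>p<(k::nat). sV (v p) (v p))" unfolding psd_cone_def by blast
      then show "b \<in> psd_cone sW" 
        using convex_cone_sum[OF W.convex_cone_psd_cone sq] by (simp add: blinfun.sum_right)
    qed
  qed
  show ?thesis
    using two
  proof
    assume M: "M = 2"
    show ?thesis
    proof (rule SDR_set_pencil[OF Bas, where n = N])
      fix h :: "'a \<Rightarrow>\<^sub>L 'b"
      have e: "bform {..<N} (\<lambda>k l. bform {..<M} (\<lambda>i j. g i j k l h) c c) d d
          = (c 0)\<^sup>2 * bform {..<N} (\<lambda>k l. g 0 0 k l h) d d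
            + 2 * c 0 * c 1 * bform {..<N} (\<lambda>k l. g 0 1 k l h) d d
            + (c 1)\<^sup>2 * bform {..<N} (\<lambda>k l. g 1 1 k l h) d d" for c d
      proof -
        have "bform {..<M} (\<lambda>i j. g i j k l h) c c
            = (c 0)\<^sup>2 * g 0 0 k l h + 2 * c 0 * c 1 * g 0 1 k l h + (c 1)\<^sup>2 * g 1 1 k l h" for k l
          using g_sym(1)[of 1 0 k l h] unfolding M
          by (simp add: bform_def sum_lessThan_2 power2_eq_square algebra_simps)
        then show ?thesis
          using bform_lincomb_mat[of "{..<N}" 1 "\<lambda>k l. (c 0)\<^sup>2 * g 0 0 k l h + 2 * c 0 * c 1 * g 0 1 k l h"
              "(c 1)\<^sup>2" "\<lambda>k l. g 1 1 k l h" d d]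
            bform_lincomb_mat[of "{..<N}" "(c 0)\<^sup>2" "\<lambda>k l. g 0 0 k l h" "2 * c 0 * c 1" "\<lambda>k l. g 0 1 k l h" d d]
          by simp
      qed
      show "h \<in> hom_cone (psd_cone sV) (psd_cone sW) \<longleftrightarrow>
          pencil_psd {..<N} (\<lambda>k l. g 0 0 k l h) (\<lambda>k l. g 0 1 k l h) (\<lambda>k l. g 1 1 k l h)"
        unfolding hom e pencil_psd_def
      proof (intro iffI allI)
        fix x0 x1 d
        assume a: "\<forall>c d. 0 \<le> (c (0::nat))\<^sup>2 * bform {..<N} (\<lambda>k l. g 0 0 k l h) d d
            + 2 * c 0 * c 1 * bform {..<N} (\<lambda>k l. g 0 1 k l h) d d
            + (c 1)\<^sup>2 * bform {..<N} (\<lambda>k l. g 1 1 k l h) d d"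
        show "0 \<le> x0\<^sup>2 * bform {..<N} (\<lambda>k l. g 0 0 k l h) d d
            + 2 * x0 * x1 * bform {..<N} (\<lambda>k l. g 0 1 k l h) d d
            + x1\<^sup>2 * bform {..<N} (\<lambda>k l. g 1 1 k l h) d d"
          using a[rule_format, of "\<lambda>i. if i = 0 then x0 else x1" d] by simp
      qed blast
    qed (use g_lin g_sym in \<open>auto simp: symmetric_on_def\<close>)
  next
    assume N: "N = 2"
    show ?thesis
    proof (rule SDR_set_pencil[OF Bas, where n = M])
      fix h :: "'a \<Rightarrow>\<^sub>L 'b"
      have e: "bform {..<N} (\<lambda>k l. bform {..<M} (\<lambda>i j. g i j k l h) c c) d d
          = (d 0)\<^sup>2 * bform {..<M} (\<lambda>i j. g i j 0 0 h) c c
            + 2 * d 0 * d 1 * bform {..<M} (\<lambda>i j. g i j 0 1 h) c c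
            + (d 1)\<^sup>2 * bform {..<M} (\<lambda>i j. g i j 1 1 h) c c" for c d
      proof -
        have "(\<lambda>i j. g i j 1 0 h) = (\<lambda>i j. g i j 0 1 h)" using g_sym(2) by blast
        then show ?thesis unfolding N
          by (simp add: bform_def[of "{..<2}"] sum_lessThan_2 power2_eq_square algebra_simps)
      qed
      show "h \<in> hom_cone (psd_cone sV) (psd_cone sW) \<longleftrightarrow>
          pencil_psd {..<M} (\<lambda>i j. g i j 0 0 h) (\<lambda>i j. g i j 0 1 h) (\<lambda>i j. g i j 1 1 h)"
        unfolding hom e pencil_psd_def
      proof (intro iffI allI)
        fix x0 x1 c
        assume a: "\<forall>c d. 0 \<le> (d (0::nat))\<^sup>2 * bform {..<M} (\<lambda>i j. g i j 0 0 h) c c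
            + 2 * d 0 * d 1 * bform {..<M} (\<lambda>i j. g i j 0 1 h) c c
            + (d 1)\<^sup>2 * bform {..<M} (\<lambda>i j. g i j 1 1 h) c c"
        show "0 \<le> x0\<^sup>2 * bform {..<M} (\<lambda>i j. g i j 0 0 h) c c
            + 2 * x0 * x1 * bform {..<M} (\<lambda>i j. g i j 0 1 h) c c
            + x1\<^sup>2 * bform {..<M} (\<lambda>i j. g i j 1 1 h) c c"
          using a[rule_format, of "\<lambda>i. if i = 0 then x0 else x1" c] by simp
      qed blast
    qed (use g_lin g_sym in \<open>auto simp: symmetric_on_def\<close>)
  qed
qed

text \<open>
  The cone is the image of \<open>S\<^sub>+(V) \<otimes> S\<^sub>+(V)\<close> under the symmetrisation
  \<open>Sym\<^sup>2 V \<otimes> Sym\<^sup>2 V \<rightarrow> Sym\<^sup>2(Sym\<^sup>2 V)\<close>. The tensors over a given element form an affine space: its symmetric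
  lift plus the skew tensors, of which there are three independent ones when \<open>Sym\<^sup>2 V\<close> has dimension 3.
\<close>

theorem SDR_set_sym2_cone:
  fixes s :: "'v::real_vector \<Rightarrow> 'v \<Rightarrow> 'a::real_vector" and s2 :: "'a \<Rightarrow> 'a \<Rightarrow> 'd::real_vector"
  assumes V: "sym_square_coords s 2 e xi mu" and s2: "is_symmetric_square s2"
  shows "SDR_set (sym2_cone s2 (psd_cone s))"
proof -
  interpret V: sym_square_coords s 2 e xi mu by fact
  have bil: "bilinear s2" and comm: "s2 a b = s2 b a" for a b
    using s2 by (auto simp: is_symmetric_square_def)
  have l: "linear (\<lambda>a. s2 a b)" and r: "linear (\<lambda>b. s2 a b)" for a b
    using bil by (auto simp: bilinear_def)
  have univ: "\<And>b :: 'a \<Rightarrow> 'a \<Rightarrow> real. bilinear b \<Longrightarrow> (\<And>x y. b x y = b y x) \<Longrightarrow>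
      \<exists>!h. linear h \<and> (\<forall>x y. h (s2 x y) = b x y)"
    using s2 unfolding is_symmetric_square_def by blast
  have "\<exists>h. linear h \<and> (\<forall>a b. h (s2 a b) = (mu i j a * mu k l b + mu k l a * mu i j b) / 2)" for i j k l
    using univ[OF bilinear_symmetrized[OF V.mu_linear[of i j] V.mu_linear[of k l]]]
    by (simp add: algebra_simps) blast
  then obtain ka where ka_lin: "\<And>i j k l. linear (ka i j k l)" and
    ka: "\<And>i j k l a b. ka i j k l (s2 a b) = (mu i j a * mu k l b + mu k l a * mu i j b) / 2" by metis
  define S where "S = (\<lambda>c :: nat \<Rightarrow> nat \<Rightarrow> nat \<Rightarrow> nat \<Rightarrow> real.
      \<Sum>i<2. \<Sum>j<2. \<Sum>k<2. \<Sum>l<2. c i j k l *\<^sub>R s2 (s (e i) (e j)) (s (e k) (e l)))"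
  have s2_S: "s2 a b = S (\<lambda>i j k l. mu i j a * mu k l b)" for a b
  proof -
    have "s2 a b = s2 (\<Sum>i<2. \<Sum>j<2. mu i j a *\<^sub>R s (e i) (e j)) (\<Sum>k<2. \<Sum>l<2. mu k l b *\<^sub>R s (e k) (e l))"
      using V.expand_square[of a, symmetric] V.expand_square[of b, symmetric] by simp
    also have "\<dots> = (\<Sum>i<2. \<Sum>j<2. mu i j a *\<^sub>R s2 (s (e i) (e j)) (\<Sum>k<2. \<Sum>l<2. mu k l b *\<^sub>R s (e k) (e l)))"
      by (simp only: linear_sum[OF l] linear_cmul[OF l])
    also have "\<dots> = S (\<lambda>i j k l. mu i j a * mu k l b)"
      unfolding S_def by (simp only: linear_sum[OF r] linear_cmul[OF r] scaleR_sum_right scaleR_scaleR)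
    finally show ?thesis .
  qed
  have S_add: "S (\<lambda>i j k l. c i j k l + c' i j k l) = S c + S c'"
    and S_scale: "S (\<lambda>i j k l. x * c i j k l) = x *\<^sub>R S c" for c c' x
    unfolding S_def by (simp_all add: scaleR_add_left sum.distrib scaleR_sum_right)
  define F where "F = (\<lambda>z. z - S (\<lambda>i j k l. ka i j k l z))"
  have "linear F"
    unfolding F_def S_def
    by (intro linear_compose_sub linear_ident linear_compose_sum ballI)
       (auto simp: linear_iff linear_add[OF ka_lin] linear_cmul[OF ka_lin] algebra_simps)
  moreover have "F (s2 a b) = 0" for a b
  proof -
    have "S (\<lambda>i j k l. ka i j k l (s2 a b))
        = S (\<lambda>i j k l. (1/2) * (mu i j a * mu k l b + mu i j b * mu k l a))"
      by (simp add: ka mult.commute)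
    also have "\<dots> = s2 a b"
      unfolding S_scale S_add s2_S[symmetric] comm[of b a] by (simp add: scaleR_2[symmetric])
    finally show ?thesis by (simp add: F_def)
  qed
  ultimately have "F z = 0" for z by (rule symmetric_square_spanned[OF s2])
  then have expand: "z = S (\<lambda>i j k l. ka i j k l z)" for z by (simp add: F_def)
  obtain Bas :: "'d set" where Bas: "finite Bas" "independent Bas" "span Bas = UNIV"
  proof (rule finite_basis_of_expansion)
    let ?J = "{..<2::nat} \<times> {..<2::nat} \<times> {..<2::nat} \<times> {..<2::nat}"
    show "finite ?J" by simp
    show "z = (\<Sum>p\<in>?J. ka (fst p) (fst (snd p)) (fst (snd (snd p))) (snd (snd (snd p))) z *\<^sub>R
      s2 (s (e (fst p)) (e (fst (snd p)))) (s (e (fst (snd (snd p)))) (e (snd (snd (snd p))))))" for z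
      using expand[of z] unfolding S_def sum.cartesian_product
      by (simp only: case_prod_unfold fst_conv snd_conv)
  qed
  have ka_sym: "ka i j k l z = ka i j l k z" "ka i j k l z = ka j i k l z" "ka i j k l z = ka k l i j z" for i j k l z
  proof -
    have "ka i j k l z - ka i j l k z = 0" "ka i j k l z - ka j i k l z = 0" "ka i j k l z - ka k l i j z = 0"
      by (rule symmetric_square_spanned[OF s2]; 
          simp add: linear_iff linear_add[OF ka_lin] linear_cmul[OF ka_lin] ka
            V.mu_commute[of i j] V.mu_commute[of k l] algebra_simps)+
    then show "ka i j k l z = ka i j l k z" "ka i j k l z = ka j i k l z" "ka i j k l z = ka k l i j z" by simp_all
  qed
  \<comment> \<open>The blocks of the three skew tensors: with \<open>E\<^sub>i\<^sub>j = e\<^sub>i e\<^sub>j\<close>, they pair \<open>E\<^sub>0\<^sub>0\<close> with \<open>E\<^sub>0\<^sub>1\<close>,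
    \<open>E\<^sub>0\<^sub>0\<close> with \<open>E\<^sub>1\<^sub>1\<close>, and \<open>E\<^sub>0\<^sub>1\<close> with \<open>E\<^sub>1\<^sub>1\<close>.\<close>
  define NP :: "nat \<Rightarrow> nat \<Rightarrow> nat \<Rightarrow> real" where "NP = (\<lambda>q k l. if q = 0 then of_bool (k \<noteq> l) else of_bool (q = 1 \<and> k = 1 \<and> l = 1))"
  define NQ :: "nat \<Rightarrow> nat \<Rightarrow> nat \<Rightarrow> real" where "NQ = (\<lambda>q k l. if q = 0 then - of_bool (k = 0 \<and> l = 0) else of_bool (q = 2 \<and> k = 1 \<and> l = 1))"
  define NR :: "nat \<Rightarrow> nat \<Rightarrow> nat \<Rightarrow> real" where "NR = (\<lambda>q k l. if q = 1 then - of_bool (k = 0 \<and> l = 0) else - of_bool (q = 2 \<and> k \<noteq> l))"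
  define P where "P = (\<lambda>z (y :: nat \<Rightarrow> real) k l. ka 0 0 k l z + (\<Sum>q<3. y q * NP q k l))"
  define Q where "Q = (\<lambda>z (y :: nat \<Rightarrow> real) k l. ka 0 1 k l z + (\<Sum>q<3. y q * NQ q k l))"
  define R where "R = (\<lambda>z (y :: nat \<Rightarrow> real) k l. ka 1 1 k l z + (\<Sum>q<3. y q * NR q k l))"
  have N_sym: "symmetric_on {..<2} (NP q)" "symmetric_on {..<2} (NQ q)" "symmetric_on {..<2} (NR q)" for q
    by (auto simp: symmetric_on_def NP_def NQ_def NR_def)
  have sym: "symmetric_on {..<2} (P z y)" "symmetric_on {..<2} (Q z y)" "symmetric_on {..<2} (R z y)" for z y
    using N_sym ka_sym(1) unfolding P_def Q_def R_def symmetric_on_def by (metis (no_types, lifting) sum.cong)+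
  define psd where "psd = (\<lambda>z y. block_psd {..<2} (P z y) (Q z y) (R z y))"
  have sum3: "(\<Sum>q<3. h q) = h 0 + h 1 + h (2::nat)" for h :: "nat \<Rightarrow> real" by (simp add: numeral_3_eq_3 numeral_2_eq_2)
  have cone: "convex_cone {z. \<exists>y. psd z y}"
  proof -
    let ?h = "\<lambda>z y u v. bform {..<2} (P z y) u u + 2 * bform {..<2} (Q z y) u v + bform {..<2} (R z y) v v"
    have add: "?h (z + z') (\<lambda>q. y q + y' q) u v = ?h z y u v + ?h z' y' u v" for z z' y y' u v
      by (simp add: P_def Q_def R_def bform_def sum3 sum_lessThan_2 linear_add[OF ka_lin] algebra_simps)
    have scale: "?h (c *\<^sub>R z) (\<lambda>q. c * y q) u v = c * ?h z y u v" for c z y u v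
      by (simp add: P_def Q_def R_def bform_def sum3 sum_lessThan_2 linear_cmul[OF ka_lin] algebra_simps)
    show ?thesis
      unfolding convex_cone_iff
    proof (intro conjI ballI allI impI)
      have "?h 0 (\<lambda>_. 0) u v = 0" for u v
        by (simp add: P_def Q_def R_def bform_def linear_0[OF ka_lin])
      then have "psd 0 (\<lambda>_. 0)" by (simp add: psd_def block_psd_def)
      then show "0 \<in> {z. \<exists>y. psd z y}" by blast
    next
      fix z z' assume "z \<in> {z. \<exists>y. psd z y}" "z' \<in> {z. \<exists>y. psd z y}"
      then obtain y y' where "psd z y" "psd z' y'" by blast
      then have "psd (z + z') (\<lambda>q. y q + y' q)" unfolding psd_def block_psd_def add by (simp add: add_nonneg_nonneg)
      then show "z + z' \<in> {z. \<exists>y. psd z y}" by blast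
    next
      fix z and c :: real assume "z \<in> {z. \<exists>y. psd z y}" and c: "0 \<le> c"
      then obtain y where "psd z y" by blast
      then have "psd (c *\<^sub>R z) (\<lambda>q. c * y q)" unfolding psd_def block_psd_def scale using c by simp
      then show "c *\<^sub>R z \<in> {z. \<exists>y. psd z y}" by blast
    qed
  qed
  have gen: "s2 (s v v) (s w w) \<in> {z. \<exists>y. psd z y}" for v w
  proof -
    \<comment> \<open>Half the difference between \<open>v\<^sup>2 \<otimes> w\<^sup>2\<close> and \<open>w\<^sup>2 \<otimes> v\<^sup>2\<close>: adding it to the symmetric lift gives
      \<open>v\<^sup>2 \<otimes> w\<^sup>2\<close>, which has rank one.\<close>
    define y where "y = (\<lambda>q::nat. if q = 0 then (xi 0 v * xi 0 v * xi 0 w * xi 1 w - xi 0 w * xi 0 w * xi 0 v * xi 1 v) / 2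
       else if q = 1 then (xi 0 v * xi 0 v * xi 1 w * xi 1 w - xi 0 w * xi 0 w * xi 1 v * xi 1 v) / 2
       else (xi 0 v * xi 1 v * xi 1 w * xi 1 w - xi 0 w * xi 1 w * xi 1 v * xi 1 v) / 2)"
    have "bform {..<2} (P (s2 (s v v) (s w w)) y) a a + 2 * bform {..<2} (Q (s2 (s v v) (s w w)) y) a b
          + bform {..<2} (R (s2 (s v v) (s w w)) y) b b
        = (xi 0 v * (a 0 * xi 0 w + a 1 * xi 1 w) + xi 1 v * (b 0 * xi 0 w + b 1 * xi 1 w))\<^sup>2" for a b
      by (simp add: P_def Q_def R_def NP_def NQ_def NR_def bform_def sum3 sum_lessThan_2 y_def ka V.mu_square
          power2_eq_square field_simps)
    then have "psd (s2 (s v v) (s w w)) y" unfolding psd_def block_psd_def by simp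
    then show ?thesis by blast
  qed
  have sub: "sym2_cone s2 (psd_cone s) \<subseteq> {z. \<exists>y. psd z y}"
    unfolding sym2_cone_def
    by (rule hull_minimal)
       (use bilinear_psd_cones_in_convex_cone[where s = s and s' = s, OF bil cone gen] cone in auto)
  have sup: "z \<in> sym2_cone s2 (psd_cone s)" if psd: "psd z y" for z y
  proof -
    obtain r :: nat and c d w where dec: "\<forall>k\<in>{..<2}. \<forall>l\<in>{..<2}.
        P z y k l = (\<Sum>p<r. (c p)\<^sup>2 * (w p k * w p l)) \<and>
        Q z y k l = (\<Sum>p<r. c p * d p * (w p k * w p l)) \<and>
        R z y k l = (\<Sum>p<r. (d p)\<^sup>2 * (w p k * w p l))"
      using block_psd_entries[OF finite_lessThan sym psd[unfolded psd_def]] by blast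
    define x :: "nat \<Rightarrow> nat \<Rightarrow> real" where "x = (\<lambda>p i. if i = 0 then c p else d p)"
    define T where "T = (\<lambda>i j k l. \<Sum>p<r. x p i * x p j * (w p k * w p l))"
    have gen_S: "s2 (s (V.vec (x p)) (V.vec (x p))) (s (V.vec (w p)) (V.vec (w p)))
        = S (\<lambda>i j k l. x p i * x p j * (w p k * w p l))" for p
    proof -
      have "s2 (s (V.vec (x p)) (V.vec (x p))) (s (V.vec (w p)) (V.vec (w p)))
         = (\<Sum>i<2. \<Sum>j<2. (x p i * x p j) *\<^sub>R s2 (s (e i) (e j)) (s (V.vec (w p)) (V.vec (w p))))"
        unfolding V.s_vec[of "x p"] by (simp only: linear_sum[OF l] linear_cmul[OF l])
      also have "\<dots> = S (\<lambda>i j k l. x p i * x p j * (w p k * w p l))"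
        unfolding V.s_vec S_def by (simp only: linear_sum[OF r] linear_cmul[OF r] scaleR_sum_right scaleR_scaleR)
      finally show ?thesis .
    qed
    have T: "T 0 0 k l = P z y k l" "T 0 1 k l = Q z y k l" "T 1 0 k l = Q z y k l" "T 1 1 k l = R z y k l"
      if "k < 2" "l < 2" for k l
      using dec that by (simp_all add: T_def x_def power2_eq_square mult_ac)
    have "(\<Sum>p<r. s2 (s (V.vec (x p)) (V.vec (x p))) (s (V.vec (w p)) (V.vec (w p)))) = S T"
      unfolding gen_S S_def T_def scaleR_sum_left by (simp only: sum.swap[of _ _ "{..<r}"])
    also have "S T = S (\<lambda>i j k l. ka i j k l z)"
      unfolding S_def sum_lessThan_2
      by (simp add: T P_def Q_def R_def NP_def NQ_def NR_def sum3 comm V.comm[of "e 1" "e 0"]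
           ka_sym(2)[of 1 0] algebra_simps del: One_nat_def)
    also have "\<dots> = z" using expand by simp
    finally have z: "z = (\<Sum>p<r. s2 (s (V.vec (x p)) (V.vec (x p))) (s (V.vec (w p)) (V.vec (w p))))" ..
    have "s2 (s v v) (s w w) \<in> sym2_cone s2 (psd_cone s)" for v w
      unfolding sym2_cone_def using V.square_in_psd_cone by (blast intro: hull_inc)
    then show ?thesis
      unfolding z by (intro convex_cone_sum) (simp add: sym2_cone_def convex_cone_convex_cone_hull)
  qed
  show ?thesis
  proof (rule SDR_setI[OF Bas])
    show "linear (\<lambda>z. block_mat 2 (\<lambda>k l. ka 0 0 k l z) (\<lambda>k l. ka 0 1 k l z) (\<lambda>k l. ka 1 1 k l z) i j)" for i j
      by (intro linear_block_mat ka_lin)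
    show "sym_mat (2 * 2) (block_mat 2 (\<lambda>k l. ka 0 0 k l z) (\<lambda>k l. ka 0 1 k l z) (\<lambda>k l. ka 1 1 k l z))" for z
      using ka_sym(1) by (intro sym_mat_block) (simp_all add: symmetric_on_def)
    show "sym_mat (2 * 2) (block_mat 2 (NP q) (NQ q) (NR q))" for q
      by (intro sym_mat_block N_sym)
    show "finite {..<(3::nat)}" by simp
    show "z \<in> sym2_cone s2 (psd_cone s) \<longleftrightarrow> (\<exists>y. psd_mat (2 * 2) (\<lambda>i j.
        block_mat 2 (\<lambda>k l. ka 0 0 k l z) (\<lambda>k l. ka 0 1 k l z) (\<lambda>k l. ka 1 1 k l z) i j
        + (\<Sum>q<3. y q * block_mat 2 (NP q) (NQ q) (NR q) i j)))" for z
    proof -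
      have "psd_mat (2 * 2) (\<lambda>i j.
        block_mat 2 (\<lambda>k l. ka 0 0 k l z) (\<lambda>k l. ka 0 1 k l z) (\<lambda>k l. ka 1 1 k l z) i j
        + (\<Sum>q<3. y q * block_mat 2 (NP q) (NQ q) (NR q) i j)) \<longleftrightarrow> psd z y" for y
        unfolding block_mat_sum block_mat_add psd_def
        using psd_mat_block[OF sym(1)[of z y] sym(3)[of z y], of "Q z y"] unfolding P_def Q_def R_def by simp
      then show ?thesis using sub sup by blast
    qed
  qed
qed

section \<open>A biquadratic form with ten zeros\<close>

lemma rational_parts:
  fixes u v :: real
  assumes "\<And>r. r\<^sup>2 = 2 \<Longrightarrow> u + r * v = 0"
  shows "u = 0 \<and> v = 0"
proof -
  have "u + sqrt 2 * v = 0" "u + (- sqrt 2) * v = 0" by (rule assms, simp)+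
  then have "u = 0" "sqrt 2 * v = 0" by linarith+
  then show ?thesis by simp
qed

text \<open>
  If \<open>b\<close> lies between \<open>a\<close> and \<open>c\<close>, replacing \<open>a\<^sup>2b + b\<^sup>2c + c\<^sup>2a + abc\<close> by \<open>b (a + c)\<^sup>2\<close> increases it by
  \<open>c (a - b)(b - c)\<close>, and \<open>4 (b + h)\<^sup>3 - 27 b h\<^sup>2 = (h - 2 b)\<^sup>2 (4 h + b)\<close> is the inequality of the arithmetic and geometric
  means of \<open>b, h/2, h/2\<close>.
\<close>

lemma cyclic_cubic_median:
  fixes a b c :: real
  assumes "a \<ge> 0" "b \<ge> 0" "c \<ge> 0" "(a - b) * (b - c) \<ge> 0"
  shows "0 \<le> 4 * (a + b + c)^3 - 27 * (a\<^sup>2 * b + b\<^sup>2 * c + c\<^sup>2 * a + a * b * c)"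
    and "4 * (a + b + c)^3 - 27 * (a\<^sup>2 * b + b\<^sup>2 * c + c\<^sup>2 * a + a * b * c) = 0 \<Longrightarrow>
         (a = b \<and> b = c) \<or> (c = 0 \<and> a = 2 * b)"
proof -
  let ?g = "4 * (a + b + c)^3 - 27 * (a\<^sup>2 * b + b\<^sup>2 * c + c\<^sup>2 * a + a * b * c)"
  have g: "?g = 27 * (c * ((a - b) * (b - c))) + (a + c - 2 * b)\<^sup>2 * (4 * (a + c) + b)"
    by (simp add: power2_eq_square power3_eq_cube algebra_simps)
  have 1: "0 \<le> c * ((a - b) * (b - c))" using assms(3,4) by (rule mult_nonneg_nonneg)
  have 2: "0 \<le> (a + c - 2 * b)\<^sup>2 * (4 * (a + c) + b)" using assms by (intro mult_nonneg_nonneg) auto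
  show "0 \<le> ?g" unfolding g using 1 2 by linarith
  assume "?g = 0"
  then have z: "c * ((a - b) * (b - c)) = 0" "(a + c - 2 * b)\<^sup>2 * (4 * (a + c) + b) = 0"
    unfolding g using 1 2 by linarith+
  show "(a = b \<and> b = c) \<or> (c = 0 \<and> a = 2 * b)"
  proof (cases "4 * (a + c) + b = 0")
    case True
    then show ?thesis using assms(1-3) by auto
  next
    case False
    then have "a + c = 2 * b" using z(2) by simp
    then show ?thesis using z(1) by auto
  qed
qed

text \<open>
  The expression is invariant under cyclic shifts, so the median may be assumed to be \<open>b\<close>.
\<close>

lemma cyclic_cubic_nonneg:
  fixes a b c :: real
  assumes "a \<ge> 0" "b \<ge> 0" "c \<ge> 0"
  shows "0 \<le> 4 * (a + b + c)^3 - 27 * (a\<^sup>2 * b + b\<^sup>2 * c + c\<^sup>2 * a + a * b * c)" (is "0 \<le> ?g a b c")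
    and "4 * (a + b + c)^3 - 27 * (a\<^sup>2 * b + b\<^sup>2 * c + c\<^sup>2 * a + a * b * c) = 0 \<Longrightarrow>
         (a = b \<and> b = c) \<or> (c = 0 \<and> a = 2 * b) \<or> (a = 0 \<and> b = 2 * c) \<or> (b = 0 \<and> c = 2 * a)"
proof -
  have rot: "?g b c a = ?g a b c" "?g c a b = ?g a b c" by (simp_all add: algebra_simps)
  have "0 \<le> (a - b) * (b - c) \<or> 0 \<le> (b - c) * (c - a) \<or> 0 \<le> (c - a) * (a - b)"
    by (auto simp: zero_le_mult_iff)
  then have "0 \<le> ?g a b c \<and> (?g a b c = 0 \<longrightarrow>
      (a = b \<and> b = c) \<or> (c = 0 \<and> a = 2 * b) \<or> (a = 0 \<and> b = 2 * c) \<or> (b = 0 \<and> c = 2 * a))"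
    using cyclic_cubic_median[of a b c] cyclic_cubic_median[of b c a] cyclic_cubic_median[of c a b] assms
    unfolding rot by auto
  then show "0 \<le> ?g a b c" and "?g a b c = 0 \<Longrightarrow>
         (a = b \<and> b = c) \<or> (c = 0 \<and> a = 2 * b) \<or> (a = 0 \<and> b = 2 * c) \<or> (b = 0 \<and> c = 2 * a)" by blast+
qed

text \<open>
  Up to scaling its zeros are \<open>x = y = (1, \<plusminus>1, \<plusminus>1)\<close> and the cyclic shifts of
  \<open>x = (1, 0, r)\<close>, \<open>y = (r, 0, 1)\<close> with \<open>r\<^sup>2 = 2\<close>.
\<close>

definition ten_zero_form :: "real \<Rightarrow> real \<Rightarrow> real \<Rightarrow> real \<Rightarrow> real \<Rightarrow> real \<Rightarrow> real" where
  "ten_zero_form x1 x2 x3 y1 y2 y3 =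
     4 * (x1\<^sup>2 + x2\<^sup>2 + x3\<^sup>2) * (y1\<^sup>2 + y2\<^sup>2 + y3\<^sup>2) - 3 * (x1 * y1 + x2 * y2 + x3 * y3)\<^sup>2
     - 3 * (x1\<^sup>2 * y2\<^sup>2 + x2\<^sup>2 * y3\<^sup>2 + x3\<^sup>2 * y1\<^sup>2)"

text \<open>
  At the zeros of \<open>ten_zero_form\<close> with a zero coordinate this form vanishes, and at
  \<open>x = y = (1, a, b)\<close> with \<open>a\<^sup>2 = b\<^sup>2 = 1\<close> it equals \<open>3 (1 + a)(1 + b)\<close>. So among the ten zeros it singles out
  \<open>(1, 1, 1)\<close>.
\<close>

definition selecting_form :: "real \<Rightarrow> real \<Rightarrow> real \<Rightarrow> real \<Rightarrow> real \<Rightarrow> real \<Rightarrow> real" where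
  "selecting_form x1 x2 x3 y1 y2 y3 =
     2 * (x1 * x2 * y1 * y2 + x2 * x3 * y2 * y3 + x1 * x3 * y1 * y3)
     - (x1\<^sup>2 * y1\<^sup>2 + x2\<^sup>2 * y2\<^sup>2 + x3\<^sup>2 * y3\<^sup>2)
     + 3 * (x1 * x2 * y3\<^sup>2 + x1 * x3 * y2\<^sup>2 + x2 * x3 * y1\<^sup>2)"

lemma selecting_form_cyclic: "selecting_form x1 x2 x3 y1 y2 y3 = selecting_form x2 x3 x1 y2 y3 y1"
  by (simp add: selecting_form_def algebra_simps)

lemma selecting_form_zero_at_boundary:
  assumes D: "4 * x1 * y3 = 2 * x3 * y1" and y: "y1\<^sup>2 = 2 * y3\<^sup>2" "y3 \<noteq> 0" and "x2 = 0" "y2 = 0"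
  shows "selecting_form x1 x2 x3 y1 y2 y3 = (0::real)"
proof -
  have "y3 * (x1 * y1 - x3 * y3) = 0" using D y(1) by (simp add: power2_eq_square algebra_simps) algebra
  then have "x1 * y1 = x3 * y3" using y(2) by simp
  then have "(x1 * y1 - x3 * y3)\<^sup>2 = 0" by simp
  then show ?thesis using assms(4,5) by (simp add: selecting_form_def power2_eq_square algebra_simps)
qed

text \<open>
  For fixed \<open>y\<close> the form in \<open>x\<close> is \<open>\<Sum> D\<^sub>i x\<^sub>i\<^sup>2 - 3 (x \<cdot> y)\<^sup>2\<close> with \<open>D\<^sub>i > 0\<close>. By Lagrange's identity for the Cauchy-Schwarz
  inequality it is nonnegative if \<open>3 \<Sum> y\<^sub>i\<^sup>2 / D\<^sub>i \<le> 1\<close>, and after clearing denominators this is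
  the cubic inequality for \<open>(y\<^sub>1\<^sup>2, y\<^sub>3\<^sup>2, y\<^sub>2\<^sup>2)\<close>. The equality cases of both inequalities give the zeros.
\<close>

lemma ten_zero_form_nonneg:
  fixes x1 x2 x3 y1 y2 y3 :: real
  shows "0 \<le> ten_zero_form x1 x2 x3 y1 y2 y3"
    and "ten_zero_form x1 x2 x3 y1 y2 y3 = 0 \<Longrightarrow> 0 \<le> selecting_form x1 x2 x3 y1 y2 y3"
proof -
  have *: "0 \<le> ten_zero_form x1 x2 x3 y1 y2 y3 \<and> (ten_zero_form x1 x2 x3 y1 y2 y3 = 0 \<longrightarrow> 0 \<le> selecting_form x1 x2 x3 y1 y2 y3)"
  proof (cases "y1 = 0 \<and> y2 = 0 \<and> y3 = 0")
    case True
    then show ?thesis by (simp add: ten_zero_form_def selecting_form_def)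
  next
    case False
    define Y1 Y2 Y3 where Y: "Y1 = y1\<^sup>2" "Y2 = y2\<^sup>2" "Y3 = y3\<^sup>2"
    define S where "S = Y1 + Y2 + Y3"
    define D1 D2 D3 where D: "D1 = 4 * S - 3 * Y2" "D2 = 4 * S - 3 * Y3" "D3 = 4 * S - 3 * Y1"
    have Y0: "Y1 \<ge> 0" "Y2 \<ge> 0" "Y3 \<ge> 0" by (simp_all add: Y)
    have S: "S > 0"
    proof (rule ccontr)
      assume "\<not> S > 0"
      then have "Y1 = 0" "Y2 = 0" "Y3 = 0" using Y0 unfolding S_def by linarith+
      then show False using False by (simp add: Y)
    qed
    have D0: "D1 > 0" "D2 > 0" "D3 > 0" using S Y0 unfolding D S_def by auto
    define T where "T = Y1 * (D2 * D3) + Y2 * (D1 * D3) + Y3 * (D1 * D2)"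
    define g where "g = 4 * (Y1 + Y3 + Y2)^3 - 27 * (Y1\<^sup>2 * Y3 + Y3\<^sup>2 * Y2 + Y2\<^sup>2 * Y1 + Y1 * Y3 * Y2)"
    define d where "d = x1 * y1 + x2 * y2 + x3 * y3"
    define E12 where "E12 = D1 * (x1 * y2) - D2 * (x2 * y1)"
    define E13 where "E13 = D1 * (x1 * y3) - D3 * (x3 * y1)"
    define E23 where "E23 = D2 * (x2 * y3) - D3 * (x3 * y2)"
    have p: "ten_zero_form x1 x2 x3 y1 y2 y3 = D1 * x1\<^sup>2 + D2 * x2\<^sup>2 + D3 * x3\<^sup>2 - 3 * d\<^sup>2"
      unfolding ten_zero_form_def D S_def Y d_def by algebra
    have T: "T > 0"
    proof -
      have "Y1 > 0 \<or> Y2 > 0 \<or> Y3 > 0" using S Y0 unfolding S_def by linarith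
      moreover have "0 \<le> Y1 * (D2 * D3)" "0 \<le> Y2 * (D1 * D3)" "0 \<le> Y3 * (D1 * D2)"
        using Y0 D0 by simp_all
      moreover have "Y1 > 0 \<Longrightarrow> 0 < Y1 * (D2 * D3)" "Y2 > 0 \<Longrightarrow> 0 < Y2 * (D1 * D3)" "Y3 > 0 \<Longrightarrow> 0 < Y3 * (D1 * D2)"
        using D0 by simp_all
      ultimately show ?thesis unfolding T_def by linarith
    qed
    have g: "g = D1 * (D2 * D3) - 3 * T"
      unfolding g_def T_def D S_def by algebra
    have lagrange: "(D1 * x1\<^sup>2 + D2 * x2\<^sup>2 + D3 * x3\<^sup>2) * T
        = D1 * (D2 * D3) * d\<^sup>2 + (D3 * E12\<^sup>2 + D2 * E13\<^sup>2 + D1 * E23\<^sup>2)"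
      unfolding T_def d_def E12_def E13_def E23_def Y by algebra
    have pT: "ten_zero_form x1 x2 x3 y1 y2 y3 * T = g * d\<^sup>2 + (D3 * E12\<^sup>2 + D2 * E13\<^sup>2 + D1 * E23\<^sup>2)"
      unfolding p g using lagrange by (simp add: algebra_simps)
    have g0: "0 \<le> g" unfolding g_def using Y0 by (intro cyclic_cubic_nonneg)
    have nn: "0 \<le> g * d\<^sup>2" "0 \<le> D3 * E12\<^sup>2" "0 \<le> D2 * E13\<^sup>2" "0 \<le> D1 * E23\<^sup>2" using g0 D0 by simp_all
    then have "0 \<le> ten_zero_form x1 x2 x3 y1 y2 y3 * T" unfolding pT by linarith
    then have "0 \<le> ten_zero_form x1 x2 x3 y1 y2 y3" using T by (simp add: zero_le_mult_iff)
    moreover have "0 \<le> selecting_form x1 x2 x3 y1 y2 y3" if p0: "ten_zero_form x1 x2 x3 y1 y2 y3 = 0"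
    proof (cases "d = 0")
      case True
      have "0 \<le> D1 * x1\<^sup>2" "0 \<le> D2 * x2\<^sup>2" "0 \<le> D3 * x3\<^sup>2" using D0 by simp_all
      moreover have "D1 * x1\<^sup>2 + D2 * x2\<^sup>2 + D3 * x3\<^sup>2 = 0" using p0 True unfolding p by simp
      ultimately have "D1 * x1\<^sup>2 = 0" "D2 * x2\<^sup>2 = 0" "D3 * x3\<^sup>2 = 0" by linarith+
      then have "x1 = 0" "x2 = 0" "x3 = 0" using D0 by auto
      then show ?thesis by (simp add: selecting_form_def)
    next
      case d: False
      have "g * d\<^sup>2 + (D3 * E12\<^sup>2 + D2 * E13\<^sup>2 + D1 * E23\<^sup>2) = 0" using pT p0 by simp
      then have "g * d\<^sup>2 = 0" "D3 * E12\<^sup>2 = 0" "D2 * E13\<^sup>2 = 0" "D1 * E23\<^sup>2 = 0"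
        using nn by linarith+
      then have "g = 0" and "E12 = 0" "E13 = 0" "E23 = 0" using d D0 by auto
      then have E: "D1 * (x1 * y2) = D2 * (x2 * y1)" "D1 * (x1 * y3) = D3 * (x3 * y1)"
          "D2 * (x2 * y3) = D3 * (x3 * y2)" by (simp_all add: E12_def E13_def E23_def)
      consider "Y1 = Y3 \<and> Y3 = Y2" | "Y2 = 0 \<and> Y1 = 2 * Y3" | "Y1 = 0 \<and> Y3 = 2 * Y2" | "Y3 = 0 \<and> Y2 = 2 * Y1"
        using cyclic_cubic_nonneg(2)[of Y1 Y3 Y2] Y0 \<open>g = 0\<close> unfolding g_def by blast
      then show ?thesis
      proof cases
        case 1
        have eq: "D1 = D2" "D2 = D3" unfolding D using 1 by simp_all
        have c: "x1 * y2 = x2 * y1" "x1 * y3 = x3 * y1" "x2 * y3 = x3 * y2" using E D0 unfolding eq by simp_all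
        have "y2\<^sup>2 = y1\<^sup>2" "y3\<^sup>2 = y1\<^sup>2" using 1 by (simp_all add: Y)
        then have pm: "(y2 = y1 \<or> y2 = - y1) \<and> (y3 = y1 \<or> y3 = - y1)" by (simp add: power2_eq_iff)
        have y1: "y1 \<noteq> 0" using False pm by auto
        have "y2 = - y1 \<Longrightarrow> (x1 + x2) * y1 = 0" "y3 = - y1 \<Longrightarrow> (x1 + x3) * y1 = 0"
             "y2 = y1 \<Longrightarrow> (x1 - x2) * y1 = 0" "y3 = y1 \<Longrightarrow> (x1 - x3) * y1 = 0"
          using c(1,2) by (simp_all add: algebra_simps)
        then have "(x2 = x1 \<and> y2 = y1 \<or> x2 = - x1 \<and> y2 = - y1) \<and> (x3 = x1 \<and> y3 = y1 \<or> x3 = - x1 \<and> y3 = - y1)"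
          using pm y1 by (auto simp: add_eq_0_iff)
        then show ?thesis
          using zero_le_square[of "x1 * y1"] by (auto simp: selecting_form_def power2_eq_square algebra_simps)
      next
        case 2
        have k: "Y3 > 0" using S 2 by (simp add: S_def)
        have y: "y2 = 0" "y1 \<noteq> 0" "y3 \<noteq> 0" using 2 k by (auto simp: Y)
        have x2: "x2 = 0" using E(1) y D0 by simp
        have "Y3 * (4 * x1 * y3) = Y3 * (2 * x3 * y1)" using E(2) 2 by (auto simp: D S_def)
        then have "4 * x1 * y3 = 2 * x3 * y1" using k by simp
        then show ?thesis
          using selecting_form_zero_at_boundary[of x1 y3 x3 y1 x2 y2] y x2 2 by (simp add: Y)
      next
        case 3
        have k: "Y2 > 0" using S 3 by (simp add: S_def)
        have y: "y1 = 0" "y3 \<noteq> 0" "y2 \<noteq> 0" using 3 k by (auto simp: Y)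
        have x: "x1 = 0" using E(1) y D0 by simp
        have "Y2 * (4 * x3 * y2) = Y2 * (2 * x2 * y3)" using E(3) 3 by (auto simp: D S_def)
        then have "4 * x3 * y2 = 2 * x2 * y3" using k by simp
        then show ?thesis
          using selecting_form_zero_at_boundary[of x3 y2 x2 y3 x1 y1] y x 3
            selecting_form_cyclic[of x1 x2 x3 y1 y2 y3] selecting_form_cyclic[of x2 x3 x1 y2 y3 y1] by (simp add: Y)
      next
        case 4
        have k: "Y1 > 0" using S 4 by (simp add: S_def)
        have y: "y3 = 0" "y2 \<noteq> 0" "y1 \<noteq> 0" using 4 k by (auto simp: Y)
        have x: "x3 = 0" using E(2) y D0 by simp
        have "Y1 * (4 * x2 * y1) = Y1 * (2 * x1 * y2)" using E(1) 4 by (auto simp: D S_def)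
        then have "4 * x2 * y1 = 2 * x1 * y2" using k by simp
        then show ?thesis
          using selecting_form_zero_at_boundary[of x2 y1 x1 y2 x3 y3] y x 4
            selecting_form_cyclic[of x1 x2 x3 y1 y2 y3] by (simp add: Y)
      qed
    qed
    ultimately show ?thesis by blast
  qed
  then show "0 \<le> ten_zero_form x1 x2 x3 y1 y2 y3"
    and "ten_zero_form x1 x2 x3 y1 y2 y3 = 0 \<Longrightarrow> 0 \<le> selecting_form x1 x2 x3 y1 y2 y3" by blast+
qed

text \<open>
  The general biquadratic form invariant under simultaneous cyclic shifts of \<open>x\<close> and \<open>y\<close>.
\<close>

definition cyclic_form ::
    "real \<Rightarrow> real \<Rightarrow> real \<Rightarrow> real \<Rightarrow> real \<Rightarrow> real \<Rightarrow> real \<Rightarrow> real \<Rightarrow> real \<Rightarrow> real \<Rightarrow> real \<Rightarrow> real \<Rightarrow>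
     real \<Rightarrow> real \<Rightarrow> real \<Rightarrow> real \<Rightarrow> real \<Rightarrow> real \<Rightarrow> real" where
  "cyclic_form A0 A1 A2 B0 B1 B2 C0 C1 C2 D0 D1 D2 x1 x2 x3 y1 y2 y3 =
     A0 * (x1^2 * y1^2 + x2^2 * y2^2 + x3^2 * y3^2) +
     A1 * (x1^2 * y2^2 + x2^2 * y3^2 + x3^2 * y1^2) +
     A2 * (x1^2 * y3^2 + x2^2 * y1^2 + x3^2 * y2^2) +
     B0 * (x1^2 * (y2 * y3) + x2^2 * (y1 * y3) + x3^2 * (y1 * y2)) +
     B1 * (x1^2 * (y1 * y2) + x2^2 * (y2 * y3) + x3^2 * (y1 * y3)) +
     B2 * (x1^2 * (y1 * y3) + x2^2 * (y1 * y2) + x3^2 * (y2 * y3)) +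
     C0 * (x2 * x3 * y1^2 + x1 * x3 * y2^2 + x1 * x2 * y3^2) +
     C1 * (x2 * x3 * y2^2 + x1 * x3 * y3^2 + x1 * x2 * y1^2) +
     C2 * (x2 * x3 * y3^2 + x1 * x3 * y1^2 + x1 * x2 * y2^2) +
     D0 * (x1 * x2 * (y1 * y2) + x2 * x3 * (y2 * y3) + x1 * x3 * (y1 * y3)) +
     D1 * (x1 * x2 * (y2 * y3) + x2 * x3 * (y1 * y3) + x1 * x3 * (y1 * y2)) +
     D2 * (x1 * x2 * (y1 * y3) + x2 * x3 * (y1 * y2) + x1 * x3 * (y2 * y3))"

text \<open>
  A nonnegative form is critical at its zeros. The partial derivatives at the two kinds of zeros are
  linear conditions on the twelve coefficients; those at \<open>r = \<plusminus>\<surd>2\<close> split into a rational part and a multiple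
  of \<open>r\<close>. Together they have rank 11, and the sum of the coefficients, which determines the value at
  \<open>(1, 1, 1)\<close>, is a combination of them.
\<close>

lemma cyclic_form_vanishes:
  fixes A0 A1 A2 B0 B1 B2 C0 C1 C2 D0 D1 D2 :: real
  assumes nonneg: "\<And>x1 x2 x3 y1 y2 y3. 0 \<le> cyclic_form A0 A1 A2 B0 B1 B2 C0 C1 C2 D0 D1 D2 x1 x2 x3 y1 y2 y3"
    and zero1: "cyclic_form A0 A1 A2 B0 B1 B2 C0 C1 C2 D0 D1 D2 1 1 (-1) 1 1 (-1) = 0"
    and zero2: "\<And>r. r\<^sup>2 = 2 \<Longrightarrow> cyclic_form A0 A1 A2 B0 B1 B2 C0 C1 C2 D0 D1 D2 1 0 r r 0 1 = 0"
  shows "cyclic_form A0 A1 A2 B0 B1 B2 C0 C1 C2 D0 D1 D2 1 1 1 1 1 1 = 0"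
proof -
  \<comment> \<open>Half the partial derivatives at \<open>x = y = (1, 1, -1)\<close>.\<close>
  have s0: "(A0 + A1 + A2 + (-1) * B0 + B1 + (-1) * B2 + D0 + (-1) * D1) = 0"
  proof (rule linear_term_zero_of_nonneg)
    fix t
    show "0 \<le> 2 * t * ((A0 + A1 + A2 + (-1) * B0 + B1 + (-1) * B2 + D0 + (-1) * D1)) + t\<^sup>2 * ((A0 + A1 + A2 + (-1) * B0 + B1 + (-1) * B2))"
      using nonneg[of "(1 + t)" "1" "(-1)" "1" "1" "(-1)"] zero1
      by (simp add: cyclic_form_def power2_eq_square algebra_simps)
  qed
  have s1: "(A0 + A1 + A2 + (-1) * B0 + (-1) * B1 + B2 + D0 + (-1) * D2) = 0"
  proof (rule linear_term_zero_of_nonneg)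
    fix t
    show "0 \<le> 2 * t * ((A0 + A1 + A2 + (-1) * B0 + (-1) * B1 + B2 + D0 + (-1) * D2)) + t\<^sup>2 * ((A0 + A1 + A2 + (-1) * B0 + (-1) * B1 + B2))"
      using nonneg[of "1" "(1 + t)" "(-1)" "1" "1" "(-1)"] zero1
      by (simp add: cyclic_form_def power2_eq_square algebra_simps)
  qed
  have s2: "((-1) * A0 + (-1) * A1 + (-1) * A2 + (-1) * B0 + B1 + B2 + C0 + C1 + C2 + (-1) * D0) = 0"
  proof (rule linear_term_zero_of_nonneg)
    fix t
    show "0 \<le> 2 * t * (((-1) * A0 + (-1) * A1 + (-1) * A2 + (-1) * B0 + B1 + B2 + C0 + C1 + C2 + (-1) * D0)) + t\<^sup>2 * ((A0 + A1 + A2 + B0 + (-1) * B1 + (-1) * B2))"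
      using nonneg[of "1" "1" "(-1 + t)" "1" "1" "(-1)"] zero1
      by (simp add: cyclic_form_def power2_eq_square algebra_simps)
  qed
  have s3: "(A0 + A1 + A2 + (-1) * C0 + C1 + (-1) * C2 + D0 + (-1) * D2) = 0"
  proof (rule linear_term_zero_of_nonneg)
    fix t
    show "0 \<le> 2 * t * ((A0 + A1 + A2 + (-1) * C0 + C1 + (-1) * C2 + D0 + (-1) * D2)) + t\<^sup>2 * ((A0 + A1 + A2 + (-1) * C0 + C1 + (-1) * C2))"
      using nonneg[of "1" "1" "(-1)" "(1 + t)" "1" "(-1)"] zero1
      by (simp add: cyclic_form_def power2_eq_square algebra_simps)
  qed
  have s4: "(A0 + A1 + A2 + (-1) * C0 + (-1) * C1 + C2 + D0 + (-1) * D1) = 0"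
  proof (rule linear_term_zero_of_nonneg)
    fix t
    show "0 \<le> 2 * t * ((A0 + A1 + A2 + (-1) * C0 + (-1) * C1 + C2 + D0 + (-1) * D1)) + t\<^sup>2 * ((A0 + A1 + A2 + (-1) * C0 + (-1) * C1 + C2))"
      using nonneg[of "1" "1" "(-1)" "1" "(1 + t)" "(-1)"] zero1
      by (simp add: cyclic_form_def power2_eq_square algebra_simps)
  qed
  have s5: "((-1) * A0 + (-1) * A1 + (-1) * A2 + B0 + B1 + B2 + (-1) * C0 + C1 + C2 + (-1) * D0) = 0"
  proof (rule linear_term_zero_of_nonneg)
    fix t
    show "0 \<le> 2 * t * (((-1) * A0 + (-1) * A1 + (-1) * A2 + B0 + B1 + B2 + (-1) * C0 + C1 + C2 + (-1) * D0)) + t\<^sup>2 * ((A0 + A1 + A2 + C0 + (-1) * C1 + (-1) * C2))"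
      using nonneg[of "1" "1" "(-1)" "1" "1" "(-1 + t)"] zero1
      by (simp add: cyclic_form_def power2_eq_square algebra_simps)
  qed
  \<comment> \<open>Half the partial derivatives at \<open>x = (1, 0, r)\<close>, \<open>y = (r, 0, 1)\<close>.\<close>
  have e0: "(2) * A0 + A2 + D0 = 0 \<and> B2 + (1 / 2) * C1 + C2 = 0"
  proof (rule rational_parts)
    fix r :: real assume r: "r\<^sup>2 = 2"
    then have rr: "r * r = 2" "\<And>w. r * (r * w) = 2 * w" by (simp_all add: power2_eq_square mult.assoc[symmetric])
    show "((2) * A0 + A2 + D0) + r * (B2 + (1 / 2) * C1 + C2) = 0"
    proof (rule linear_term_zero_of_nonneg)
      fix t
      show "0 \<le> 2 * t * (((2) * A0 + A2 + D0) + r * (B2 + (1 / 2) * C1 + C2)) + t\<^sup>2 * (((2) * A0 + A2) + r * (B2))"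
        using nonneg[of "(1 + t)" "0" "r" "r" "0" "1"] zero2[OF r]
        by (simp add: cyclic_form_def power2_eq_square rr algebra_simps)
    qed
  qed
  have e1: "(1 / 2) * C0 + C1 + D1 = 0 \<and> C0 + (1 / 2) * C2 + (1 / 2) * D2 = 0"
  proof (rule rational_parts)
    fix r :: real assume r: "r\<^sup>2 = 2"
    then have rr: "r * r = 2" "\<And>w. r * (r * w) = 2 * w" by (simp_all add: power2_eq_square mult.assoc[symmetric])
    show "((1 / 2) * C0 + C1 + D1) + r * (C0 + (1 / 2) * C2 + (1 / 2) * D2) = 0"
    proof (rule linear_term_zero_of_nonneg)
      fix t
      show "0 \<le> 2 * t * (((1 / 2) * C0 + C1 + D1) + r * (C0 + (1 / 2) * C2 + (1 / 2) * D2)) + t\<^sup>2 * ((A1 + (2) * A2) + r * (B0))"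
        using nonneg[of "1" "(0 + t)" "r" "r" "0" "1"] zero2[OF r]
        by (simp add: cyclic_form_def power2_eq_square rr algebra_simps)
    qed
  qed
  have e2: "(2) * B1 + (1 / 2) * C1 + C2 = 0 \<and> A0 + (2) * A1 + (1 / 2) * D0 = 0"
  proof (rule rational_parts)
    fix r :: real assume r: "r\<^sup>2 = 2"
    then have rr: "r * r = 2" "\<And>w. r * (r * w) = 2 * w" by (simp_all add: power2_eq_square mult.assoc[symmetric])
    show "((2) * B1 + (1 / 2) * C1 + C2) + r * (A0 + (2) * A1 + (1 / 2) * D0) = 0"
    proof (rule linear_term_zero_of_nonneg)
      fix t
      show "0 \<le> 2 * t * (((2) * B1 + (1 / 2) * C1 + C2) + r * (A0 + (2) * A1 + (1 / 2) * D0)) + t\<^sup>2 * ((A0 + (2) * A1) + r * (B1))"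
        using nonneg[of "1" "0" "(r + t)" "r" "0" "1"] zero2[OF r]
        by (simp add: cyclic_form_def power2_eq_square rr algebra_simps)
    qed
  qed
  have e3: "B1 + (1 / 2) * B2 + (2) * C2 = 0 \<and> A0 + (2) * A1 + (1 / 2) * D0 = 0"
  proof (rule rational_parts)
    fix r :: real assume r: "r\<^sup>2 = 2"
    then have rr: "r * r = 2" "\<And>w. r * (r * w) = 2 * w" by (simp_all add: power2_eq_square mult.assoc[symmetric])
    show "(B1 + (1 / 2) * B2 + (2) * C2) + r * (A0 + (2) * A1 + (1 / 2) * D0) = 0"
    proof (rule linear_term_zero_of_nonneg)
      fix t
      show "0 \<le> 2 * t * ((B1 + (1 / 2) * B2 + (2) * C2) + r * (A0 + (2) * A1 + (1 / 2) * D0)) + t\<^sup>2 * ((A0 + (2) * A1) + r * (C2))"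
        using nonneg[of "1" "0" "r" "(r + t)" "0" "1"] zero2[OF r]
        by (simp add: cyclic_form_def power2_eq_square rr algebra_simps)
    qed
  qed
  have e4: "(1 / 2) * B0 + B2 + D1 = 0 \<and> B0 + (1 / 2) * B1 + (1 / 2) * D2 = 0"
  proof (rule rational_parts)
    fix r :: real assume r: "r\<^sup>2 = 2"
    then have rr: "r * r = 2" "\<And>w. r * (r * w) = 2 * w" by (simp_all add: power2_eq_square mult.assoc[symmetric])
    show "((1 / 2) * B0 + B2 + D1) + r * (B0 + (1 / 2) * B1 + (1 / 2) * D2) = 0"
    proof (rule linear_term_zero_of_nonneg)
      fix t
      show "0 \<le> 2 * t * (((1 / 2) * B0 + B2 + D1) + r * (B0 + (1 / 2) * B1 + (1 / 2) * D2)) + t\<^sup>2 * ((A1 + (2) * A2) + r * (C0))"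
        using nonneg[of "1" "0" "r" "r" "(0 + t)" "1"] zero2[OF r]
        by (simp add: cyclic_form_def power2_eq_square rr algebra_simps)
    qed
  qed
  have e5: "(2) * A0 + A2 + D0 = 0 \<and> B1 + (1 / 2) * B2 + C1 = 0"
  proof (rule rational_parts)
    fix r :: real assume r: "r\<^sup>2 = 2"
    then have rr: "r * r = 2" "\<And>w. r * (r * w) = 2 * w" by (simp_all add: power2_eq_square mult.assoc[symmetric])
    show "((2) * A0 + A2 + D0) + r * (B1 + (1 / 2) * B2 + C1) = 0"
    proof (rule linear_term_zero_of_nonneg)
      fix t
      show "0 \<le> 2 * t * (((2) * A0 + A2 + D0) + r * (B1 + (1 / 2) * B2 + C1)) + t\<^sup>2 * (((2) * A0 + A2) + r * (C1))"
        using nonneg[of "1" "0" "r" "r" "0" "(1 + t)"] zero2[OF r]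
        by (simp add: cyclic_form_def power2_eq_square rr algebra_simps)
    qed
  qed
  have "A0 + A1 + A2 + B0 + B1 + B2 + C0 + C1 + C2 + D0 + D1 + D2 = 0"
    using s0 s1 s2 s3 s4 s5 e0 e1 e2 e3 e4 e5 by linarith
  then show ?thesis by (simp add: cyclic_form_def) 
qed

section \<open>Spectrahedral cones beyond a point of a face\<close>

text \<open>
  On a common kernel vector both forms lose an index; without one, \<open>A\<close> is positive definite on the
  compact unit sphere, where the quotient of the two forms is bounded.
\<close>

lemma psd_dominated:
  assumes "finite I" "symmetric_on I A" "symmetric_on I G"
    and "\<And>u. 0 \<le> bform I A u u" "\<And>u. 0 \<le> bform I G u u"
    and "\<And>u. bform I A u u = 0 \<Longrightarrow> bform I G u u = 0"
  shows "\<exists>c>0. \<forall>u. c * bform I G u u \<le> bform I A u u"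
  using assms
proof (induction I rule: finite_psubset_induct)
  case (psubset I)
  note fin = psubset.hyps(1) and sym = psubset.prems(1,2) and A = psubset.prems(3)
    and G = psubset.prems(4) and ker = psubset.prems(5)
  show ?case
  proof (cases "I = {}")
    case True
    then show ?thesis by (intro exI[of _ 1]) (simp add: bform_def)
  next
    case False
    show ?thesis
    proof (cases "\<exists>y\<in>usphere I. bform I A y y = 0")
      case True
      then obtain y where y: "y \<in> usphere I" "bform I A y y = 0" by blast
      have kA: "bform I A u y = 0" and kG: "bform I G u y = 0" for u
        using psd_kernel[OF sym(1) A y(2)] psd_kernel[OF sym(2) G ker[OF y(2)]] by blast+
      obtain k where k: "k \<in> I" "y k \<noteq> 0" using usphere_nonzero[OF y(1)] by blast
      let ?J = "I - {k}"
      have "\<exists>c>0. \<forall>u. c * bform ?J G u u \<le> bform ?J A u u"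
      proof (rule psubset.IH)
        show "?J \<subset> I" using k by auto
        show "symmetric_on ?J A" "symmetric_on ?J G" using sym by (auto intro: symmetric_on_subset)
        show "0 \<le> bform ?J A u u" "0 \<le> bform ?J G u u"
             "bform ?J A u u = 0 \<Longrightarrow> bform ?J G u u = 0" for u
          unfolding bform_restrict[OF fin k(1)] using A G ker by blast+
      qed
      then obtain c where c: "c > 0" "\<And>u. c * bform ?J G u u \<le> bform ?J A u u" by blast
      have "c * bform I G u u \<le> bform I A u u" for u
        using c(2)[of "elim y k u"] bform_elim[of I k y, OF fin k sym(1) kA, of u u]
          bform_elim[of I k y, OF fin k sym(2) kG, of u u] by simp
      then show ?thesis using c(1) by blast
    next
      case nz: False
      have pos: "bform I A u u > 0" if "u \<in> usphere I" for u
        using A[of u] nz that by (metis less_eq_real_def)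
      have cont: "continuous_on (usphere I) (\<lambda>u. bform I G u u / bform I A u u)"
        using nz by (intro continuous_intros) auto
      obtain y where y: "y \<in> usphere I"
        and max: "\<And>u. u \<in> usphere I \<Longrightarrow> bform I G u u / bform I A u u \<le> bform I G y y / bform I A y y"
        using continuous_attains_sup[OF compact_usphere[OF fin] usphere_nonempty[OF False fin] cont] by auto
      define m where "m = bform I G y y / bform I A y y"
      have m: "m \<ge> 0" using pos[OF y] G[of y] by (simp add: m_def)
      have "1 / (m + 1) * bform I G u u \<le> bform I A u u" for u
      proof (cases "\<exists>i\<in>I. u i \<noteq> 0")
        case True
        then obtain i where "i \<in> I" "u i \<noteq> 0" by auto
        then obtain v where v: "v \<in> usphere I"
          and u: "\<forall>X. bform I X u u = (\<Sum>i\<in>I. (u i)\<^sup>2) * bform I X v v"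
          using bform_homogeneous[OF fin, of i u] \<open>i \<in> I\<close> \<open>u i \<noteq> 0\<close> by blast
        have "bform I G v v \<le> m * bform I A v v"
          using max[OF v] pos[OF v] by (simp add: m_def divide_le_eq)
        then have "bform I G v v \<le> (m + 1) * bform I A v v" using pos[OF v] by (simp add: algebra_simps)
        then have "1 / (m + 1) * bform I G v v \<le> bform I A v v" using m by (simp add: field_simps)
        then have "(\<Sum>i\<in>I. (u i)\<^sup>2) * (1 / (m + 1) * bform I G v v) \<le> (\<Sum>i\<in>I. (u i)\<^sup>2) * bform I A v v"
          by (rule mult_left_mono) (simp add: sum_nonneg)
        then show ?thesis unfolding u[rule_format] by (simp add: mult.left_commute)
      next
        case False
        then show ?thesis by (simp add: bform_def)
      qed
      then show ?thesis using m by (intro exI[of _ "1 / (m + 1)"]) auto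
    qed
  qed
qed

text \<open>
  Functionals that support the cone at \<open>x\<^sub>0\<close> arise as \<open>x \<mapsto> u\<^sup>T A(x) u\<close> for the kernel vectors \<open>u\<close> of the matrix
  \<open>A(x\<^sub>0)\<close>. If they all vanish at \<open>g\<close>, the kernel of \<open>A(g)\<close> contains that of \<open>A(x\<^sub>0)\<close>, so that a small multiple
  of \<open>A(g)\<close> can be subtracted from \<open>A(x\<^sub>0)\<close>. In other words, \<open>g\<close> belongs to the smallest face containing \<open>x\<^sub>0\<close> as soon as it
  belongs to every exposed face containing \<open>x\<^sub>0\<close>.
\<close>

theorem spectrahedron_cone_continues:
  fixes C :: "'e::real_vector set"
  assumes "spectrahedron C" and C: "convex_cone C" and x0: "x0 \<in> C" and g: "g \<in> C"
    and dom: "\<And>h :: 'e \<Rightarrow> real. linear h \<Longrightarrow> (\<And>c. c \<in> C \<Longrightarrow> 0 \<le> h c) \<Longrightarrow> h x0 = 0 \<Longrightarrow> h g = 0"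
  shows "\<exists>c>0. x0 - c *\<^sub>R g \<in> C"
proof -
  obtain B :: "'e set" and d M0 M where B: "finite B" "independent B" "span B = UNIV"
    and M0: "sym_mat d M0" and M: "\<forall>b\<in>B. sym_mat d (M b)"
    and C_eq: "C = {x. psd_mat d (\<lambda>i j. M0 i j + (\<Sum>b\<in>B. representation B x b * M b i j))}"
    using assms(1) unfolding spectrahedron_def by blast
  let ?I = "{..<d}"
  define L where "L = (\<lambda>x i j. \<Sum>b\<in>B. representation B x b * M b i j)"
  define A where "A = (\<lambda>x i j. M0 i j + L x i j)"
  have L_lin: "linear (\<lambda>x. L x i j)" for i j
    unfolding L_def using B
    by (auto simp: linear_iff representation_add representation_scale sum.distrib sum_distrib_left algebra_simps)
  define h where "h = (\<lambda>u x. bform ?I (L x) u u)"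
  have h_lin: "linear (h u)" for u
    unfolding h_def bform_def
    by (intro linear_compose_sum ballI)
       (auto simp: linear_iff linear_add[OF L_lin] linear_cmul[OF L_lin] algebra_simps)
  have A_h: "bform ?I (A x) u u = bform ?I M0 u u + h u x" for x u
    using bform_lincomb_mat[of ?I 1 M0 1 "L x" u u] by (simp add: A_def h_def)
  have A_sym: "symmetric_on ?I (A x)" for x
    using M0 M by (simp add: symmetric_on_def A_def L_def sym_mat_def)
  have C_iff: "x \<in> C \<longleftrightarrow> (\<forall>u. 0 \<le> bform ?I (A x) u u)" for x
    unfolding C_eq using A_sym[of x] by (simp add: psd_mat_iff A_def L_def)
  have M0_nn: "0 \<le> bform ?I M0 u u" for u
  proof -
    have "0 \<le> bform ?I (A 0) u u" using C_iff[of 0] convex_cone_contains_0[OF C] by blast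
    then show ?thesis by (simp add: A_h linear_0[OF h_lin])
  qed
  have "\<exists>c>0. \<forall>u. c * bform ?I (A g) u u \<le> bform ?I (A x0) u u"
  proof (rule psd_dominated)
    fix u assume z: "bform ?I (A x0) u u = 0"
    \<comment> \<open>The pencil is only affine, but on a cone its constant term vanishes where it has to:
      the values at \<open>0\<close>, \<open>x0\<close> and \<open>2 x0\<close> are nonnegative and the middle one is \<open>0\<close>.\<close>
    have "2 *\<^sub>R x0 \<in> C" using C x0 by (simp add: convex_cone_scaleR)
    then have "0 \<le> bform ?I (A (2 *\<^sub>R x0)) u u" using C_iff by blast
    then have "0 \<le> bform ?I M0 u u + 2 * h u x0" by (simp add: A_h linear_cmul[OF h_lin])
    then have h0: "bform ?I M0 u u = 0" "h u x0 = 0" using z M0_nn[of u] unfolding A_h by linarith+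
    have "0 \<le> h u c" if "c \<in> C" for c
    proof -
      have "0 \<le> bform ?I (A c) u u" using that C_iff by blast
      then show ?thesis by (simp add: A_h h0(1))
    qed
    then have "h u g = 0" using dom[OF h_lin] h0(2) by blast
    then show "bform ?I (A g) u u = 0" unfolding A_h using h0(1) by simp
  qed (use A_sym C_iff x0 g in auto)
  then obtain c where c: "c > 0" "\<And>u. c * bform ?I (A g) u u \<le> bform ?I (A x0) u u" by blast
  have "0 \<le> bform ?I (A (x0 - c *\<^sub>R g)) u u" for u
  proof -
    have "h u (x0 - c *\<^sub>R g) = h u x0 - c * h u g" by (simp add: linear_diff[OF h_lin] linear_cmul[OF h_lin])
    moreover have "0 \<le> c * bform ?I M0 u u" using c(1) M0_nn by simp
    ultimately show ?thesis using c(2)[of u] unfolding A_h by (simp add: algebra_simps)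
  qed
  then show ?thesis using c(1) C_iff by blast
qed

section \<open>A nonexposed face for two three-dimensional factors\<close>

locale tensor_coords_3 = tensor_coords sV 3 e xi mu sW 3 f eta nu t tau
  for sV :: "'v::real_vector \<Rightarrow> 'v \<Rightarrow> 'a::real_vector" and e xi mu
    and sW :: "'w::real_vector \<Rightarrow> 'w \<Rightarrow> 'b::real_vector" and f eta nu
    and t :: "'a \<Rightarrow> 'b \<Rightarrow> 'c::real_vector" and tau +
  assumes dual_V: "i < 3 \<Longrightarrow> j < 3 \<Longrightarrow> xi i (e j) = of_bool (i = j)"
    and dual_W: "i < 3 \<Longrightarrow> j < 3 \<Longrightarrow> eta i (f j) = of_bool (i = j)"
begin

definition triple :: "real \<Rightarrow> real \<Rightarrow> real \<Rightarrow> nat \<Rightarrow> real" where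
  "triple x1 x2 x3 = (\<lambda>i. if i = 0 then x1 else if i = 1 then x2 else x3)"

definition product_point :: "real \<Rightarrow> real \<Rightarrow> real \<Rightarrow> real \<Rightarrow> real \<Rightarrow> real \<Rightarrow> 'c" where
  "product_point x1 x2 x3 y1 y2 y3 =
     t (sV (V.vec (triple x1 x2 x3)) (V.vec (triple x1 x2 x3))) (sW (W.vec (triple y1 y2 y3)) (W.vec (triple y1 y2 y3)))"

lemma sum_lessThan_3: "(\<Sum>i<3. h i) = h 0 + h 1 + h (2::nat)"
  by (simp add: numeral_3_eq_3 numeral_2_eq_2)

lemma xi_vec: "i < 3 \<Longrightarrow> xi i (V.vec c) = c i"
proof -
  assume "i < 3"
  then have "{..<3} \<inter> {j. i = j} = {i}" by auto
  then show ?thesis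
    using \<open>i < 3\<close> by (simp add: V.vec_def linear_sum[OF V.xi_linear] linear_cmul[OF V.xi_linear] dual_V)
qed

lemma eta_vec: "i < 3 \<Longrightarrow> eta i (W.vec c) = c i"
proof -
  assume "i < 3"
  then have "{..<3} \<inter> {j. i = j} = {i}" by auto
  then show ?thesis
    using \<open>i < 3\<close> by (simp add: W.vec_def linear_sum[OF W.xi_linear] linear_cmul[OF W.xi_linear] dual_W)
qed

definition ten_zero_functional :: "'c \<Rightarrow> real" where
  "ten_zero_functional z = tau 0 0 0 0 z + tau 1 1 1 1 z + tau 2 2 2 2 z + tau 0 0 1 1 z + tau 1 1 2 2 z + tau 2 2 0 0 z
     + 4 * (tau 0 0 2 2 z + tau 1 1 0 0 z + tau 2 2 1 1 z)
     - 6 * (tau 0 1 0 1 z + tau 1 2 1 2 z + tau 0 2 0 2 z)"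

definition selecting_functional :: "'c \<Rightarrow> real" where
  "selecting_functional z = 2 * (tau 0 1 0 1 z + tau 1 2 1 2 z + tau 0 2 0 2 z)
     - (tau 0 0 0 0 z + tau 1 1 1 1 z + tau 2 2 2 2 z)
     + 3 * (tau 0 1 2 2 z + tau 0 2 1 1 z + tau 1 2 0 0 z)"

lemma ten_zero_functional_linear: "linear ten_zero_functional"
  by (simp add: ten_zero_functional_def[abs_def] linear_iff linear_add[OF tau_linear] linear_cmul[OF tau_linear] algebra_simps)

lemma selecting_functional_linear: "linear selecting_functional"
  by (simp add: selecting_functional_def[abs_def] linear_iff linear_add[OF tau_linear] linear_cmul[OF tau_linear] algebra_simps)

lemma ten_zero_functional_generator:
  "ten_zero_functional (t (sV v v) (sW w w)) = ten_zero_form (xi 0 v) (xi 1 v) (xi 2 v) (eta 0 w) (eta 1 w) (eta 2 w)"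
  by (simp add: ten_zero_functional_def tau_generator ten_zero_form_def power2_eq_square algebra_simps)

lemma selecting_functional_generator:
  "selecting_functional (t (sV v v) (sW w w)) = selecting_form (xi 0 v) (xi 1 v) (xi 2 v) (eta 0 w) (eta 1 w) (eta 2 w)"
  by (simp add: selecting_functional_def tau_generator selecting_form_def power2_eq_square algebra_simps)

lemma ten_zero_functional_point: "ten_zero_functional (product_point x1 x2 x3 y1 y2 y3) = ten_zero_form x1 x2 x3 y1 y2 y3"
  and selecting_functional_point: "selecting_functional (product_point x1 x2 x3 y1 y2 y3) = selecting_form x1 x2 x3 y1 y2 y3"
  by (simp_all add: product_point_def ten_zero_functional_generator selecting_functional_generator xi_vec eta_vec triple_def)

lemma product_point_in_cone: "product_point x1 x2 x3 y1 y2 y3 \<in> separable_cone"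
  unfolding product_point_def by (rule generator_in_tensor_cone)

text \<open>
  The pair of functionals is lexicographically nonnegative on products of squares, and the
  lexicographically nonnegative elements form a convex cone. So \<open>selecting_functional\<close> supports the face on which
  \<open>ten_zero_functional\<close> vanishes, although it is negative elsewhere on the cone.
\<close>

lemma lexicographically_nonneg:
  assumes "z \<in> separable_cone"
  shows "0 \<le> ten_zero_functional z" "ten_zero_functional z = 0 \<Longrightarrow> 0 \<le> selecting_functional z"
proof -
  let ?S = "{z. 0 \<le> ten_zero_functional z \<and> (ten_zero_functional z = 0 \<longrightarrow> 0 \<le> selecting_functional z)}"
  have "convex_cone ?S"
    unfolding convex_cone_iff
    by (auto simp: linear_0[OF ten_zero_functional_linear] linear_0[OF selecting_functional_linear] linear_add[OF ten_zero_functional_linear]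
        linear_add[OF selecting_functional_linear] linear_cmul[OF ten_zero_functional_linear] linear_cmul[OF selecting_functional_linear] add_nonneg_eq_0_iff)
  then have "separable_cone \<subseteq> ?S"
    by (rule tensor_cone_subset) (use ten_zero_form_nonneg in \<open>simp add: ten_zero_functional_generator selecting_functional_generator\<close>)
  then show "0 \<le> ten_zero_functional z" "ten_zero_functional z = 0 \<Longrightarrow> 0 \<le> selecting_functional z" using assms by auto
qed

text \<open>
  The sum over the nine zeros other than \<open>x = y = (1, 1, 1)\<close>, so a relative interior point of the face that they span.
\<close>

definition face_point :: 'c where
  "face_point = product_point 1 1 (-1) 1 1 (-1) + product_point (-1) 1 1 (-1) 1 1 + product_point 1 (-1) 1 1 (-1) 1
     + (product_point 1 0 (sqrt 2) (sqrt 2) 0 1 + product_point (sqrt 2) 1 0 1 (sqrt 2) 0 + product_point 0 (sqrt 2) 1 0 1 (sqrt 2))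
     + (product_point 1 0 (- sqrt 2) (- sqrt 2) 0 1 + product_point (- sqrt 2) 1 0 1 (- sqrt 2) 0 + product_point 0 (- sqrt 2) 1 0 1 (- sqrt 2))"

lemma face_point: "face_point \<in> separable_cone" "ten_zero_functional face_point = 0" "selecting_functional face_point = 0"
proof -
  show "face_point \<in> separable_cone"
    unfolding face_point_def by (intro convex_cone_add[OF convex_cone_tensor_cone] product_point_in_cone)
  show "ten_zero_functional face_point = 0" "selecting_functional face_point = 0"
    by (simp_all add: face_point_def linear_add[OF ten_zero_functional_linear] linear_add[OF selecting_functional_linear] ten_zero_functional_point selecting_functional_point
        ten_zero_form_def selecting_form_def)
qed

text \<open>
  The nine zeros are permuted by cyclic shifts and the tenth is fixed, so the biquadratic form of the
  functional may be replaced by the sum \<open>Q\<close> of its three shifts.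
\<close>

lemma functional_vanishes:
  assumes h: "linear h" and nn: "\<And>c. c \<in> separable_cone \<Longrightarrow> 0 \<le> h c" and z: "h face_point = 0"
  shows "h (product_point 1 1 1 1 1 1) = (0::real)"
proof -
  define K where "K = (\<lambda>i j k l. h (t (sV (e i) (e j)) (sW (f k) (f l))))"
  have Ks: "K 1 0 k l = K 0 1 k l" "K 2 0 k l = K 0 2 k l" "K 2 1 k l = K 1 2 k l"
      "K i j 1 0 = K i j 0 1" "K i j 2 0 = K i j 0 2" "K i j 2 1 = K i j 1 2" for i j k l
    by (simp_all add: K_def V.comm[of "e 1" "e 0"] V.comm[of "e 2" "e 0"] V.comm[of "e 2" "e 1"]
        W.comm[of "f 1" "f 0"] W.comm[of "f 2" "f 0"] W.comm[of "f 2" "f 1"] del: One_nat_def)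
  define q where "q = (\<lambda>x1 x2 x3 y1 y2 y3. h (product_point x1 x2 x3 y1 y2 y3))"
  define R where "R = (\<lambda>i j y1 y2 y3. y1\<^sup>2 * K i j 0 0 + y2\<^sup>2 * K i j 1 1 + y3\<^sup>2 * K i j 2 2
      + 2 * (y1 * y2) * K i j 0 1 + 2 * (y1 * y3) * K i j 0 2 + 2 * (y2 * y3) * K i j 1 2)"
  have q: "q x1 x2 x3 y1 y2 y3 = x1\<^sup>2 * R 0 0 y1 y2 y3 + x2\<^sup>2 * R 1 1 y1 y2 y3 + x3\<^sup>2 * R 2 2 y1 y2 y3
      + 2 * (x1 * x2) * R 0 1 y1 y2 y3 + 2 * (x1 * x3) * R 0 2 y1 y2 y3 + 2 * (x2 * x3) * R 1 2 y1 y2 y3"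
    for x1 x2 x3 y1 y2 y3
  proof -
    let ?x = "triple x1 x2 x3" and ?y = "triple y1 y2 y3"
    have R: "(\<Sum>k<3. \<Sum>l<3. ?y k * ?y l * K i j k l) = R i j y1 y2 y3" for i j
      unfolding sum_lessThan_3 R_def Ks
      by (simp add: triple_def power2_eq_square algebra_simps del: One_nat_def)
    have Rs: "R 1 0 = R 0 1" "R 2 0 = R 0 2" "R 2 1 = R 1 2" by (simp_all only: R_def Ks)
    have "q x1 x2 x3 y1 y2 y3 = (\<Sum>i<3. \<Sum>j<3. \<Sum>k<3. \<Sum>l<3. (?x i * ?x j) * (?y k * ?y l * K i j k l))"
      unfolding q_def product_point_def generator_vec K_def by (simp add: linear_sum[OF h] linear_cmul[OF h] mult.assoc)
    also have "\<dots> = (\<Sum>i<3. \<Sum>j<3. (?x i * ?x j) * R i j y1 y2 y3)"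
      by (simp only: sum_distrib_left[symmetric] R)
    also have "\<dots> = x1\<^sup>2 * R 0 0 y1 y2 y3 + x2\<^sup>2 * R 1 1 y1 y2 y3 + x3\<^sup>2 * R 2 2 y1 y2 y3
      + 2 * (x1 * x2) * R 0 1 y1 y2 y3 + 2 * (x1 * x3) * R 0 2 y1 y2 y3 + 2 * (x2 * x3) * R 1 2 y1 y2 y3"
      unfolding sum_lessThan_3 Rs
      by (simp add: triple_def power2_eq_square algebra_simps del: One_nat_def)
    finally show ?thesis .
  qed
  define Q where "Q = cyclic_form
     (K 0 0 0 0 + K 1 1 1 1 + K 2 2 2 2) (K 0 0 1 1 + K 1 1 2 2 + K 2 2 0 0) (K 0 0 2 2 + K 1 1 0 0 + K 2 2 1 1)
     (2 * (K 0 0 1 2 + K 1 1 0 2 + K 2 2 0 1)) (2 * (K 0 0 0 1 + K 1 1 1 2 + K 2 2 0 2)) (2 * (K 0 0 0 2 + K 1 1 0 1 + K 2 2 1 2))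
     (2 * (K 1 2 0 0 + K 0 2 1 1 + K 0 1 2 2)) (2 * (K 1 2 1 1 + K 0 2 2 2 + K 0 1 0 0)) (2 * (K 1 2 2 2 + K 0 2 0 0 + K 0 1 1 1))
     (4 * (K 0 1 0 1 + K 1 2 1 2 + K 0 2 0 2)) (4 * (K 0 1 1 2 + K 1 2 0 2 + K 0 2 0 1)) (4 * (K 0 1 0 2 + K 1 2 0 1 + K 0 2 1 2))"
  have Q: "Q x1 x2 x3 y1 y2 y3 = q x1 x2 x3 y1 y2 y3 + q x3 x1 x2 y3 y1 y2 + q x2 x3 x1 y2 y3 y1"
    for x1 x2 x3 y1 y2 y3
    unfolding q R_def Q_def cyclic_form_def
    by (simp add: algebra_simps del: One_nat_def)
  have q_nn: "0 \<le> q x1 x2 x3 y1 y2 y3" for x1 x2 x3 y1 y2 y3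
    unfolding q_def by (intro nn product_point_in_cone)
  have "q 1 1 (-1) 1 1 (-1) + q (-1) 1 1 (-1) 1 1 + q 1 (-1) 1 1 (-1) 1
     + (q 1 0 (sqrt 2) (sqrt 2) 0 1 + q (sqrt 2) 1 0 1 (sqrt 2) 0 + q 0 (sqrt 2) 1 0 1 (sqrt 2))
     + (q 1 0 (- sqrt 2) (- sqrt 2) 0 1 + q (- sqrt 2) 1 0 1 (- sqrt 2) 0 + q 0 (- sqrt 2) 1 0 1 (- sqrt 2)) = 0"
    using z by (simp add: face_point_def linear_add[OF h] q_def)
  then have Q0: "Q 1 1 (-1) 1 1 (-1) + Q 1 0 (sqrt 2) (sqrt 2) 0 1 + Q 1 0 (- sqrt 2) (- sqrt 2) 0 1 = 0"
    unfolding Q by linarith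
  have Q_nn: "0 \<le> Q x1 x2 x3 y1 y2 y3" for x1 x2 x3 y1 y2 y3
    unfolding Q by (intro add_nonneg_nonneg q_nn)
  have sum_zero: "a = 0 \<and> b = 0 \<and> c = 0" if "0 \<le> a" "0 \<le> b" "0 \<le> c" "a + b + c = 0" for a b c :: real
    using that by linarith
  have Qz: "Q 1 1 (-1) 1 1 (-1) = 0" "Q 1 0 (sqrt 2) (sqrt 2) 0 1 = 0" "Q 1 0 (- sqrt 2) (- sqrt 2) 0 1 = 0"
    using sum_zero[OF Q_nn Q_nn Q_nn Q0] by blast+
  have "Q 1 0 r r 0 1 = 0" if "r\<^sup>2 = 2" for r
  proof -
    have "r = sqrt 2 \<or> r = - sqrt 2" using that power2_eq_iff[of r "sqrt 2"] by simp
    then show ?thesis using Qz by blast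
  qed
  then have "Q 1 1 1 1 1 1 = 0"
    unfolding Q_def by (rule cyclic_form_vanishes[OF Q_nn[unfolded Q_def] Qz(1)[unfolded Q_def]])
  then show ?thesis unfolding Q by (simp add: q_def)
qed

theorem separable_cone_nonexposed_face:
  "\<exists>F. cone_face separable_cone F \<and> \<not> exposed_cone_face separable_cone F"
proof -
  let ?F = "{z \<in> separable_cone. ten_zero_functional z = 0 \<and> selecting_functional z = 0}"
  have "convex_cone ?F"
    using convex_cone_tensor_cone unfolding convex_cone_iff
    by (auto simp: linear_0[OF ten_zero_functional_linear] linear_0[OF selecting_functional_linear] linear_add[OF ten_zero_functional_linear]
        linear_add[OF selecting_functional_linear] linear_cmul[OF ten_zero_functional_linear] linear_cmul[OF selecting_functional_linear])
  moreover have "c1 \<in> ?F \<and> c2 \<in> ?F"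
    if c: "c1 \<in> separable_cone" "c2 \<in> separable_cone" "c1 + c2 \<in> ?F" for c1 c2
  proof -
    have "ten_zero_functional c1 + ten_zero_functional c2 = 0" "selecting_functional c1 + selecting_functional c2 = 0"
      using c(3) by (simp_all add: linear_add[OF ten_zero_functional_linear] linear_add[OF selecting_functional_linear])
    moreover have "ten_zero_functional c1 = 0" "ten_zero_functional c2 = 0"
      using calculation(1) lexicographically_nonneg(1) c(1,2) by (smt (verit))+
    ultimately show ?thesis
      using lexicographically_nonneg(2) c(1,2) by (smt (verit) mem_Collect_eq)
  qed
  ultimately have face: "cone_face separable_cone ?F" unfolding cone_face_def by blast
  have "\<not> exposed_cone_face separable_cone ?F"
  proof
    assume "exposed_cone_face separable_cone ?F"
    then obtain h :: "'c \<Rightarrow> real" where h: "linear h" "\<forall>c\<in>separable_cone. 0 \<le> h c"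
      and F: "?F = separable_cone \<inter> {x. h x = 0}" unfolding exposed_cone_face_def by blast
    have "face_point \<in> ?F" using face_point by simp
    then have "h face_point = 0" using F by blast
    then have "h (product_point 1 1 1 1 1 1) = 0" using functional_vanishes[of h] h by blast
    then have "product_point 1 1 1 1 1 1 \<in> ?F" using F product_point_in_cone by blast
    then show False by (simp add: selecting_functional_point selecting_form_def)
  qed
  then show ?thesis using face by blast
qed

text \<open>
  Moving from \<open>face_point\<close> away from the tenth product makes \<open>selecting_functional\<close> negative, so it leaves the
  cone, contrary to \<open>spectrahedron_cone_continues\<close>.
\<close>

theorem separable_cone_not_spectrahedron: "\<not> spectrahedron separable_cone"
proof
  assume "spectrahedron separable_cone"
  then obtain c where c: "c > 0" "face_point - c *\<^sub>R product_point 1 1 1 1 1 1 \<in> separable_cone"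
    using spectrahedron_cone_continues[of separable_cone face_point "product_point 1 1 1 1 1 1"]
      convex_cone_tensor_cone face_point(1) product_point_in_cone functional_vanishes by blast
  have "ten_zero_functional (face_point - c *\<^sub>R product_point 1 1 1 1 1 1) = 0"
    using face_point(2) by (simp add: linear_diff[OF ten_zero_functional_linear] linear_cmul[OF ten_zero_functional_linear] ten_zero_functional_point ten_zero_form_def)
  then have "0 \<le> selecting_functional (face_point - c *\<^sub>R product_point 1 1 1 1 1 1)" using lexicographically_nonneg(2)[OF c(2)] by blast
  also have "\<dots> = - (c * 12)"
    using face_point(3) by (simp add: linear_diff[OF selecting_functional_linear] linear_cmul[OF selecting_functional_linear] selecting_functional_point selecting_form_def)
  finally show False using c(1) by simp
qed

end

section \<open>The three cones in low dimensions\<close>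

lemma is_tensor_product_swap:
  assumes "is_tensor_product t"
  shows "is_tensor_product (\<lambda>b a. t a b)"
  unfolding is_tensor_product_def
proof (intro conjI allI impI)
  show "bilinear (\<lambda>b a. t a b)" using assms by (auto simp: is_tensor_product_def bilinear_def)
  fix b :: "'b \<Rightarrow> 'a \<Rightarrow> real"
  assume "bilinear b"
  then have "bilinear (\<lambda>x y. b y x)" by (auto simp: bilinear_def)
  then have "\<exists>!h. linear h \<and> (\<forall>x y. h (t x y) = b y x)"
    using assms unfolding is_tensor_product_def by blast
  moreover have "(\<forall>x y. h (t x y) = b y x) = (\<forall>x y. h (t y x) = b x y)" for h :: "'c \<Rightarrow> real" by blast
  ultimately show "\<exists>!h. linear h \<and> (\<forall>x y. h (t y x) = b x y)" by simp
qed

lemma tensor_cone_swap: "tensor_cone (\<lambda>b a. t a b) C2 C1 = tensor_cone t C1 C2"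
  unfolding tensor_cone_def by (rule arg_cong[where f = "\<lambda>S. convex_cone hull S"]) blast

theorem theorem6p2:
  fixes sV :: "'v::real_vector \<Rightarrow> 'v \<Rightarrow> 'a::real_normed_vector"
    and sW :: "'w::real_vector \<Rightarrow> 'w \<Rightarrow> 'b::real_normed_vector"
    and s2 :: "'a \<Rightarrow> 'a \<Rightarrow> 'd::real_vector"
    and t :: "'a \<Rightarrow> 'b \<Rightarrow> 'c::real_normed_vector"
    and m n :: nat
  assumes "has_dimension TYPE('v) m"
    and "has_dimension TYPE('w) n"
    and "is_symmetric_square sV"
    and "is_symmetric_square sW"
    and "is_symmetric_square s2"
    and "is_tensor_product t"
  shows "(min m n \<le> 2 \<longrightarrow>
            SDR_set (hom_cone (psd_cone sV) (psd_cone sW)) \<and>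
            (m \<le> 2 \<longrightarrow> SDR_set (sym2_cone s2 (psd_cone sV))) \<and>
            spectrahedral_cone (tensor_cone t (psd_cone sV) (psd_cone sW))) \<and>
         (m = 3 \<and> n = 3 \<longrightarrow>
            (\<exists>F. cone_face (tensor_cone t (psd_cone sV) (psd_cone sW)) F \<and>
                 \<not> exposed_cone_face (tensor_cone t (psd_cone sV) (psd_cone sW)) F) \<and>
            \<not> spectrahedron (tensor_cone t (psd_cone sV) (psd_cone sW)))"
proof -
  obtain e xi mu where V: "sym_square_coords sV m e xi mu"
    and dV: "\<forall>i<m. \<forall>j<m. xi i (e j) = of_bool (i = j)"
    using sym_square_coords_exist[OF assms(1) order_refl assms(3)] by blast
  obtain f eta nu where W: "sym_square_coords sW n f eta nu"
    and dW: "\<forall>i<n. \<forall>j<n. eta i (f j) = of_bool (i = j)"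
    using sym_square_coords_exist[OF assms(2) order_refl assms(4)] by blast
  have small_V: "SDR_set (hom_cone (psd_cone sV) (psd_cone sW)) \<and>
      SDR_set (sym2_cone s2 (psd_cone sV)) \<and>
      spectrahedral_cone (tensor_cone t (psd_cone sV) (psd_cone sW))" if "m \<le> 2"
  proof -
    obtain e' xi' mu' where V2: "sym_square_coords sV 2 e' xi' mu'"
      using sym_square_coords_exist[OF assms(1) \<open>m \<le> 2\<close> assms(3)] by blast
    obtain tau where "tensor_coords sV 2 e' xi' mu' sW n f eta nu t tau"
      using tensor_coords_exist[OF V2 W assms(6)] by blast
    then show ?thesis
      using SDR_set_hom_cone[OF V2 W] SDR_set_sym2_cone[OF V2 assms(5)] spectrahedral_separable_cone by blast
  qed
  have small_W: "SDR_set (hom_cone (psd_cone sV) (psd_cone sW)) \<and>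
      spectrahedral_cone (tensor_cone t (psd_cone sV) (psd_cone sW))" if "n \<le> 2"
  proof -
    obtain f' eta' nu' where W2: "sym_square_coords sW 2 f' eta' nu'"
      using sym_square_coords_exist[OF assms(2) \<open>n \<le> 2\<close> assms(4)] by blast
    obtain tau where "tensor_coords sW 2 f' eta' nu' sV m e xi mu (\<lambda>b a. t a b) tau"
      using tensor_coords_exist[OF W2 V is_tensor_product_swap[OF assms(6)]] by blast
    then have "spectrahedral_cone (tensor_cone (\<lambda>b a. t a b) (psd_cone sW) (psd_cone sV))"
      by (rule spectrahedral_separable_cone)
    then have "spectrahedral_cone (tensor_cone t (psd_cone sV) (psd_cone sW))"
      unfolding tensor_cone_swap[of t "psd_cone sW" "psd_cone sV"] .
    then show ?thesis using SDR_set_hom_cone[OF V W2] by blast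
  qed
  have three: "(\<exists>F. cone_face (tensor_cone t (psd_cone sV) (psd_cone sW)) F \<and>
                 \<not> exposed_cone_face (tensor_cone t (psd_cone sV) (psd_cone sW)) F) \<and>
            \<not> spectrahedron (tensor_cone t (psd_cone sV) (psd_cone sW))" if "m = 3" "n = 3"
  proof -
    obtain tau where "tensor_coords sV 3 e xi mu sW 3 f eta nu t tau"
      using tensor_coords_exist[OF V W assms(6)] unfolding \<open>m = 3\<close> \<open>n = 3\<close> by blast
    then interpret tensor_coords_3 sV e xi mu sW f eta nu t tau
      by (rule tensor_coords_3.intro) (use dV dW that in \<open>simp add: tensor_coords_3_axioms_def\<close>)
    show ?thesis using separable_cone_nonexposed_face separable_cone_not_spectrahedron by blast
  qed
  show ?thesis using small_V small_W three by (auto simp: min_le_iff_disj)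
qed

end
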